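(* Let $G$ be an ordered groupoid and let $\mathcal{A}$ be a $G$-module. Then, for $n>0$, we have $$H^n (G^I,\mathcal{A}^0) \cong \operatorname{Ext}_{\mathfrak{L}(G)}^{n-1} (KG,\mathcal{A}).$$
   Context: **Ordered groupoids.** A groupoid $G$ is a small category with all morphisms invertible, composed left to right; identities are identified with objects and form the set $G_0$. For an arrow $g$, $g\mathbf d=gg^{-1}$ is its start and $g\mathbf r=g^{-1}g$ its end. An ordered groupoid is a groupoid with a partial order $\leq$ on arrows such that: (OG1) $x\leq y\Rightarrow x^{-1}\leq y^{-1}$; (OG2) if $x\leq y$, $u\leq v$ and $xu,yv$ exist then $xu\leq yv$; (OG3) if $e\in G_0$, $e\leq x\mathbf d$, there is a unique $(e|x)\leq x$ with $(e|x)\mathbf d=e$ (restriction); (OG4) if $e\in G_0$, $e\leq x\mathbf r$, there is a unique $(x|e)\leq x$ with $(x|e)\mathbf r=e$ (corestriction). **Modules.** $\mathfrak L(G)$ is the category with objects $G_0$ and morphisms $(e,g)$, $e\in G_0$, $g\in G$, $g\mathbf d\leq e$, from $e$ to $g\mathbf r$, with $(e,g)(f,h)=(e,(g|h\mathbf d)h)$ when $g\mathbf r=f$. A $G$-module is a functor $\mathcal A:\mathfrak L(G)\to\mathbf{Ab}$, $e\mapsto A_e$; $\operatorname{Mod}_{\mathfrak L(G)}$ is the category of $G$-modules and natural transformations, and $\operatorname{Ext}_{\mathfrak L(G)}$ is computed there. **Augmentation module.** $\mathbb ZG$ is the $G$-module with $(\mathbb ZG)_e$ the free abelian group on $\{g\in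 G:g^{-1}g=e\}$; an arrow $g\in G(e,y)$ induces $(\mathbb ZG)_e\to(\mathbb ZG)_y$, $h\mapsto hg$, and for identities $f\leq e$ the morphism $(e,f)$ induces $g\mapsto(g|f)$. $KG$ is the kernel of the augmentation $G$-map $\mathbb ZG\to\Delta\mathbb Z$, $\sum n_gg\mapsto\sum n_g$, where $\Delta\mathbb Z$ is the constant module at $\mathbb Z$. **Cohomology.** $G^I=G\cup\{I\}$ with $I\notin G$ a new identity and $e\leq I$ for all $e\in G_0$; this is an ordered groupoid. $\mathcal A^0$ is the $G^I$-module extending $\mathcal A$ by $\mathcal A^0_I=\{0\}$. For any ordered groupoid $H$ and $H$-module $\mathcal B$, $H^n(H,\mathcal B)=\operatorname{Ext}^n_{\mathfrak L(H)}(\Delta\mathbb Z,\mathcal B)$. *)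

theory Defs
  imports "HOL-Algebra.Free_Abelian_Groups" "HOL-Algebra.Weak_Morphisms"
begin

section \<open>Small categories\<close>

text \<open>Composition is written in diagrammatic order: \<open>Cmp C f g\<close> is \<open>f\<close> followed by
  \<open>g\<close>, meaningful when \<open>Cod C f = Dom C g\<close>.\<close>

record ('o, 'm) cat =
  Obj :: "'o set"
  Mor :: "'m set"
  Dom :: "'m \<Rightarrow> 'o"
  Cod :: "'m \<Rightarrow> 'o"
  Idt :: "'o \<Rightarrow> 'm"
  Cmp :: "'m \<Rightarrow> 'm \<Rightarrow> 'm"

locale category =
  fixes C :: "('o, 'm, 'z) cat_scheme"
  assumes Dom_in: "f \<in> Mor C \<Longrightarrow> Dom C f \<in> Obj C"
    and Cod_in: "f \<in> Mor C \<Longrightarrow> Cod C f \<in> Obj C"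
    and Idt_in: "e \<in> Obj C \<Longrightarrow> Idt C e \<in> Mor C"
    and Dom_Idt: "e \<in> Obj C \<Longrightarrow> Dom C (Idt C e) = e"
    and Cod_Idt: "e \<in> Obj C \<Longrightarrow> Cod C (Idt C e) = e"
    and Cmp_in: "\<lbrakk>f \<in> Mor C; g \<in> Mor C; Cod C f = Dom C g\<rbrakk> \<Longrightarrow> Cmp C f g \<in> Mor C"
    and Dom_Cmp: "\<lbrakk>f \<in> Mor C; g \<in> Mor C; Cod C f = Dom C g\<rbrakk> \<Longrightarrow> Dom C (Cmp C f g) = Dom C f"
    and Cod_Cmp: "\<lbrakk>f \<in> Mor C; g \<in> Mor C; Cod C f = Dom C g\<rbrakk> \<Longrightarrow> Cod C (Cmp C f g) = Cod C g"
    and Idt_Cmp: "f \<in> Mor C \<Longrightarrow> Cmp C (Idt C (Dom C f)) f = f"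
    and Cmp_Idt: "f \<in> Mor C \<Longrightarrow> Cmp C f (Idt C (Cod C f)) = f"
    and Cmp_assoc:
      "\<lbrakk>f \<in> Mor C; g \<in> Mor C; h \<in> Mor C; Cod C f = Dom C g; Cod C g = Dom C h\<rbrakk>
        \<Longrightarrow> Cmp C (Cmp C f g) h = Cmp C f (Cmp C g h)"

section \<open>Ordered groupoids\<close>

text \<open>Identities are identified with objects, so \<open>Obj G\<close> is the set \<open>G\<^sub>0\<close> of identity
  arrows, and \<open>Dom G g\<close>, \<open>Cod G g\<close> are the arrows \<open>g g\<^sup>-\<^sup>1\<close>, \<open>g\<^sup>-\<^sup>1 g\<close>
  (lemmas \<open>Cmp_inv_right\<close>, \<open>Cmp_inv_left\<close>).\<close>

definition is_inverse :: "('o, 'm, 'z) cat_scheme \<Rightarrow> 'm \<Rightarrow> 'm \<Rightarrow> bool" where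
  "is_inverse G g h \<longleftrightarrow> h \<in> Mor G \<and> Dom G h = Cod G g \<and> Cod G h = Dom G g \<and>
     Cmp G g h = Idt G (Dom G g) \<and> Cmp G h g = Idt G (Cod G g)"

definition ginv :: "('o, 'm, 'z) cat_scheme \<Rightarrow> 'm \<Rightarrow> 'm" where
  "ginv G g = (THE h. is_inverse G g h)"

locale groupoid = category G for G :: "('a, 'a, 'z) cat_scheme" +
  assumes Idt_eq: "e \<in> Obj G \<Longrightarrow> Idt G e = e"
    and ex_inverse: "g \<in> Mor G \<Longrightarrow> \<exists>h. is_inverse G g h"

record 'a ordgpd = "('a, 'a) cat" +
  Le :: "'a \<Rightarrow> 'a \<Rightarrow> bool"

locale ordered_groupoid = groupoid G for G :: "'a ordgpd" +
  assumes Le_refl: "x \<in> Mor G \<Longrightarrow> Le G x x"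
    and Le_antisym: "\<lbrakk>x \<in> Mor G; y \<in> Mor G; Le G x y; Le G y x\<rbrakk> \<Longrightarrow> x = y"
    and Le_trans: "\<lbrakk>x \<in> Mor G; y \<in> Mor G; z \<in> Mor G; Le G x y; Le G y z\<rbrakk> \<Longrightarrow> Le G x z"
    and OG1: "\<lbrakk>x \<in> Mor G; y \<in> Mor G; Le G x y\<rbrakk> \<Longrightarrow> Le G (ginv G x) (ginv G y)"
    and OG2: "\<lbrakk>x \<in> Mor G; y \<in> Mor G; u \<in> Mor G; v \<in> Mor G; Le G x y; Le G u v;
        Cod G x = Dom G u; Cod G y = Dom G v\<rbrakk> \<Longrightarrow> Le G (Cmp G x u) (Cmp G y v)"
    and OG3: "\<lbrakk>e \<in> Obj G; x \<in> Mor G; Le G e (Dom G x)\<rbrakk>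
        \<Longrightarrow> \<exists>!y. y \<in> Mor G \<and> Le G y x \<and> Dom G y = e"
    and OG4: "\<lbrakk>e \<in> Obj G; x \<in> Mor G; Le G e (Cod G x)\<rbrakk>
        \<Longrightarrow> \<exists>!y. y \<in> Mor G \<and> Le G y x \<and> Cod G y = e"

text \<open>The corestriction \<open>(x|e)\<close>.\<close>

definition corestr :: "'a ordgpd \<Rightarrow> 'a \<Rightarrow> 'a \<Rightarrow> 'a" where
  "corestr G x e = (THE y. y \<in> Mor G \<and> Le G y x \<and> Cod G y = e)"

definition LCat :: "'a ordgpd \<Rightarrow> ('a, 'a \<times> 'a) cat" where
  "LCat G = \<lparr>
     Obj = Obj G,
     Mor = {(e, g). e \<in> Obj G \<and> g \<in> Mor G \<and> Le G (Dom G g) e},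
     Dom = (\<lambda>(e, g). e),
     Cod = (\<lambda>(e, g). Cod G g),
     Idt = (\<lambda>e. (e, e)),
     Cmp = (\<lambda>(e, g) (f, h). (e, Cmp G (corestr G g (Dom G h)) h))\<rparr>"

text \<open>The ordered groupoid \<open>G\<^sup>I\<close>; the new identity \<open>I\<close> is \<open>None\<close>.\<close>

fun adjI_cmp :: "'a ordgpd \<Rightarrow> 'a option \<Rightarrow> 'a option \<Rightarrow> 'a option" where
  "adjI_cmp G (Some x) (Some y) = Some (Cmp G x y)"
| "adjI_cmp G None y = y"
| "adjI_cmp G x None = x"

fun adjI_le :: "'a ordgpd \<Rightarrow> 'a option \<Rightarrow> 'a option \<Rightarrow> bool" where
  "adjI_le G (Some x) (Some y) \<longleftrightarrow> Le G x y"
| "adjI_le G (Some x) None \<longleftrightarrow> x \<in> Obj G"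
| "adjI_le G None None \<longleftrightarrow> True"
| "adjI_le G None (Some y) \<longleftrightarrow> False"

definition adjI :: "'a ordgpd \<Rightarrow> 'a option ordgpd" where
  "adjI G = \<lparr>
     Obj = insert None (Some ` Obj G),
     Mor = insert None (Some ` Mor G),
     Dom = map_option (Dom G),
     Cod = map_option (Cod G),
     Idt = map_option (Idt G),
     Cmp = adjI_cmp G,
     Le = adjI_le G\<rparr>"

section \<open>Modules over a small category\<close>

text \<open>A module over \<open>C\<close> is a functor from \<open>C\<close> to abelian groups: \<open>Grp M e\<close> is the
  value at the object \<open>e\<close>, written multiplicatively as in \<open>HOL-Algebra\<close>, and
  \<open>Act M c\<close> the map induced by the morphism \<open>c\<close>.\<close>

record ('o, 'm, 'u) cmodule =
  Grp :: "'o \<Rightarrow> 'u monoid"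
  Act :: "'m \<Rightarrow> 'u \<Rightarrow> 'u"

definition is_module :: "('o, 'm) cat \<Rightarrow> ('o, 'm, 'u) cmodule \<Rightarrow> bool" where
  "is_module C M \<longleftrightarrow>
     (\<forall>e\<in>Obj C. comm_group (Grp M e)) \<and>
     (\<forall>c\<in>Mor C. Act M c \<in> hom (Grp M (Dom C c)) (Grp M (Cod C c))) \<and>
     (\<forall>e\<in>Obj C. \<forall>x\<in>carrier (Grp M e). Act M (Idt C e) x = x) \<and>
     (\<forall>c\<in>Mor C. \<forall>d\<in>Mor C. Cod C c = Dom C d \<longrightarrow>
        (\<forall>x\<in>carrier (Grp M (Dom C c)). Act M (Cmp C c d) x = Act M d (Act M c x)))"

definition module_map ::
  "('o, 'm) cat \<Rightarrow> ('o, 'm, 'u) cmodule \<Rightarrow> ('o, 'm, 'v) cmodule \<Rightarrow> ('o \<Rightarrow> 'u \<Rightarrow> 'v) \<Rightarrow> bool"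
  where
  "module_map C M N \<eta> \<longleftrightarrow>
     (\<forall>e\<in>Obj C. \<eta> e \<in> hom (Grp M e) (Grp N e)) \<and>
     (\<forall>c\<in>Mor C. \<forall>x\<in>carrier (Grp M (Dom C c)).
        \<eta> (Cod C c) (Act M c x) = Act N c (\<eta> (Dom C c) x))"

definition surjective_map ::
  "('o, 'm) cat \<Rightarrow> ('o, 'm, 'u) cmodule \<Rightarrow> ('o, 'm, 'v) cmodule \<Rightarrow> ('o \<Rightarrow> 'u \<Rightarrow> 'v) \<Rightarrow> bool"
  where
  "surjective_map C M N \<eta> \<longleftrightarrow> module_map C M N \<eta> \<and>
     (\<forall>e\<in>Obj C. \<eta> e ` carrier (Grp M e) = carrier (Grp N e))"

definition kernel_module ::
  "('o, 'm, 'u) cmodule \<Rightarrow> ('o, 'm, 'v) cmodule \<Rightarrow> ('o \<Rightarrow> 'u \<Rightarrow> 'v) \<Rightarrow> ('o, 'm, 'u) cmodule"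
  where
  "kernel_module M N \<eta> = M\<lparr>Grp := \<lambda>e. (Grp M e)\<lparr>carrier := kernel (Grp M e) (Grp N e) (\<eta> e)\<rparr>\<rparr>"

text \<open>The abelian group of natural transformations. Maps are made extensional so that
  equality in this group is equality on the objects of \<open>C\<close> and the elements of \<open>M\<close>.\<close>

definition Hom_group ::
  "('o, 'm) cat \<Rightarrow> ('o, 'm, 'u) cmodule \<Rightarrow> ('o, 'm, 'v) cmodule \<Rightarrow> ('o \<Rightarrow> 'u \<Rightarrow> 'v) monoid"
  where
  "Hom_group C M N = \<lparr>
     carrier = {\<eta>. module_map C M N \<eta> \<and> \<eta> \<in> extensional (Obj C) \<and>
                   (\<forall>e\<in>Obj C. \<eta> e \<in> extensional (carrier (Grp M e)))},
     mult = (\<lambda>\<eta> \<theta>. \<lambda>e\<in>Obj C. \<lambda>x\<in>carrier (Grp M e). \<eta> e x \<otimes>\<^bsub>Grp N e\<^esub> \<theta> e x),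
     one = (\<lambda>e\<in>Obj C. \<lambda>x\<in>carrier (Grp M e). \<one>\<^bsub>Grp N e\<^esub>)\<rparr>"

section \<open>Projective resolutions and Ext\<close>

text \<open>HOL does not quantify over types inside a formula, so the lifting property is tested on
  the modules whose elements lie in the same type as those of \<open>P\<close>. Below it is only
  used at the type \<open>univ\<close>, which is closed under forming free modules (lemma
  \<open>free_cover\<close>): there a projective module is a direct summand of a free one and hence
  lifts against surjections between modules of arbitrary element types (lemma
  \<open>projective_lift\<close>).\<close>

definition projective :: "('o, 'm) cat \<Rightarrow> ('o, 'm, 'u) cmodule \<Rightarrow> bool" where
  "projective C P \<longleftrightarrow> is_module C P \<and>
     (\<forall>(M :: ('o, 'm, 'u) cmodule) (N :: ('o, 'm, 'u) cmodule) p f.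
        is_module C M \<longrightarrow> is_module C N \<longrightarrow> surjective_map C M N p \<longrightarrow> module_map C P N f \<longrightarrow>
        (\<exists>g. module_map C P M g \<and>
             (\<forall>e\<in>Obj C. \<forall>x\<in>carrier (Grp P e). p e (g e x) = f e x)))"

text \<open>\<open>Bdry R n\<close> is the differential from degree \<open>n + 1\<close> to degree \<open>n\<close>.\<close>

record ('o, 'm, 'u, 'v) resolution =
  Term :: "nat \<Rightarrow> ('o, 'm, 'u) cmodule"
  Bdry :: "nat \<Rightarrow> 'o \<Rightarrow> 'u \<Rightarrow> 'u"
  Aug :: "'o \<Rightarrow> 'u \<Rightarrow> 'v"

definition projective_resolution ::
  "('o, 'm) cat \<Rightarrow> ('o, 'm, 'v) cmodule \<Rightarrow> ('o, 'm, 'u, 'v) resolution \<Rightarrow> bool" where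
  "projective_resolution C M R \<longleftrightarrow>
     (\<forall>n. projective C (Term R n)) \<and>
     (\<forall>n. module_map C (Term R (Suc n)) (Term R n) (Bdry R n)) \<and>
     surjective_map C (Term R 0) M (Aug R) \<and>
     (\<forall>e\<in>Obj C. Bdry R 0 e ` carrier (Grp (Term R 1) e) =
        kernel (Grp (Term R 0) e) (Grp M e) (Aug R e)) \<and>
     (\<forall>n. \<forall>e\<in>Obj C. Bdry R (Suc n) e ` carrier (Grp (Term R (Suc (Suc n))) e) =
        kernel (Grp (Term R (Suc n)) e) (Grp (Term R n) e) (Bdry R n e))"

definition coboundary ::
  "('o, 'm) cat \<Rightarrow> ('o, 'm, 'u, 'v) resolution \<Rightarrow> nat \<Rightarrow> ('o \<Rightarrow> 'u \<Rightarrow> 'w) \<Rightarrow> ('o \<Rightarrow> 'u \<Rightarrow> 'w)"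
  where
  "coboundary C R n \<eta> =
     (\<lambda>e\<in>Obj C. \<lambda>x\<in>carrier (Grp (Term R (Suc n)) e). \<eta> e (Bdry R n e x))"

definition cocycles ::
  "('o, 'm) cat \<Rightarrow> ('o, 'm, 'u, 'v) resolution \<Rightarrow> ('o, 'm, 'w) cmodule \<Rightarrow> nat \<Rightarrow>
     ('o \<Rightarrow> 'u \<Rightarrow> 'w) set" where
  "cocycles C R N n =
     kernel (Hom_group C (Term R n) N) (Hom_group C (Term R (Suc n)) N) (coboundary C R n)"

fun coboundaries ::
  "('o, 'm) cat \<Rightarrow> ('o, 'm, 'u, 'v) resolution \<Rightarrow> ('o, 'm, 'w) cmodule \<Rightarrow> nat \<Rightarrow>
     ('o \<Rightarrow> 'u \<Rightarrow> 'w) set" where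
  "coboundaries C R N 0 = {\<one>\<^bsub>Hom_group C (Term R 0) N\<^esub>}"
| "coboundaries C R N (Suc n) = coboundary C R n ` carrier (Hom_group C (Term R n) N)"

definition cohomology_group ::
  "('o, 'm) cat \<Rightarrow> ('o, 'm, 'u, 'v) resolution \<Rightarrow> ('o, 'm, 'w) cmodule \<Rightarrow> nat \<Rightarrow>
     ('o \<Rightarrow> 'u \<Rightarrow> 'w) set monoid" where
  "cohomology_group C R N n =
     (Hom_group C (Term R n) N)\<lparr>carrier := cocycles C R N n\<rparr> Mod coboundaries C R N n"

text \<open>An element type large enough for a projective resolution of a module with elements of
  type \<open>'v\<close> over a category with morphisms of type \<open>'m\<close>: it contains \<open>'v\<close>
  and all formal integer combinations of pairs of one of its own elements and a morphism.\<close>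

datatype ('m, 'v) univ = Elt 'v | Comb "(int \<times> ('m, 'v) univ \<times> 'm) list"

text \<open>\<open>Ext\<^sup>n(M, N)\<close> is computed from a chosen projective resolution of \<open>M\<close>, which
  exists by lemma \<open>ex_projective_resolution\<close>.\<close>

definition Ext_resolution ::
  "('o, 'm) cat \<Rightarrow> ('o, 'm, 'v) cmodule \<Rightarrow> ('o, 'm, ('m, 'v) univ, 'v) resolution" where
  "Ext_resolution C M = (SOME R. projective_resolution C M R)"

definition Ext ::
  "('o, 'm) cat \<Rightarrow> nat \<Rightarrow> ('o, 'm, 'v) cmodule \<Rightarrow> ('o, 'm, 'w) cmodule \<Rightarrow>
     ('o \<Rightarrow> ('m, 'v) univ \<Rightarrow> 'w) set monoid" where
  "Ext C n M N = cohomology_group C (Ext_resolution C M) N n"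

section \<open>The modules of an ordered groupoid\<close>

definition constZ :: "('o, 'm, int) cmodule" where
  "constZ = \<lparr>Grp = (\<lambda>_. integer_group), Act = (\<lambda>_ n. n)\<rparr>"

text \<open>The morphism \<open>(e, g)\<close> factors as \<open>(e, g\<^bold>d)\<close> followed by the arrow
  \<open>g\<close>, so it sends a basis element \<open>h\<close> to \<open>(h|g\<^bold>d)g\<close>. For \<open>e = g\<^bold>d\<close> this
  is \<open>hg\<close>, and for an identity \<open>g = f\<close> it is \<open>(h|f)\<close>.\<close>

definition ZG :: "'a ordgpd \<Rightarrow> ('a, 'a \<times> 'a, 'a \<Rightarrow>\<^sub>0 int) cmodule" where
  "ZG G = \<lparr>
     Grp = (\<lambda>e. free_Abelian_group {g \<in> Mor G. Cod G g = e}),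
     Act = (\<lambda>(e, g). frag_extend (\<lambda>h. frag_of (Cmp G (corestr G h (Dom G g)) g)))\<rparr>"

definition augmentation :: "'o \<Rightarrow> ('a \<Rightarrow>\<^sub>0 int) \<Rightarrow> int" where
  "augmentation e x = (\<Sum>g\<in>Poly_Mapping.keys x. Poly_Mapping.lookup x g)"

definition KG :: "'a ordgpd \<Rightarrow> ('a, 'a \<times> 'a, 'a \<Rightarrow>\<^sub>0 int) cmodule" where
  "KG G = kernel_module (ZG G) constZ augmentation"

text \<open>The \<open>G\<^sup>I\<close>-module \<open>A\<^sup>0\<close>. There is no morphism from an object of \<open>G\<close> to
  \<open>I\<close>; a morphism out of \<open>I\<close> induces the trivial map.\<close>

definition ext0 ::
  "'a ordgpd \<Rightarrow> ('a, 'a \<times> 'a, 'w) cmodule \<Rightarrow> ('a option, 'a option \<times> 'a option, 'w) cmodule"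
  where
  "ext0 G A = (let B = case_option (singleton_group undefined) (Grp A) in
     \<lparr>Grp = B,
      Act = (\<lambda>(e, g). case e of
          None \<Rightarrow> (\<lambda>_. \<one>\<^bsub>B (map_option (Cod G) g)\<^esub>)
        | Some e' \<Rightarrow> Act A (e', the g))\<rparr>)"

definition cohomology ::
  "'a ordgpd \<Rightarrow> nat \<Rightarrow> ('a, 'a \<times> 'a, 'w) cmodule \<Rightarrow>
     ('a \<Rightarrow> ('a \<times> 'a, int) univ \<Rightarrow> 'w) set monoid" where
  "cohomology G n A = Ext (LCat G) n constZ A"

section \<open>Existence of projective resolutions\<close>

lemma hom_free_eq:
  assumes H: "group H" and h: "h \<in> hom (free_Abelian_group S) H"
    and k: "k \<in> hom (free_Abelian_group S) H"
    and eq: "\<And>s. s \<in> S \<Longrightarrow> h (frag_of s) = k (frag_of s)"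
    and x: "Poly_Mapping.keys x \<subseteq> S"
  shows "h x = k x"
proof -
  interpret h: group_hom "free_Abelian_group S" H h
    using H h by (simp add: group_hom_def group_hom_axioms_def)
  interpret k: group_hom "free_Abelian_group S" H k
    using H k by (simp add: group_hom_def group_hom_axioms_def)
  have diff: "f (a - b) = f a \<otimes>\<^bsub>H\<^esub> inv\<^bsub>H\<^esub> (f b)"
    if f: "group_hom (free_Abelian_group S) H f"
      and "Poly_Mapping.keys a \<subseteq> S" "Poly_Mapping.keys b \<subseteq> S" for f a b
    using group_hom.hom_mult[OF f, of a "- b"] group_hom.hom_inv[OF f, of b] that by simp
  show ?thesis
    by (rule free_Abelian_group_induct[OF x])
      (simp_all add: diff h.group_hom_axioms k.group_hom_axioms eq
        h.hom_one[simplified] k.hom_one[simplified])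
qed

lemma frag_extend_hom:
  assumes "\<And>s. s \<in> S \<Longrightarrow> Poly_Mapping.keys (f s) \<subseteq> T"
  shows "frag_extend f \<in> hom (free_Abelian_group S) (free_Abelian_group T)"
proof (rule homI)
  fix x assume "x \<in> carrier (free_Abelian_group S)"
  then show "frag_extend f x \<in> carrier (free_Abelian_group T)"
    using keys_frag_extend[of f x] assms by fastforce
qed (simp add: frag_extend_add)

definition gens :: "('o, 'm) cat \<Rightarrow> ('o, 'm, 'u) cmodule \<Rightarrow> 'o \<Rightarrow> ('u \<times> 'm) set" where
  "gens C M e = {(m, c). c \<in> Mor C \<and> Cod C c = e \<and> m \<in> carrier (Grp M (Dom C c))}"

definition free_module :: "('o, 'm) cat \<Rightarrow> ('o, 'm, 'u) cmodule \<Rightarrow> ('o, 'm, 'u \<times> 'm \<Rightarrow>\<^sub>0 int) cmodule"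
  where
  "free_module C M = \<lparr>
     Grp = (\<lambda>e. free_Abelian_group (gens C M e)),
     Act = (\<lambda>d. frag_extend (\<lambda>(m, c). frag_of (m, Cmp C c d)))\<rparr>"

lemma Grp_free_module [simp]: "Grp (free_module C M) e = free_Abelian_group (gens C M e)"
  and Act_free_module: "Act (free_module C M) d = frag_extend (\<lambda>(m, c). frag_of (m, Cmp C c d))"
  by (simp_all add: free_module_def)

lemma Act_free_module_of [simp]:
  "Act (free_module C M) d (frag_of (m, c)) = frag_of (m, Cmp C c d)"
  by (simp add: Act_free_module)

lemma is_moduleD:
  assumes "is_module C M"
  shows "e \<in> Obj C \<Longrightarrow> comm_group (Grp M e)"
    and "e \<in> Obj C \<Longrightarrow> group (Grp M e)"
    and "c \<in> Mor C \<Longrightarrow> Act M c \<in> hom (Grp M (Dom C c)) (Grp M (Cod C c))"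
    and "\<lbrakk>e \<in> Obj C; x \<in> carrier (Grp M e)\<rbrakk> \<Longrightarrow> Act M (Idt C e) x = x"
    and "\<lbrakk>c \<in> Mor C; d \<in> Mor C; Cod C c = Dom C d; x \<in> carrier (Grp M (Dom C c))\<rbrakk>
        \<Longrightarrow> Act M (Cmp C c d) x = Act M d (Act M c x)"
    and "\<lbrakk>c \<in> Mor C; x \<in> carrier (Grp M (Dom C c))\<rbrakk> \<Longrightarrow> Act M c x \<in> carrier (Grp M (Cod C c))"
  using assms comm_group.axioms(2) by (auto simp: is_module_def hom_def Pi_iff)

lemma module_mapD:
  assumes "module_map C M N \<eta>"
  shows "e \<in> Obj C \<Longrightarrow> \<eta> e \<in> hom (Grp M e) (Grp N e)"
    and "\<lbrakk>c \<in> Mor C; x \<in> carrier (Grp M (Dom C c))\<rbrakk>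
        \<Longrightarrow> \<eta> (Cod C c) (Act M c x) = Act N c (\<eta> (Dom C c) x)"
    and "\<lbrakk>e \<in> Obj C; x \<in> carrier (Grp M e)\<rbrakk> \<Longrightarrow> \<eta> e x \<in> carrier (Grp N e)"
  using assms by (auto simp: module_map_def hom_def Pi_iff)

definition transport_group :: "('u \<Rightarrow> 'v) \<Rightarrow> 'u monoid \<Rightarrow> 'v monoid" where
  "transport_group i G = \<lparr>carrier = i ` carrier G,
     mult = (\<lambda>x y. i (inv_into UNIV i x \<otimes>\<^bsub>G\<^esub> inv_into UNIV i y)), one = i \<one>\<^bsub>G\<^esub>\<rparr>"

definition transport :: "('u \<Rightarrow> 'v) \<Rightarrow> ('o, 'm, 'u) cmodule \<Rightarrow> ('o, 'm, 'v) cmodule" where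
  "transport i M = \<lparr>Grp = (\<lambda>e. transport_group i (Grp M e)),
     Act = (\<lambda>c. i \<circ> Act M c \<circ> inv_into UNIV i)\<rparr>"

lemma comm_group_transport:
  assumes i: "inj i" and G: "comm_group G"
  shows "comm_group (transport_group i G)"
proof -
  interpret comm_group G by (rule G)
  show ?thesis
  proof (rule comm_groupI)
    fix x assume "x \<in> carrier (transport_group i G)"
    then show "\<exists>y\<in>carrier (transport_group i G).
        y \<otimes>\<^bsub>transport_group i G\<^esub> x = \<one>\<^bsub>transport_group i G\<^esub>"
    proof -
      obtain a where a: "a \<in> carrier G" "x = i a"
        using \<open>x \<in> carrier (transport_group i G)\<close> by (auto simp: transport_group_def)
      then show ?thesis
        using i by (intro bexI[of _ "i (m_inv G a)"]) (auto simp: transport_group_def)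
    qed
  qed (use i in \<open>auto simp: transport_group_def m_ac\<close>)
qed

lemma transport_homs:
  assumes "inj i"
  shows "i \<in> hom G (transport_group i G)" "inv_into UNIV i \<in> hom (transport_group i G) G"
  using assms by (auto simp: hom_def transport_group_def Pi_iff)

lemma carrier_transport_group [simp]: "carrier (transport_group i G) = i ` carrier G"
  by (simp add: transport_group_def)

text \<open>The type \<open>univ\<close> contains the free modules on modules with elements in \<open>univ\<close>.\<close>

definition decode :: "('m, 'v) univ \<Rightarrow> (('m, 'v) univ \<times> 'm \<Rightarrow>\<^sub>0 int)" where
  "decode u = (case u of Elt v \<Rightarrow> 0
     | Comb xs \<Rightarrow> sum_list (map (\<lambda>(k, s). frag_cmul k (frag_of s)) xs))"

lemma surj_decode: "surj decode"
proof -
  have "\<exists>xs. x = sum_list (map (\<lambda>(k, s). frag_cmul k (frag_of s)) xs)"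
    for x :: "('m, 'v) univ \<times> 'm \<Rightarrow>\<^sub>0 int"
  proof (rule frag_induction[of x UNIV])
    show "\<exists>xs. 0 = sum_list (map (\<lambda>(k, s). frag_cmul k (frag_of s)) xs)"
      by (rule exI[of _ "[]"]) simp
  next
    fix s :: "('m, 'v) univ \<times> 'm"
    show "\<exists>xs. frag_of s = sum_list (map (\<lambda>(k, s). frag_cmul k (frag_of s)) xs)"
      by (rule exI[of _ "[(1, s)]"]) simp
  next
    fix a b :: "('m, 'v) univ \<times> 'm \<Rightarrow>\<^sub>0 int"
    assume "\<exists>xs. a = sum_list (map (\<lambda>(k, s). frag_cmul k (frag_of s)) xs)"
      "\<exists>xs. b = sum_list (map (\<lambda>(k, s). frag_cmul k (frag_of s)) xs)"
    then obtain xs ys where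
      a: "a = sum_list (map (\<lambda>(k, s). frag_cmul k (frag_of s)) xs)" and
      b: "b = sum_list (map (\<lambda>(k, s). frag_cmul k (frag_of s)) ys)" by blast
    have "- sum_list (map (\<lambda>(k, s). frag_cmul k (frag_of s)) ys)
        = sum_list (map (\<lambda>(k, s). frag_cmul k (frag_of s)) (map (apfst uminus) ys))"
      by (induction ys) auto
    then show "\<exists>xs. a - b = sum_list (map (\<lambda>(k, s). frag_cmul k (frag_of s)) xs)"
      by (intro exI[of _ "xs @ map (apfst uminus) ys"]) (simp add: a b)
  qed simp
  then show ?thesis
    unfolding surj_def decode_def by (metis univ.simps(6))
qed

definition encode :: "(('m, 'v) univ \<times> 'm \<Rightarrow>\<^sub>0 int) \<Rightarrow> ('m, 'v) univ" where
  "encode = inv_into UNIV decode"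

lemma inj_encode: "inj encode"
  unfolding encode_def by (rule surj_imp_inj_inv[OF surj_decode])

definition free_cover :: "('o, 'm) cat \<Rightarrow> ('o, 'm, ('m, 'v) univ) cmodule
    \<Rightarrow> ('o, 'm, ('m, 'v) univ) cmodule" where
  "free_cover C M = transport encode (free_module C M)"

context
  fixes C :: "('o, 'm) cat"
  assumes C: "category C"
begin

interpretation category C by (rule C)

lemma module_map_comp:
  assumes f: "module_map C M N f" and g: "module_map C N P g"
  shows "module_map C M P (\<lambda>e. g e \<circ> f e)"
  unfolding module_map_def
proof (intro conjI ballI)
  fix e assume "e \<in> Obj C"
  then show "g e \<circ> f e \<in> hom (Grp M e) (Grp P e)"
    using f g by (auto intro: hom_compose module_mapD)
next
  fix c x assume "c \<in> Mor C" "x \<in> carrier (Grp M (Dom C c))"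
  then show "(g (Cod C c) \<circ> f (Cod C c)) (Act M c x) = Act P c ((g (Dom C c) \<circ> f (Dom C c)) x)"
    using f g by (simp add: module_mapD Dom_in)
qed

lemma Act_free_hom:
  assumes "d \<in> Mor C"
  shows "Act (free_module C M) d
    \<in> hom (free_Abelian_group (gens C M (Dom C d))) (free_Abelian_group (gens C M (Cod C d)))"
  unfolding Act_free_module
  by (rule frag_extend_hom) (use assms in \<open>auto simp: gens_def Cmp_in Dom_Cmp Cod_Cmp\<close>)

lemma is_module_free: "is_module C (free_module C M)"
  unfolding is_module_def
proof (intro conjI ballI impI)
  fix e x assume e: "e \<in> Obj C" and x: "x \<in> carrier (Grp (free_module C M) e)"
  have h: "Act (free_module C M) (Idt C e)
    \<in> hom (free_Abelian_group (gens C M e)) (free_Abelian_group (gens C M e))"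
    using Act_free_hom[OF Idt_in[OF e]] e by (simp add: Dom_Idt Cod_Idt)
  have i: "id \<in> hom (free_Abelian_group (gens C M e)) (free_Abelian_group (gens C M e))"
    by (simp only: group_hom_free_Abelian_groups_id order_refl)
  have "Act (free_module C M) (Idt C e) x = id x"
    by (rule hom_free_eq[OF group_free_Abelian_group h i])
      (use x e in \<open>auto simp: gens_def Cmp_Idt\<close>)
  then show "Act (free_module C M) (Idt C e) x = x" by simp
next
  fix c d x
  assume c: "c \<in> Mor C" and d: "d \<in> Mor C" and cd: "Cod C c = Dom C d"
    and x: "x \<in> carrier (Grp (free_module C M) (Dom C c))"
  have 1: "Act (free_module C M) (Cmp C c d)
    \<in> hom (free_Abelian_group (gens C M (Dom C c))) (free_Abelian_group (gens C M (Cod C d)))"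
    using Act_free_hom[OF Cmp_in[OF c d cd]] c d cd by (simp add: Dom_Cmp Cod_Cmp)
  have 2: "Act (free_module C M) d \<circ> Act (free_module C M) c
    \<in> hom (free_Abelian_group (gens C M (Dom C c))) (free_Abelian_group (gens C M (Cod C d)))"
    using Act_free_hom[OF c, of M] Act_free_hom[OF d, of M] cd by (auto intro: hom_compose)
  have "Act (free_module C M) (Cmp C c d) x = (Act (free_module C M) d \<circ> Act (free_module C M) c) x"
    by (rule hom_free_eq[OF group_free_Abelian_group 1 2])
      (use x c d cd in \<open>auto simp: gens_def Cmp_assoc\<close>)
  then show "Act (free_module C M) (Cmp C c d) x = Act (free_module C M) d (Act (free_module C M) c x)"
    by simp
qed (use Act_free_hom in \<open>auto simp: abelian_free_Abelian_group\<close>)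

lemma free_module_extend:
  assumes N: "is_module C N"
    and \<phi>: "\<And>e m. \<lbrakk>e \<in> Obj C; m \<in> carrier (Grp M e)\<rbrakk> \<Longrightarrow> \<phi> e m \<in> carrier (Grp N e)"
  shows "\<exists>g. module_map C (free_module C M) N g \<and>
    (\<forall>e\<in>Obj C. \<forall>m\<in>carrier (Grp M e). g e (frag_of (m, Idt C e)) = \<phi> e m)"
proof -
  define s where "s = (\<lambda>(m, c). Act N c (\<phi> (Dom C c) m))"
  have s: "s ` gens C M e \<subseteq> carrier (Grp N e)" if "e \<in> Obj C" for e
    using that by (auto simp: s_def gens_def intro!: is_moduleD(6)[OF N] \<phi> Dom_in)
  have "\<exists>h. h \<in> hom (free_Abelian_group (gens C M e)) (Grp N e) \<and>
      (\<forall>k\<in>gens C M e. h (frag_of k) = s k)" if "e \<in> Obj C" for e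
    using comm_group.free_Abelian_group_universal[OF is_moduleD(1)[OF N that] s[OF that]] by metis
  then obtain g where g: "\<And>e. e \<in> Obj C \<Longrightarrow> g e \<in> hom (free_Abelian_group (gens C M e)) (Grp N e)"
    and gs: "\<And>e k. \<lbrakk>e \<in> Obj C; k \<in> gens C M e\<rbrakk> \<Longrightarrow> g e (frag_of k) = s k"
    by metis
  have "module_map C (free_module C M) N g"
    unfolding module_map_def
  proof (intro conjI ballI)
    fix d x assume d: "d \<in> Mor C" and x: "x \<in> carrier (Grp (free_module C M) (Dom C d))"
    have 1: "g (Cod C d) \<circ> Act (free_module C M) d
      \<in> hom (free_Abelian_group (gens C M (Dom C d))) (Grp N (Cod C d))"
      by (rule hom_compose[OF Act_free_hom[OF d] g[OF Cod_in[OF d]]])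
    have 2: "Act N d \<circ> g (Dom C d)
      \<in> hom (free_Abelian_group (gens C M (Dom C d))) (Grp N (Cod C d))"
      by (rule hom_compose[OF g[OF Dom_in[OF d]] is_moduleD(3)[OF N d]])
    have "(g (Cod C d) \<circ> Act (free_module C M) d) x = (Act N d \<circ> g (Dom C d)) x"
    proof (rule hom_free_eq[OF is_moduleD(2)[OF N Cod_in[OF d]] 1 2])
      fix k assume k: "k \<in> gens C M (Dom C d)"
      obtain m c where mc: "k = (m, c)" by (cases k)
      have c: "c \<in> Mor C" "Cod C c = Dom C d" "m \<in> carrier (Grp M (Dom C c))"
        using k mc by (auto simp: gens_def)
      have "(m, Cmp C c d) \<in> gens C M (Cod C d)"
        using c d by (simp add: gens_def Cmp_in Dom_Cmp Cod_Cmp)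
      then have "g (Cod C d) (frag_of (m, Cmp C c d)) = Act N (Cmp C c d) (\<phi> (Dom C c) m)"
        using gs[OF Cod_in[OF d]] c d by (simp add: s_def Dom_Cmp)
      also have "\<dots> = Act N d (Act N c (\<phi> (Dom C c) m))"
        using c d by (intro is_moduleD(5)[OF N]) (auto intro: \<phi> Dom_in)
      also have "Act N c (\<phi> (Dom C c) m) = g (Dom C d) (frag_of k)"
        using gs[OF Dom_in[OF d] k] by (simp add: mc s_def)
      finally show "(g (Cod C d) \<circ> Act (free_module C M) d) (frag_of k)
          = (Act N d \<circ> g (Dom C d)) (frag_of k)"
        by (simp add: mc)
    qed (use x in simp)
    then show "g (Cod C d) (Act (free_module C M) d x) = Act N d (g (Dom C d) x)" by simp
  qed (simp add: g)
  moreover have "g e (frag_of (m, Idt C e)) = \<phi> e m"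
    if "e \<in> Obj C" "m \<in> carrier (Grp M e)" for e m
  proof -
    have "(m, Idt C e) \<in> gens C M e"
      using that by (simp add: gens_def Idt_in Dom_Idt Cod_Idt)
    then show ?thesis
      using gs[OF that(1)] that \<phi>[OF that] is_moduleD(4)[OF N] by (simp add: s_def Dom_Idt)
  qed
  ultimately show ?thesis by blast
qed

lemma free_module_map_eq:
  assumes N: "is_module C N"
    and g: "module_map C (free_module C M) N g" and h: "module_map C (free_module C M) N h"
    and eq: "\<And>e m. \<lbrakk>e \<in> Obj C; m \<in> carrier (Grp M e)\<rbrakk>
      \<Longrightarrow> g e (frag_of (m, Idt C e)) = h e (frag_of (m, Idt C e))"
    and e: "e \<in> Obj C" and x: "Poly_Mapping.keys x \<subseteq> gens C M e"
  shows "g e x = h e x"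
proof (rule hom_free_eq[OF is_moduleD(2)[OF N e]])
  show "g e \<in> hom (free_Abelian_group (gens C M e)) (Grp N e)"
    "h e \<in> hom (free_Abelian_group (gens C M e)) (Grp N e)"
    using module_mapD(1)[OF g e] module_mapD(1)[OF h e] by simp_all
next
  fix k assume k: "k \<in> gens C M e"
  obtain m c where mc: "k = (m, c)" by (cases k)
  have c: "c \<in> Mor C" "Cod C c = e" "m \<in> carrier (Grp M (Dom C c))"
    using k mc by (auto simp: gens_def)
  have k': "frag_of k = Act (free_module C M) c (frag_of (m, Idt C (Dom C c)))"
    using c by (simp add: mc Idt_Cmp)
  have fr: "frag_of (m, Idt C (Dom C c)) \<in> carrier (Grp (free_module C M) (Dom C c))"
    using c by (simp add: gens_def Idt_in Dom_Idt Cod_Idt Dom_in)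
  show "g e (frag_of k) = h e (frag_of k)"
    using module_mapD(2)[OF g c(1) fr] module_mapD(2)[OF h c(1) fr] eq[OF Dom_in[OF c(1)] c(3)]
    by (simp add: k' c)
qed (rule x)

lemma free_module_lift:
  assumes N: "is_module C N" and N': "is_module C N'" and p: "surjective_map C N N' p"
    and f: "module_map C (free_module C M) N' f"
  shows "\<exists>g. module_map C (free_module C M) N g \<and>
    (\<forall>e\<in>Obj C. \<forall>x\<in>carrier (Grp (free_module C M) e). p e (g e x) = f e x)"
proof -
  have "\<exists>y. y \<in> carrier (Grp N e) \<and> p e y = f e (frag_of (m, Idt C e))"
    if "e \<in> Obj C" "m \<in> carrier (Grp M e)" for e m
  proof -
    have "f e (frag_of (m, Idt C e)) \<in> carrier (Grp N' e)"
      using that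
      by (intro module_mapD(3)[OF f]) (simp_all add: gens_def Idt_in Dom_Idt Cod_Idt)
    then show ?thesis
      using p that by (auto simp: surjective_map_def image_iff Bex_def eq_commute)
  qed
  then obtain \<phi> where \<phi>: "\<And>e m. \<lbrakk>e \<in> Obj C; m \<in> carrier (Grp M e)\<rbrakk> \<Longrightarrow>
      \<phi> e m \<in> carrier (Grp N e) \<and> p e (\<phi> e m) = f e (frag_of (m, Idt C e))"
    by metis
  obtain g where g: "module_map C (free_module C M) N g"
    and g\<phi>: "\<forall>e\<in>Obj C. \<forall>m\<in>carrier (Grp M e). g e (frag_of (m, Idt C e)) = \<phi> e m"
    using free_module_extend[OF N, of M \<phi>] \<phi> by blast
  have pg: "module_map C (free_module C M) N' (\<lambda>e. p e \<circ> g e)"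
    by (rule module_map_comp[OF g]) (use p in \<open>simp add: surjective_map_def\<close>)
  have "p e (g e x) = f e x" if "e \<in> Obj C" "x \<in> carrier (Grp (free_module C M) e)" for e x
    using free_module_map_eq[OF N' pg f, of e x] g\<phi> \<phi> that by simp
  with g show ?thesis by blast
qed

lemma
  assumes i: "inj i" and M: "is_module C M"
  shows is_module_transport: "is_module C (transport i M)"
    and transport_to: "module_map C M (transport i M) (\<lambda>_. i)"
    and transport_from: "module_map C (transport i M) M (\<lambda>_. inv_into UNIV i)"
proof -
  show "is_module C (transport i M)"
    unfolding is_module_def
  proof (intro conjI ballI impI)
    fix c assume c: "c \<in> Mor C"
    show "Act (transport i M) c
      \<in> hom (Grp (transport i M) (Dom C c)) (Grp (transport i M) (Cod C c))"
      using is_moduleD(3)[OF M c] transport_homs[OF i]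
      by (auto simp: transport_def intro!: hom_compose)
  qed (use i in \<open>auto simp: transport_def comm_group_transport is_moduleD[OF M]\<close>)
  show "module_map C M (transport i M) (\<lambda>_. i)"
    "module_map C (transport i M) M (\<lambda>_. inv_into UNIV i)"
    using i by (auto simp: module_map_def transport_def transport_homs)
qed

lemma is_module_free_cover: "is_module C (free_cover C M)"
  unfolding free_cover_def by (rule is_module_transport[OF inj_encode is_module_free])

lemma free_cover_lift:
  assumes N: "is_module C N" and N': "is_module C N'" and p: "surjective_map C N N' p"
    and f: "module_map C (free_cover C M) N' f"
  shows "\<exists>g. module_map C (free_cover C M) N g \<and>
    (\<forall>e\<in>Obj C. \<forall>x\<in>carrier (Grp (free_cover C M) e). p e (g e x) = f e x)"
proof -
  note to = transport_to[OF inj_encode is_module_free, folded free_cover_def, of M]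
  note frm = transport_from[OF inj_encode is_module_free, folded free_cover_def, of M]
  obtain g where g: "module_map C (free_module C M) N g"
    and pg: "\<forall>e\<in>Obj C. \<forall>x\<in>carrier (Grp (free_module C M) e). p e (g e x) = (f e \<circ> encode) x"
    using free_module_lift[OF N N' p module_map_comp[OF to f]] by blast
  have "p e ((g e \<circ> inv_into UNIV encode) x) = f e x"
    if "e \<in> Obj C" "x \<in> carrier (Grp (free_cover C M) e)" for e x
    using pg that by (auto simp: free_cover_def transport_def inv_f_f[OF inj_encode])
  then show ?thesis
    using module_map_comp[OF frm g] by blast
qed

lemma free_cover:
  assumes M: "is_module C M"
  shows "\<exists>p. surjective_map C (free_cover C M) M p"
proof -
  note frm = transport_from[OF inj_encode is_module_free, folded free_cover_def, of M]
  obtain g where g: "module_map C (free_module C M) M g"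
    and gm: "\<forall>e\<in>Obj C. \<forall>m\<in>carrier (Grp M e). g e (frag_of (m, Idt C e)) = m"
    using free_module_extend[OF M, of M "\<lambda>e m. m"] by blast
  have pm: "module_map C (free_cover C M) M (\<lambda>e. g e \<circ> inv_into UNIV encode)"
    by (rule module_map_comp[OF frm g])
  have "m \<in> (g e \<circ> inv_into UNIV encode) ` carrier (Grp (free_cover C M) e)"
    if "e \<in> Obj C" "m \<in> carrier (Grp M e)" for e m
  proof (rule image_eqI)
    show "m = (g e \<circ> inv_into UNIV encode) (encode (frag_of (m, Idt C e)))"
      using gm that by (simp add: inv_f_f[OF inj_encode])
    show "encode (frag_of (m, Idt C e)) \<in> carrier (Grp (free_cover C M) e)"
      using that by (simp add: free_cover_def transport_def gens_def Idt_in Dom_Idt Cod_Idt)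
  qed
  with pm have "surjective_map C (free_cover C M) M (\<lambda>e. g e \<circ> inv_into UNIV encode)"
    using module_mapD(3)[OF pm] unfolding surjective_map_def by blast
  then show ?thesis by blast
qed

lemma projective_free_cover: "projective C (free_cover C M)"
  unfolding projective_def using is_module_free_cover free_cover_lift by blast

text \<open>A module that lifts against surjections between \<open>univ\<close>-valued modules lifts against
  surjections between arbitrary modules.\<close>

lemma projective_lift:
  fixes P :: "('o, 'm, ('m, 'v) univ) cmodule"
  assumes P: "projective C P"
    and N: "is_module C N" and N': "is_module C N'" and p: "surjective_map C N N' p"
    and f: "module_map C P N' f"
  shows "\<exists>g. module_map C P N g \<and> (\<forall>e\<in>Obj C. \<forall>x\<in>carrier (Grp P e). p e (g e x) = f e x)"
proof -
  have Pm: "is_module C P" using P by (simp add: projective_def)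
  obtain q where q: "surjective_map C (free_cover C P) P q"
    using free_cover[OF Pm] by blast
  then have qm: "module_map C (free_cover C P) P q" by (simp add: surjective_map_def)
  have "module_map C P P (\<lambda>e x. x)"
    by (auto simp: module_map_def hom_def)
  then obtain s where s: "module_map C P (free_cover C P) s"
    and qs: "\<forall>e\<in>Obj C. \<forall>x\<in>carrier (Grp P e). q e (s e x) = x"
    using P is_module_free_cover Pm q unfolding projective_def by blast
  obtain g where g: "module_map C (free_cover C P) N g"
    and pg: "\<forall>e\<in>Obj C. \<forall>x\<in>carrier (Grp (free_cover C P) e). p e (g e x) = (f e \<circ> q e) x"
    using free_cover_lift[OF N N' p module_map_comp[OF qm f]] by blast
  have "p e ((g e \<circ> s e) x) = f e x" if "e \<in> Obj C" "x \<in> carrier (Grp P e)" for e x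
    using that pg qs module_mapD(3)[OF s that] by simp
  then show ?thesis
    using module_map_comp[OF s g] by blast
qed

lemma is_module_kernel:
  assumes M: "is_module C M" and N: "is_module C N" and f: "module_map C M N f"
  shows "is_module C (kernel_module M N f)"
  unfolding is_module_def
proof (intro conjI ballI impI)
  fix e assume e: "e \<in> Obj C"
  interpret comm_group "Grp M e" by (rule is_moduleD(1)[OF M e])
  interpret f: group_hom "Grp M e" "Grp N e" "f e"
    using is_moduleD(2)[OF M e] is_moduleD(2)[OF N e] module_mapD(1)[OF f e]
    by (simp add: group_hom_def group_hom_axioms_def)
  show "comm_group (Grp (kernel_module M N f) e)"
    using group.group_comm_groupI[OF subgroup.subgroup_is_group[OF f.subgroup_kernel group_axioms]]
    by (simp add: kernel_module_def kernel_def m_comm)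
next
  fix c assume c: "c \<in> Mor C"
  interpret A: group_hom "Grp N (Dom C c)" "Grp N (Cod C c)" "Act N c"
    using is_moduleD(2)[OF N Dom_in[OF c]] is_moduleD(2)[OF N Cod_in[OF c]] is_moduleD(3)[OF N c]
    by (simp add: group_hom_def group_hom_axioms_def)
  show "Act (kernel_module M N f) c
    \<in> hom (Grp (kernel_module M N f) (Dom C c)) (Grp (kernel_module M N f) (Cod C c))"
    using is_moduleD(3)[OF M c] module_mapD(2)[OF f c] A.hom_one
    by (auto simp: kernel_module_def hom_def kernel_def Pi_iff)
qed (auto simp: kernel_module_def kernel_def is_moduleD[OF M])

lemma kernel_inclusion:
  "module_map C (kernel_module M N f) M (\<lambda>e x. x)"
  by (auto simp: module_map_def kernel_module_def hom_def kernel_def)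

lemma ex_projective_resolution:
  fixes M :: "('o, 'm, 'v) cmodule"
  assumes M: "is_module C M"
  shows "\<exists>R :: ('o, 'm, ('m, 'v) univ, 'v) resolution. projective_resolution C M R"
proof -
  have iE: "inj (Elt :: 'v \<Rightarrow> ('m, 'v) univ)" by (simp add: inj_def)
  define p where "p = (\<lambda>K :: ('o, 'm, ('m, 'v) univ) cmodule.
    SOME p. surjective_map C (free_cover C K) K p)"
  have p: "surjective_map C (free_cover C K) K (p K)" if "is_module C K" for K
    unfolding p_def by (rule someI_ex[OF free_cover[OF that]])
  define K where "K = rec_nat (transport Elt M) (\<lambda>_ K. kernel_module (free_cover C K) K (p K))"
  have K0: "K 0 = transport Elt M"
    and KS: "K (Suc n) = kernel_module (free_cover C (K n)) (K n) (p (K n))" for n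
    by (simp_all add: K_def)
  have K: "is_module C (K n)" for n
  proof (induction n)
    case 0
    show ?case unfolding K0 by (rule is_module_transport[OF iE M])
  next
    case (Suc n)
    then show ?case
      unfolding KS using p[OF Suc]
      by (intro is_module_kernel is_module_free_cover) (simp_all add: surjective_map_def)
  qed
  note pK = p[OF K]
  then have pm: "module_map C (free_cover C (K n)) (K n) (p (K n))" for n
    by (simp add: surjective_map_def)
  define R where "R = \<lparr>Term = (\<lambda>n. free_cover C (K n)), Bdry = (\<lambda>n. p (K (Suc n))),
    Aug = (\<lambda>e. inv_into UNIV Elt \<circ> p (K 0) e)\<rparr>"
  have im: "p (K (Suc n)) e ` carrier (Grp (free_cover C (K (Suc n))) e)
      = kernel (Grp (free_cover C (K n)) e) (Grp (K n) e) (p (K n) e)" if "e \<in> Obj C" for n e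
    using pK[of "Suc n"] that by (simp add: surjective_map_def KS kernel_module_def)
  have aug: "module_map C (free_cover C (K 0)) M (\<lambda>e. inv_into UNIV Elt \<circ> p (K 0) e)"
    using module_map_comp[OF pm[of 0]] transport_from[OF iE M] by (simp add: K0)
  show ?thesis
  proof (intro exI[of _ R], unfold projective_resolution_def, intro conjI allI ballI)
    fix n
    show "projective C (Term R n)" by (simp add: R_def projective_free_cover)
    show "module_map C (Term R (Suc n)) (Term R n) (Bdry R n)"
      using module_map_comp[OF pm[of "Suc n", unfolded KS] kernel_inclusion]
      by (simp add: R_def KS comp_def)
  next
    have "(inv_into UNIV Elt \<circ> p (K 0) e) ` carrier (Grp (free_cover C (K 0)) e) = carrier (Grp M e)"
      if "e \<in> Obj C" for e
    proof -
      have "p (K 0) e ` carrier (Grp (free_cover C (K 0)) e) = Elt ` carrier (Grp M e)"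
        using pK[of 0] that by (simp add: surjective_map_def) (simp add: K0 transport_def)
      then show ?thesis
        unfolding image_comp[symmetric] by (simp add: image_inv_f_f[OF iE])
    qed
    then show "surjective_map C (Term R 0) M (Aug R)"
      using aug by (simp add: surjective_map_def R_def)
  next
    fix e assume e: "e \<in> Obj C"
    have "kernel (Grp (free_cover C (K 0)) e) (Grp (K 0) e) (p (K 0) e)
      = kernel (Grp (free_cover C (K 0)) e) (Grp M e) (inv_into UNIV Elt \<circ> p (K 0) e)"
    proof -
      have "p (K 0) e x = \<one>\<^bsub>Grp (K 0) e\<^esub> \<longleftrightarrow> inv_into UNIV Elt (p (K 0) e x) = \<one>\<^bsub>Grp M e\<^esub>"
        if "x \<in> carrier (Grp (free_cover C (K 0)) e)" for x
        using module_mapD(3)[OF pm e that] iE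
        by (auto simp: K0 transport_def transport_group_def)
      then show ?thesis by (auto simp: kernel_def)
    qed
    then show "Bdry R 0 e ` carrier (Grp (Term R 1) e)
      = kernel (Grp (Term R 0) e) (Grp M e) (Aug R e)"
      using im[OF e, of 0] by (simp add: R_def)
    fix n
    have "kernel (Grp (free_cover C (K (Suc n))) e) (Grp (K (Suc n)) e) (p (K (Suc n)) e)
      = kernel (Grp (free_cover C (K (Suc n))) e) (Grp (free_cover C (K n)) e) (p (K (Suc n)) e)"
      by (simp add: KS kernel_module_def kernel_def)
    then show "Bdry R (Suc n) e ` carrier (Grp (Term R (Suc (Suc n))) e)
      = kernel (Grp (Term R (Suc n)) e) (Grp (Term R n) e) (Bdry R n e)"
      using im[OF e, of "Suc n"] by (simp add: R_def)
  qed
qed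

corollary projective_resolution_Ext: "is_module C M \<Longrightarrow> projective_resolution C M (Ext_resolution C M)"
  unfolding Ext_resolution_def by (rule someI_ex[OF ex_projective_resolution])

end

section \<open>Well-definedness of the constructions on ordered groupoids\<close>

context groupoid
begin

lemma Obj_Mor: "e \<in> Obj G \<Longrightarrow> e \<in> Mor G"
  and Dom_Obj: "e \<in> Obj G \<Longrightarrow> Dom G e = e"
  and Cod_Obj: "e \<in> Obj G \<Longrightarrow> Cod G e = e"
  using Idt_in Dom_Idt Cod_Idt by (simp_all add: Idt_eq)

lemma Obj_Cmp: "f \<in> Mor G \<Longrightarrow> Cmp G (Dom G f) f = f"
  and Cmp_Obj: "f \<in> Mor G \<Longrightarrow> Cmp G f (Cod G f) = f"
  using Idt_Cmp Cmp_Idt by (simp_all add: Idt_eq Dom_in Cod_in)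

lemma Obj_Obj: "e \<in> Obj G \<Longrightarrow> Cmp G e e = e"
  using Obj_Cmp[of e] by (simp add: Obj_Mor Dom_Obj)

lemma inverse_unique:
  assumes g: "g \<in> Mor G" and h: "is_inverse G g h" and k: "is_inverse G g k"
  shows "h = k"
proof -
  have "h = Cmp G h (Cmp G g k)"
    using h k Cmp_Idt[of h] by (simp add: is_inverse_def)
  also have "\<dots> = Cmp G (Cmp G h g) k"
    using h k g Cmp_assoc[of h g k] unfolding is_inverse_def by metis
  also have "\<dots> = k"
    using h k Idt_Cmp[of k] by (simp add: is_inverse_def)
  finally show ?thesis .
qed

lemma is_inverse_ginv: "g \<in> Mor G \<Longrightarrow> is_inverse G g (ginv G g)"
  unfolding ginv_def using ex_inverse inverse_unique by (metis theI)

lemma ginv_eq: "\<lbrakk>g \<in> Mor G; is_inverse G g h\<rbrakk> \<Longrightarrow> ginv G g = h"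
  using is_inverse_ginv inverse_unique by blast

lemma ginv_in: "g \<in> Mor G \<Longrightarrow> ginv G g \<in> Mor G"
  and Dom_ginv: "g \<in> Mor G \<Longrightarrow> Dom G (ginv G g) = Cod G g"
  and Cod_ginv: "g \<in> Mor G \<Longrightarrow> Cod G (ginv G g) = Dom G g"
  and Cmp_inv_right: "g \<in> Mor G \<Longrightarrow> Cmp G g (ginv G g) = Dom G g"
  and Cmp_inv_left: "g \<in> Mor G \<Longrightarrow> Cmp G (ginv G g) g = Cod G g"
  using is_inverse_ginv[of g] by (simp_all add: is_inverse_def Idt_eq Dom_in Cod_in)

end

context ordered_groupoid
begin

lemma Le_Dom: "\<lbrakk>x \<in> Mor G; y \<in> Mor G; Le G x y\<rbrakk> \<Longrightarrow> Le G (Dom G x) (Dom G y)"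
  using OG2[of x y "ginv G x" "ginv G y"] OG1[of x y]
  by (simp add: ginv_in Dom_ginv Cmp_inv_right)

lemma Le_Cod: "\<lbrakk>x \<in> Mor G; y \<in> Mor G; Le G x y\<rbrakk> \<Longrightarrow> Le G (Cod G x) (Cod G y)"
  using OG2[of "ginv G x" "ginv G y" x y] OG1[of x y]
  by (simp add: ginv_in Cod_ginv Cmp_inv_left)

lemma
  assumes "e \<in> Obj G" "x \<in> Mor G" "Le G e (Cod G x)"
  shows corestr_in: "corestr G x e \<in> Mor G"
    and corestr_Le: "Le G (corestr G x e) x"
    and Cod_corestr: "Cod G (corestr G x e) = e"
  using theI'[OF OG4[OF assms]] by (simp_all add: corestr_def)

lemma corestr_eq: "\<lbrakk>x \<in> Mor G; y \<in> Mor G; Le G y x\<rbrakk> \<Longrightarrow> corestr G x (Cod G y) = y"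
  unfolding corestr_def
  by (rule the1_equality[OF OG4]) (auto intro: Cod_in Le_Cod)

lemma corestr_Cod: "x \<in> Mor G \<Longrightarrow> corestr G x (Cod G x) = x"
  by (rule corestr_eq) (auto intro: Le_refl)

lemma corestr_Obj: "\<lbrakk>e \<in> Obj G; f \<in> Obj G; Le G f e\<rbrakk> \<Longrightarrow> corestr G e f = f"
  using corestr_eq[of e f] by (simp add: Obj_Mor Cod_Obj)

text \<open>The product \<open>(x|y\<^bold>d)y\<close>.\<close>

lemma
  assumes "x \<in> Mor G" "y \<in> Mor G" "Le G (Dom G y) (Cod G x)"
  shows prod_in: "Cmp G (corestr G x (Dom G y)) y \<in> Mor G"
    and Cod_prod: "Cod G (Cmp G (corestr G x (Dom G y)) y) = Cod G y"
    and Dom_prod: "Le G (Dom G (Cmp G (corestr G x (Dom G y)) y)) (Dom G x)"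
  using assms corestr_in[of "Dom G y" x] Cod_corestr[of "Dom G y" x] corestr_Le[of "Dom G y" x]
  by (simp_all add: Dom_in Cmp_in Cod_Cmp Dom_Cmp Le_Dom)

lemma prod_assoc:
  assumes x: "x \<in> Mor G" and y: "y \<in> Mor G" and z: "z \<in> Mor G"
    and xy: "Le G (Dom G y) (Cod G x)" and yz: "Le G (Dom G z) (Cod G y)"
  defines "w \<equiv> Cmp G (corestr G y (Dom G z)) z"
  shows "Cmp G (corestr G (Cmp G (corestr G x (Dom G y)) y) (Dom G z)) z
    = Cmp G (corestr G x (Dom G w)) w"
proof -
  define y' where "y' = corestr G y (Dom G z)"
  have y': "y' \<in> Mor G" "Le G y' y" "Cod G y' = Dom G z"
    unfolding y'_def using corestr_in corestr_Le Cod_corestr y z yz by (simp_all add: Dom_in)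
  have y'd: "Le G (Dom G y') (Dom G y)" using y' y by (simp add: Le_Dom)
  have y'x: "Le G (Dom G y') (Cod G x)"
    by (rule Le_trans[OF _ _ _ y'd xy]) (use y' x y in \<open>simp_all add: Dom_in Cod_in Obj_Mor\<close>)
  define x1 where "x1 = corestr G x (Dom G y)"
  define x' where "x' = corestr G x (Dom G y')"
  have x1: "x1 \<in> Mor G" "Le G x1 x" "Cod G x1 = Dom G y"
    unfolding x1_def using corestr_in corestr_Le Cod_corestr x y xy by (simp_all add: Dom_in)
  have x': "x' \<in> Mor G" "Le G x' x" "Cod G x' = Dom G y'"
    unfolding x'_def using corestr_in corestr_Le Cod_corestr x y' y'x by (simp_all add: Dom_in)
  have "Le G (Dom G y') (Cod G x1)" using y'd x1 by simp
  note c = corestr_in[OF Dom_in[OF y'(1)] x1(1) this] corestr_Le[OF Dom_in[OF y'(1)] x1(1) this]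
    Cod_corestr[OF Dom_in[OF y'(1)] x1(1) this]
  have "corestr G x1 (Dom G y') = x'"
    using corestr_eq[OF x c(1) Le_trans[OF c(1) x1(1) x c(2) x1(2)]] by (simp add: x'_def c(3))
  then have x'x1: "Le G x' x1" using c by simp
  have "Le G (Cmp G x' y') (Cmp G x1 y)"
    using x' y' x1 y x'x1 by (intro OG2) auto
  from corestr_eq[OF _ _ this]
  have "corestr G (Cmp G x1 y) (Dom G z) = Cmp G x' y'"
    using x' y' x1 y by (simp add: Cmp_in Cod_Cmp)
  then show ?thesis
    using x' y' z unfolding w_def y'_def[symmetric] x1_def[symmetric]
    by (simp add: Dom_Cmp Cmp_assoc x'_def[symmetric])
qed

lemma LCat_simps:
  "Obj (LCat G) = Obj G"
  "(e, g) \<in> Mor (LCat G) \<longleftrightarrow> e \<in> Obj G \<and> g \<in> Mor G \<and> Le G (Dom G g) e"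
  "Dom (LCat G) (e, g) = e"
  "Cod (LCat G) (e, g) = Cod G g"
  "Idt (LCat G) e = (e, e)"
  "Cmp (LCat G) (e, g) (f, h) = (e, Cmp G (corestr G g (Dom G h)) h)"
  by (simp_all add: LCat_def)

lemma category_LCat: "category (LCat G)"
proof
  fix f g assume f: "f \<in> Mor (LCat G)" and g: "g \<in> Mor (LCat G)"
    and fg: "Cod (LCat G) f = Dom (LCat G) g"
  obtain e1 f1 e2 g1 where eq: "f = (e1, f1)" "g = (e2, g1)" by (cases f, cases g)
  show "Cmp (LCat G) f g \<in> Mor (LCat G)"
    "Dom (LCat G) (Cmp (LCat G) f g) = Dom (LCat G) f"
    "Cod (LCat G) (Cmp (LCat G) f g) = Cod (LCat G) g"
    using f g fg prod_in[of f1 g1] Cod_prod[of f1 g1]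
      Le_trans[OF _ _ _ Dom_prod[of f1 g1], of e1]
    by (simp_all add: eq LCat_simps Dom_in Obj_Mor)
next
  fix f g h assume "f \<in> Mor (LCat G)" "g \<in> Mor (LCat G)" "h \<in> Mor (LCat G)"
    "Cod (LCat G) f = Dom (LCat G) g" "Cod (LCat G) g = Dom (LCat G) h"
  then show "Cmp (LCat G) (Cmp (LCat G) f g) h = Cmp (LCat G) f (Cmp (LCat G) g h)"
    by (cases f, cases g, cases h) (simp add: LCat_simps prod_assoc)
next
  fix f assume "f \<in> Mor (LCat G)"
  then show "Cmp (LCat G) (Idt (LCat G) (Dom (LCat G) f)) f = f"
    "Cmp (LCat G) f (Idt (LCat G) (Cod (LCat G) f)) = f"
    by (cases f; simp add: LCat_simps corestr_Obj Dom_in Obj_Cmp Dom_Obj Cod_in corestr_Cod Cmp_Obj)+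
qed (auto simp: LCat_def Dom_in Cod_in Obj_Mor Dom_Obj Cod_Obj Le_refl)

lemma adjI_simps:
  "Obj (adjI G) = insert None (Some ` Obj G)"
  "Mor (adjI G) = insert None (Some ` Mor G)"
  "Dom (adjI G) = map_option (Dom G)"
  "Cod (adjI G) = map_option (Cod G)"
  "Idt (adjI G) = map_option (Idt G)"
  "Cmp (adjI G) = adjI_cmp G"
  "Le (adjI G) = adjI_le G"
  by (simp_all add: adjI_def)

lemma adjI_le_None: "adjI_le G None y \<longleftrightarrow> y = None"
  by (cases y) simp_all

lemma groupoid_adjI: "groupoid (adjI G)"
proof
  fix f g h assume "f \<in> Mor (adjI G)" "g \<in> Mor (adjI G)" "h \<in> Mor (adjI G)"
    "Cod (adjI G) f = Dom (adjI G) g" "Cod (adjI G) g = Dom (adjI G) h"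
  then show "Cmp (adjI G) (Cmp (adjI G) f g) h = Cmp (adjI G) f (Cmp (adjI G) g h)"
    by (auto simp: adjI_simps Cmp_assoc)
next
  fix g assume "g \<in> Mor (adjI G)"
  then show "\<exists>h. is_inverse (adjI G) g h"
  proof (cases g)
    case None
    then show ?thesis by (intro exI[of _ None]) (simp add: is_inverse_def adjI_simps)
  next
    case (Some x)
    then show ?thesis
      using \<open>g \<in> Mor (adjI G)\<close> is_inverse_ginv[of x]
      by (intro exI[of _ "Some (ginv G x)"]) (auto simp: is_inverse_def adjI_simps)
  qed
qed (auto simp: adjI_simps Dom_in Cod_in Obj_Mor Dom_Obj Cod_Obj Cmp_in Dom_Cmp Cod_Cmp
    Obj_Cmp Cmp_Obj Idt_eq)

lemma ginv_adjI: "x \<in> Mor (adjI G) \<Longrightarrow> ginv (adjI G) x = map_option (ginv G) x"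
proof (rule groupoid.ginv_eq[OF groupoid_adjI])
  assume x: "x \<in> Mor (adjI G)"
  show "is_inverse (adjI G) x (map_option (ginv G) x)"
  proof (cases x)
    case (Some g)
    with x have "g \<in> Mor G" by (auto simp: adjI_simps)
    with is_inverse_ginv[OF this] Some show ?thesis
      by (simp add: is_inverse_def adjI_simps)
  qed (simp add: is_inverse_def adjI_simps)
qed

lemma Le_Obj: "\<lbrakk>x \<in> Mor G; e \<in> Obj G; Le G x e\<rbrakk> \<Longrightarrow> x \<in> Obj G"
  using corestr_eq[of e x] corestr_Obj[of e "Cod G x"] Le_Cod[of x e] Cod_in[of x]
  by (simp add: Obj_Mor Cod_Obj)

lemma ginv_Obj: "e \<in> Obj G \<Longrightarrow> ginv G e = e"
  by (rule ginv_eq)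
    (use Obj_Cmp[of e] in \<open>auto simp: is_inverse_def Obj_Mor Dom_Obj Cod_Obj Idt_eq\<close>)

lemma ordered_groupoid_adjI: "ordered_groupoid (adjI G)"
proof -
  interpret I: groupoid "adjI G" by (rule groupoid_adjI)
  show ?thesis
  proof
    fix x assume "x \<in> Mor (adjI G)"
    then show "Le (adjI G) x x" by (auto simp: adjI_simps Le_refl)
  next
    fix x y assume xy: "x \<in> Mor (adjI G)" "y \<in> Mor (adjI G)" "Le (adjI G) x y"
    {
      assume "Le (adjI G) y x"
      with xy show "x = y" by (auto simp: adjI_simps Le_antisym)
    }
    show "Le (adjI G) (ginv (adjI G) x) (ginv (adjI G) y)"
      using xy by (auto simp: ginv_adjI) (auto simp: adjI_simps OG1 ginv_Obj)
    {
      fix z assume "z \<in> Mor (adjI G)" "Le (adjI G) y z"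
      with xy show "Le (adjI G) x z"
        by (cases x; cases y; cases z) (auto simp: adjI_simps intro: Le_Obj Le_trans[of _ "the y"])
    }
    {
      fix u v assume "u \<in> Mor (adjI G)" "v \<in> Mor (adjI G)" "Le (adjI G) u v"
        "Cod (adjI G) x = Dom (adjI G) u" "Cod (adjI G) y = Dom (adjI G) v"
      with xy show "Le (adjI G) (Cmp (adjI G) x u) (Cmp (adjI G) y v)"
        by (auto simp: adjI_simps OG2 Cod_Obj Dom_Obj Obj_Obj)
    }
  next
    fix e x assume ex: "e \<in> Obj (adjI G)" "x \<in> Mor (adjI G)"
    {
      assume le: "Le (adjI G) e (Dom (adjI G) x)"
      show "\<exists>!y. y \<in> Mor (adjI G) \<and> Le (adjI G) y x \<and> Dom (adjI G) y = e"
      proof (cases x)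
        case None
        then show ?thesis
          using ex by (intro ex1I[of _ e]) (auto simp: adjI_simps Obj_Mor Dom_Obj)
      next
        case (Some x')
        with ex le obtain e' where e': "e = Some e'" "e' \<in> Obj G" "x' \<in> Mor G" "Le G e' (Dom G x')"
          by (auto simp: adjI_simps)
        obtain y where y: "y \<in> Mor G \<and> Le G y x' \<and> Dom G y = e'"
          and un: "\<And>z. z \<in> Mor G \<and> Le G z x' \<and> Dom G z = e' \<Longrightarrow> z = y"
          using OG3[OF e'(2-4)] by blast
        show ?thesis
        proof (rule ex1I[of _ "Some y"])
          show "Some y \<in> Mor (adjI G) \<and> Le (adjI G) (Some y) x \<and> Dom (adjI G) (Some y) = e"
            using y by (simp add: adjI_simps Some e')
        next
          fix z assume "z \<in> Mor (adjI G) \<and> Le (adjI G) z x \<and> Dom (adjI G) z = e"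
          then obtain z' where z': "z = Some z'" "z' \<in> Mor G \<and> Le G z' x' \<and> Dom G z' = e'"
            by (cases z) (auto simp: adjI_simps Some e')
          show "z = Some y" using un[OF z'(2)] z'(1) by simp
        qed
      qed
    }
    {
      assume le: "Le (adjI G) e (Cod (adjI G) x)"
      show "\<exists>!y. y \<in> Mor (adjI G) \<and> Le (adjI G) y x \<and> Cod (adjI G) y = e"
      proof (cases x)
        case None
        then show ?thesis
          using ex by (intro ex1I[of _ e]) (auto simp: adjI_simps Obj_Mor Cod_Obj)
      next
        case (Some x')
        with ex le obtain e' where e': "e = Some e'" "e' \<in> Obj G" "x' \<in> Mor G" "Le G e' (Cod G x')"
          by (auto simp: adjI_simps)
        obtain y where y: "y \<in> Mor G \<and> Le G y x' \<and> Cod G y = e'"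
          and un: "\<And>z. z \<in> Mor G \<and> Le G z x' \<and> Cod G z = e' \<Longrightarrow> z = y"
          using OG4[OF e'(2-4)] by blast
        show ?thesis
        proof (rule ex1I[of _ "Some y"])
          show "Some y \<in> Mor (adjI G) \<and> Le (adjI G) (Some y) x \<and> Cod (adjI G) (Some y) = e"
            using y by (simp add: adjI_simps Some e')
        next
          fix z assume "z \<in> Mor (adjI G) \<and> Le (adjI G) z x \<and> Cod (adjI G) z = e"
          then obtain z' where z': "z = Some z'" "z' \<in> Mor G \<and> Le G z' x' \<and> Cod G z' = e'"
            by (cases z) (auto simp: adjI_simps Some e')
          show "z = Some y" using un[OF z'(2)] z'(1) by simp
        qed
      qed
    }
  qed
qed

lemma is_module_constZ: "is_module C constZ"
  by (auto simp: is_module_def constZ_def abelian_integer_group hom_def)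

lemma Act_ZG_of: "Act (ZG G) (e, g) (frag_of h) = frag_of (Cmp G (corestr G h (Dom G g)) g)"
  by (simp add: ZG_def)

lemma Act_ZG_hom:
  assumes "c \<in> Mor (LCat G)"
  shows "Act (ZG G) c \<in> hom (Grp (ZG G) (Dom (LCat G) c)) (Grp (ZG G) (Cod (LCat G) c))"
proof -
  obtain e g where c: "c = (e, g)" by (cases c)
  show ?thesis
    using assms unfolding c ZG_def
    by (auto simp: LCat_simps prod_in Cod_prod intro!: frag_extend_hom)
qed

lemma is_module_ZG: "is_module (LCat G) (ZG G)"
  unfolding is_module_def
proof (intro conjI ballI impI)
  fix e assume "e \<in> Obj (LCat G)"
  show "comm_group (Grp (ZG G) e)"
    by (simp add: ZG_def abelian_free_Abelian_group)
next
  fix e x assume e: "e \<in> Obj (LCat G)" and x: "x \<in> carrier (Grp (ZG G) e)"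
  let ?F = "free_Abelian_group {g \<in> Mor G. Cod G g = e}"
  have e': "e \<in> Obj G" using e by (simp add: LCat_simps)
  have h: "Act (ZG G) (e, e) \<in> hom ?F ?F"
    using Act_ZG_hom[of "(e, e)"] e' by (simp add: LCat_simps Obj_Mor Dom_Obj Cod_Obj Le_refl ZG_def)
  have i: "id \<in> hom ?F ?F" by (simp only: group_hom_free_Abelian_groups_id order_refl)
  have "Act (ZG G) (e, e) x = id x"
    by (rule hom_free_eq[OF group_free_Abelian_group h i])
      (use x e' in \<open>auto simp: ZG_def Dom_Obj corestr_Cod Cmp_Obj\<close>)
  then show "Act (ZG G) (Idt (LCat G) e) x = x" by (simp add: LCat_simps)
next
  fix c d x
  assume c: "c \<in> Mor (LCat G)" and d: "d \<in> Mor (LCat G)" and cd: "Cod (LCat G) c = Dom (LCat G) d"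
    and x: "x \<in> carrier (Grp (ZG G) (Dom (LCat G) c))"
  interpret L: category "LCat G" by (rule category_LCat)
  obtain e g f h where eq: "c = (e, g)" "d = (f, h)" by (cases c, cases d)
  let ?F = "free_Abelian_group {k \<in> Mor G. Cod G k = e}"
  let ?F' = "free_Abelian_group {k \<in> Mor G. Cod G k = Cod G h}"
  have 1: "Act (ZG G) (Cmp (LCat G) c d) \<in> hom ?F ?F'"
    using Act_ZG_hom[OF L.Cmp_in[OF c d cd]] c d cd L.Cod_Cmp[OF c d cd] L.Dom_Cmp[OF c d cd]
    by (simp add: eq ZG_def LCat_simps(3,4))
  have 2: "Act (ZG G) d \<circ> Act (ZG G) c \<in> hom ?F ?F'"
    using hom_compose[OF Act_ZG_hom[OF c]] Act_ZG_hom[OF d] cd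
    by (simp add: eq ZG_def LCat_simps(3,4))
  have "Act (ZG G) (Cmp (LCat G) c d) x = (Act (ZG G) d \<circ> Act (ZG G) c) x"
  proof (rule hom_free_eq[OF group_free_Abelian_group 1 2])
    fix k assume "k \<in> {k \<in> Mor G. Cod G k = e}"
    then show "Act (ZG G) (Cmp (LCat G) c d) (frag_of k) = (Act (ZG G) d \<circ> Act (ZG G) c) (frag_of k)"
      using c d cd prod_assoc[of k g h] by (simp add: eq LCat_simps Act_ZG_of)
  qed (use x in \<open>simp add: eq ZG_def LCat_simps\<close>)
  then show "Act (ZG G) (Cmp (LCat G) c d) x = Act (ZG G) d (Act (ZG G) c x)" by simp
qed (rule Act_ZG_hom)

end

lemma augmentation_of: "augmentation e (frag_of g) = 1"
  by (simp add: augmentation_def keys_frag_of)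

lemma augmentation_hom: "augmentation e \<in> hom (free_Abelian_group S) integer_group"
proof (rule homI)
  fix x y :: "'a \<Rightarrow>\<^sub>0 int"
  have eq: "augmentation e z = (\<Sum>g\<in>Poly_Mapping.keys x \<union> Poly_Mapping.keys y. Poly_Mapping.lookup z g)"
    if "Poly_Mapping.keys z \<subseteq> Poly_Mapping.keys x \<union> Poly_Mapping.keys y" for z
    unfolding augmentation_def
    by (rule sum.mono_neutral_left) (use that in \<open>auto simp: in_keys_iff\<close>)
  show "augmentation e (x \<otimes>\<^bsub>free_Abelian_group S\<^esub> y)
    = augmentation e x \<otimes>\<^bsub>integer_group\<^esub> augmentation e y"
    using keys_add[of x y] by (simp add: eq lookup_add sum.distrib)
qed simp

context ordered_groupoid
begin

lemma augmentation_map: "module_map (LCat G) (ZG G) constZ augmentation"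
  unfolding module_map_def
proof (intro conjI ballI)
  fix e
  show "augmentation e \<in> hom (Grp (ZG G) e) (Grp constZ e)"
    by (simp add: ZG_def constZ_def augmentation_hom)
next
  fix c x assume c: "c \<in> Mor (LCat G)" and x: "x \<in> carrier (Grp (ZG G) (Dom (LCat G) c))"
  let ?F = "Grp (ZG G) (Dom (LCat G) c)"
  obtain e g where eq: "c = (e, g)" by (cases c)
  have F: "?F = free_Abelian_group {k \<in> Mor G. Cod G k = e}"
    by (simp add: ZG_def eq LCat_simps)
  have "augmentation (Cod (LCat G) c) \<in> hom (Grp (ZG G) (Cod (LCat G) c)) integer_group"
    by (simp add: ZG_def augmentation_hom)
  from hom_compose[OF Act_ZG_hom[OF c] this]
  have 1: "augmentation (Cod (LCat G) c) \<circ> Act (ZG G) c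
    \<in> hom (free_Abelian_group {k \<in> Mor G. Cod G k = e}) integer_group"
    by (simp only: F)
  have "(augmentation (Cod (LCat G) c) \<circ> Act (ZG G) c) x = augmentation (Dom (LCat G) c) x"
    by (rule hom_free_eq[OF group_integer_group 1 augmentation_hom])
      (use x in \<open>simp_all add: F[unfolded eq] eq Act_ZG_of augmentation_of\<close>)
  then show "augmentation (Cod (LCat G) c) (Act (ZG G) c x)
    = Act constZ c (augmentation (Dom (LCat G) c) x)"
    by (simp add: constZ_def)
qed

lemma is_module_KG: "is_module (LCat G) (KG G)"
  unfolding KG_def
  by (rule is_module_kernel[OF category_LCat is_module_ZG is_module_constZ augmentation_map])

lemma is_module_ext0:
  assumes A: "is_module (LCat G) A"
  shows "is_module (LCat (adjI G)) (ext0 G A)"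
proof -
  interpret I: ordered_groupoid "adjI G" by (rule ordered_groupoid_adjI)
  interpret L: category "LCat (adjI G)" by (rule I.category_LCat)
  have LA: "c \<in> Mor (LCat (adjI G)) \<longleftrightarrow>
      c = (None, None) \<or> (\<exists>g\<in>Mor G. c = (None, Some g) \<and> Dom G g \<in> Obj G) \<or>
      (\<exists>e g. c = (Some e, Some g) \<and> (e, g) \<in> Mor (LCat G))" for c
    by (cases c) (auto simp: I.LCat_simps LCat_simps adjI_simps adjI_le_None)
  have N: "Grp (ext0 G A) None = singleton_group undefined"
    and S: "Grp (ext0 G A) (Some e) = Grp A e"
    and aN: "Act (ext0 G A) (None, g) = (\<lambda>_. \<one>\<^bsub>Grp (ext0 G A) (map_option (Cod G) g)\<^esub>)"
    and aS: "Act (ext0 G A) (Some e, Some h) = Act A (e, h)" for e g h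
    by (simp_all add: ext0_def Let_def)
  have one1: "\<one>\<^bsub>singleton_group a\<^esub> = a" for a by (simp add: singleton_group_def)
  have gr: "comm_group (Grp (ext0 G A) e)" if "e \<in> Obj (adjI G)" for e
    using that is_moduleD(1)[OF A] by (auto simp: adjI_simps N S LCat_simps)
  have hm: "Act (ext0 G A) c \<in>
      hom (Grp (ext0 G A) (Dom (LCat (adjI G)) c)) (Grp (ext0 G A) (Cod (LCat (adjI G)) c))"
    if c: "c \<in> Mor (LCat (adjI G))" for c
  proof -
    interpret T: comm_group "Grp (ext0 G A) (Cod (LCat (adjI G)) c)"
      using gr L.Cod_in[OF c] by (simp add: I.LCat_simps)
    show ?thesis
    proof (cases "fst c")
      case None
      then obtain g where g: "c = (None, g)" by (cases c) auto
      then have "Act (ext0 G A) c = (\<lambda>_. \<one>\<^bsub>Grp (ext0 G A) (Cod (LCat (adjI G)) c)\<^esub>)"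
        by (simp add: aN I.LCat_simps adjI_simps)
      then show ?thesis by (simp add: hom_def)
    next
      case (Some e)
      then obtain g where g: "c = (Some e, Some g)" "(e, g) \<in> Mor (LCat G)"
        using c LA by auto
      then show ?thesis
        using is_moduleD(3)[OF A g(2)] by (simp add: S aS I.LCat_simps adjI_simps LCat_simps)
    qed
  qed
  have cs: "corestr (adjI G) (Some g) (Some f) = Some (corestr G g f)"
    if "g \<in> Mor G" "f \<in> Obj G" "Le G f (Cod G g)" for g f
    using I.corestr_eq[of "Some g" "Some (corestr G g f)"] that
    by (simp add: adjI_simps corestr_in corestr_Le Cod_corestr)
  show ?thesis
    unfolding is_module_def
  proof (intro conjI ballI impI)
    fix e x assume "e \<in> Obj (LCat (adjI G))" "x \<in> carrier (Grp (ext0 G A) e)"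
    then show "Act (ext0 G A) (Idt (LCat (adjI G)) e) x = x"
      using is_moduleD(4)[OF A]
      by (cases e) (auto simp: I.LCat_simps adjI_simps N S aN aS one1 LCat_simps)
  next
    fix c d x
    assume c: "c \<in> Mor (LCat (adjI G))" and d: "d \<in> Mor (LCat (adjI G))"
      and cd: "Cod (LCat (adjI G)) c = Dom (LCat (adjI G)) d"
      and x: "x \<in> carrier (Grp (ext0 G A) (Dom (LCat (adjI G)) c))"
    show "Act (ext0 G A) (Cmp (LCat (adjI G)) c d) x = Act (ext0 G A) d (Act (ext0 G A) c x)"
    proof (cases "fst c")
      case None
      then obtain g where g: "c = (None, g)" by (cases c) auto
      obtain k where k: "Cmp (LCat (adjI G)) c d = (None, k)"
        by (cases d) (simp add: g I.LCat_simps)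
      have kd: "map_option (Cod G) k = Cod (LCat (adjI G)) d"
        using L.Cod_Cmp[OF c d cd] by (simp add: k I.LCat_simps adjI_simps)
      have 1: "group_hom (Grp (ext0 G A) (Dom (LCat (adjI G)) d))
          (Grp (ext0 G A) (Cod (LCat (adjI G)) d)) (Act (ext0 G A) d)"
        using hm[OF d] gr L.Dom_in[OF d] L.Cod_in[OF d]
        by (simp add: group_hom_def group_hom_axioms_def I.LCat_simps(1) comm_group.axioms(2))
      have "map_option (Cod G) g = Dom (LCat (adjI G)) d"
        using cd by (simp add: g I.LCat_simps adjI_simps)
      then show ?thesis
        using group_hom.hom_one[OF 1] by (simp add: k kd aN) (simp add: g aN)
    next
      case (Some e)
      then obtain g where g: "c = (Some e, Some g)" "(e, g) \<in> Mor (LCat G)"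
        using c LA by auto
      then obtain h where h: "d = (Some (Cod G g), Some h)" "(Cod G g, h) \<in> Mor (LCat G)"
        using d cd LA by (auto simp: I.LCat_simps adjI_simps)
      have "Cmp (LCat (adjI G)) c d = (Some e, Some (Cmp G (corestr G g (Dom G h)) h))"
        using g h by (simp add: I.LCat_simps adjI_simps) (simp add: LCat_simps cs Dom_in)
      then show ?thesis
        using is_moduleD(5)[OF A g(2) h(2)] x g h
        by (simp add: aS S LCat_simps I.LCat_simps)
    qed
  qed (use gr hm in \<open>simp_all add: I.LCat_simps(1)\<close>)
qed

end

end

theory Submission
  imports Defs
begin

text \<open>In \<open>G\<^sup>I\<close> the new identity \<open>I\<close> is the greatest identity, so the arrows of \<open>G\<^sup>I\<close> ending at \<open>e\<close>
  correspond to the morphisms from \<open>I\<close> to \<open>e\<close> in \<open>\<LL>(G\<^sup>I)\<close>. Hence \<open>\<int>G\<^sup>I\<close> is the free module on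
  one generator at \<open>I\<close>; it is projective (lemma \<open>free_summand_ZG_top\<close>), and
  \<open>Hom(\<int>G\<^sup>I, A\<^sup>0) = A\<^sup>0\<^sub>I = 0\<close> (lemma \<open>ZG_top_to_ext0_trivial\<close>). The augmentation
  \<open>\<int>G\<^sup>I \<rightarrow> \<Delta>\<int>\<close> is an isomorphism at \<open>I\<close>, and over \<open>G\<close> it is the augmentation of \<open>\<int>G\<close>. Its kernel
  is therefore \<open>(KG)\<^sup>0\<close>, the extension of \<open>KG\<close> by zero.

  Extension by zero is exact, and it is left adjoint to restriction because no morphism of
  \<open>\<LL>(G\<^sup>I)\<close> leads from an object of \<open>G\<close> to \<open>I\<close>. It thus preserves projectives (lemma
  \<open>free_summand_ext0\<close>), and \<open>Hom(P\<^sup>0, A\<^sup>0) = Hom(P, A)\<close>. So a projective resolution \<open>R\<close> of \<open>KG\<close>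
  over \<open>G\<close> yields the projective resolution
  \<open>\<dots> \<rightarrow> R\<^sub>1\<^sup>0 \<rightarrow> R\<^sub>0\<^sup>0 \<rightarrow> \<int>G\<^sup>I \<rightarrow> \<Delta>\<int>\<close> over \<open>G\<^sup>I\<close> (lemma \<open>summand_resolution_shifted\<close>).
  Applying \<open>Hom(-, A\<^sup>0)\<close> to it gives \<open>0\<close> in degree \<open>0\<close> and the complex \<open>Hom(R, A)\<close> shifted by one
  degree above that, so that the cohomology in degree \<open>n > 0\<close> is \<open>Ext\<^sup>n\<^sup>-\<^sup>1(KG, A)\<close> (lemma
  \<open>cohomology_group_shifted\<close>).

  As \<open>Ext\<close> is defined from a chosen resolution, the argument is completed by its independence
  of that choice (theorem \<open>cohomology_group_unique\<close>), that is, by the comparison of projective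
  resolutions by chain maps and homotopies. There the resolutions may have different element types,
  which is why projectivity is used in the form of being a direct summand of a free module.\<close>

section \<open>Quotients and groups of natural transformations\<close>

text \<open>Two quotients are isomorphic as soon as there are homomorphisms in both directions that
  respect the subgroups and are mutually inverse modulo them. This is the form in which chain
  homotopy equivalences and bijections of cochain groups both produce isomorphisms of cohomology.\<close>

lemma quotient_iso:
  assumes G: "comm_group G" and H: "comm_group H"
    and A: "subgroup A G" and B: "subgroup B H"
    and \<phi>: "\<phi> \<in> hom G H" and \<psi>: "\<psi> \<in> hom H G"
    and \<phi>A: "\<And>a. a \<in> A \<Longrightarrow> \<phi> a \<in> B" and \<psi>B: "\<And>b. b \<in> B \<Longrightarrow> \<psi> b \<in> A"
    and \<psi>\<phi>: "\<And>x. x \<in> carrier G \<Longrightarrow> \<exists>a\<in>A. \<psi> (\<phi> x) = x \<otimes>\<^bsub>G\<^esub> a"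
    and \<phi>\<psi>: "\<And>y. y \<in> carrier H \<Longrightarrow> \<exists>b\<in>B. \<phi> (\<psi> y) = y \<otimes>\<^bsub>H\<^esub> b"
  shows "G Mod A \<cong> H Mod B"
proof -
  interpret G: comm_group G by (rule G)
  interpret H: comm_group H by (rule H)
  interpret A: normal A G by (rule G.subgroup_imp_normal[OF A])
  interpret B: normal B H by (rule H.subgroup_imp_normal[OF B])
  have \<phi>c: "\<phi> x \<in> carrier H" if "x \<in> carrier G" for x
    using \<phi> that by (auto simp: hom_def)
  have \<psi>c: "\<psi> y \<in> carrier G" if "y \<in> carrier H" for y
    using \<psi> that by (auto simp: hom_def)
  define k where "k = (\<lambda>x. B #>\<^bsub>H\<^esub> \<phi> x)"
  have "k \<in> hom G (H Mod B)"
    unfolding k_def using hom_compose[OF \<phi> B.r_coset_hom_Mod] by (simp add: comp_def)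
  then interpret k: group_hom G "H Mod B" k
    by (simp add: group_hom_def group_hom_axioms_def B.factorgroup_is_group)
  have coset: "B #>\<^bsub>H\<^esub> y = B \<longleftrightarrow> y \<in> B" if "y \<in> carrier H" for y
    using that H.coset_join1[OF _ that B] H.coset_join2[OF that B] by blast
  have "kernel G (H Mod B) k = A"
  proof (intro equalityI subsetI)
    fix x assume "x \<in> kernel G (H Mod B) k"
    then have x: "x \<in> carrier G" and "\<phi> x \<in> B"
      using coset[OF \<phi>c] by (auto simp: kernel_def k_def FactGroup_def)
    then have "\<psi> (\<phi> x) \<in> A" using \<psi>B by blast
    moreover obtain a where a: "a \<in> A" "\<psi> (\<phi> x) = x \<otimes>\<^bsub>G\<^esub> a" using \<psi>\<phi>[OF x] by blast
    ultimately have "x \<otimes>\<^bsub>G\<^esub> a \<otimes>\<^bsub>G\<^esub> inv\<^bsub>G\<^esub> a \<in> A"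
      by simp
    then show "x \<in> A" using x a(1) by (simp add: G.m_assoc)
  next
    fix x assume "x \<in> A"
    then show "x \<in> kernel G (H Mod B) k"
      using coset[OF \<phi>c] \<phi>A A.subset by (auto simp: kernel_def k_def FactGroup_def)
  qed
  moreover have "k ` carrier G = carrier (H Mod B)"
  proof -
    have "B #>\<^bsub>H\<^esub> y \<in> k ` carrier G" if y: "y \<in> carrier H" for y
    proof -
      obtain b where b: "b \<in> B" "\<phi> (\<psi> y) = y \<otimes>\<^bsub>H\<^esub> b" using \<phi>\<psi>[OF y] by blast
      have "\<phi> (\<psi> y) \<in> B #>\<^bsub>H\<^esub> y"
        using b y B.subset by (auto simp: r_coset_def H.m_comm)
      then have "B #>\<^bsub>H\<^esub> y = k (\<psi> y)"
        unfolding k_def by (rule H.repr_independence[OF _ y B])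
      then show ?thesis using \<psi>c[OF y] by blast
    qed
    then show ?thesis
      using \<phi>c by (auto simp: k_def FactGroup_def RCOSETS_def)
  qed
  ultimately show ?thesis using k.FactGroup_iso by simp
qed

text \<open>The map \<open>Hom(M', N) \<rightarrow> Hom(M, N)\<close> induced by \<open>f : M \<rightarrow> M'\<close>, with the result made
  extensional as the elements of \<open>Hom_group\<close> are. The coboundary of a cochain complex is an
  instance, and so are the cochain maps induced by a chain map or a homotopy.\<close>

definition precompose ::
  "('o, 'm) cat \<Rightarrow> ('o, 'm, 'u) cmodule \<Rightarrow> ('o \<Rightarrow> 'u \<Rightarrow> 'v) \<Rightarrow> ('o \<Rightarrow> 'v \<Rightarrow> 'w) \<Rightarrow> ('o \<Rightarrow> 'u \<Rightarrow> 'w)"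
  where
  "precompose C M f \<eta> = (\<lambda>e\<in>Obj C. \<lambda>x\<in>carrier (Grp M e). \<eta> e (f e x))"

lemma coboundary_eq: "coboundary C R n = precompose C (Term R (Suc n)) (Bdry R n)"
  by (simp add: coboundary_def precompose_def fun_eq_iff)

lemma precompose_apply [simp]:
  "\<lbrakk>e \<in> Obj C; x \<in> carrier (Grp M e)\<rbrakk> \<Longrightarrow> precompose C M f \<eta> e x = \<eta> e (f e x)"
  by (simp add: precompose_def)

lemma carrier_Hom_groupD:
  assumes "\<eta> \<in> carrier (Hom_group C M N)"
  shows "module_map C M N \<eta>"
    and "\<eta> \<in> extensional (Obj C)"
    and "e \<in> Obj C \<Longrightarrow> \<eta> e \<in> extensional (carrier (Grp M e))"
  using assms by (simp_all add: Hom_group_def)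

lemma Hom_group_eqI:
  assumes "\<eta> \<in> carrier (Hom_group C M N)" and "\<theta> \<in> carrier (Hom_group C M N)"
    and "\<And>e x. \<lbrakk>e \<in> Obj C; x \<in> carrier (Grp M e)\<rbrakk> \<Longrightarrow> \<eta> e x = \<theta> e x"
  shows "\<eta> = \<theta>"
proof (rule extensionalityI[OF carrier_Hom_groupD(2)[OF assms(1)] carrier_Hom_groupD(2)[OF assms(2)]])
  fix e assume e: "e \<in> Obj C"
  show "\<eta> e = \<theta> e"
    by (rule extensionalityI[OF carrier_Hom_groupD(3)[OF assms(1) e] carrier_Hom_groupD(3)[OF assms(2) e]
          assms(3)[OF e]])
qed

lemma Hom_group_mult:
  "\<lbrakk>e \<in> Obj C; x \<in> carrier (Grp M e)\<rbrakk>
    \<Longrightarrow> (\<eta> \<otimes>\<^bsub>Hom_group C M N\<^esub> \<theta>) e x = \<eta> e x \<otimes>\<^bsub>Grp N e\<^esub> \<theta> e x"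
  by (simp add: Hom_group_def)

lemma Hom_group_one:
  "\<lbrakk>e \<in> Obj C; x \<in> carrier (Grp M e)\<rbrakk> \<Longrightarrow> \<one>\<^bsub>Hom_group C M N\<^esub> e x = \<one>\<^bsub>Grp N e\<^esub>"
  by (simp add: Hom_group_def)

lemma module_map_one:
  assumes "is_module C M" "is_module C N" "module_map C M N f" "e \<in> Obj C"
  shows "f e \<one>\<^bsub>Grp M e\<^esub> = \<one>\<^bsub>Grp N e\<^esub>"
  by (rule hom_one[OF module_mapD(1)[OF assms(3,4)]]) (use assms in \<open>simp_all add: is_moduleD(2)\<close>)

lemma module_map_mult:
  assumes "module_map C M N f" "e \<in> Obj C" "x \<in> carrier (Grp M e)" "y \<in> carrier (Grp M e)"
  shows "f e (x \<otimes>\<^bsub>Grp M e\<^esub> y) = f e x \<otimes>\<^bsub>Grp N e\<^esub> f e y"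
  using module_mapD(1)[OF assms(1,2)] assms(3,4) by (simp add: hom_mult)

lemma module_map_inv:
  assumes "is_module C M" "is_module C N" "module_map C M N f" "e \<in> Obj C" "x \<in> carrier (Grp M e)"
  shows "f e (inv\<^bsub>Grp M e\<^esub> x) = inv\<^bsub>Grp N e\<^esub> (f e x)"
proof -
  interpret group_hom "Grp M e" "Grp N e" "f e"
    using is_moduleD(2)[OF assms(1,4)] is_moduleD(2)[OF assms(2,4)] module_mapD(1)[OF assms(3,4)]
    by (simp add: group_hom_def group_hom_axioms_def)
  show ?thesis using assms by simp
qed

context
  fixes C :: "('o, 'm) cat"
  assumes C: "category C"
begin

interpretation category C by (rule C)

lemma Act_hom:
  assumes "is_module C N" "c \<in> Mor C"
  shows "group_hom (Grp N (Dom C c)) (Grp N (Cod C c)) (Act N c)"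
  using assms by (simp add: group_hom_def group_hom_axioms_def is_moduleD Dom_in Cod_in)

lemma
  assumes N: "is_module C N"
  shows module_map_const_one: "module_map C M N (\<lambda>e x. \<one>\<^bsub>Grp N e\<^esub>)"
    and module_map_pointwise_mult: "\<lbrakk>module_map C M N f; module_map C M N g\<rbrakk>
      \<Longrightarrow> module_map C M N (\<lambda>e x. f e x \<otimes>\<^bsub>Grp N e\<^esub> g e x)"
    and module_map_pointwise_inv: "module_map C M N f
      \<Longrightarrow> module_map C M N (\<lambda>e x. inv\<^bsub>Grp N e\<^esub> (f e x))"
proof -
  note hom = group_hom.hom_one[OF Act_hom[OF N]] group_hom.hom_mult[OF Act_hom[OF N]]
    group_hom.hom_inv[OF Act_hom[OF N]]
  have gr: "comm_group (Grp N e)" "group (Grp N e)" if "e \<in> Obj C" for e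
    using is_moduleD[OF N] that by auto
  show "module_map C M N (\<lambda>e x. \<one>\<^bsub>Grp N e\<^esub>)"
    using gr by (auto simp: module_map_def hom_def hom group.is_monoid monoid.one_closed monoid.r_one)
  show "module_map C M N (\<lambda>e x. f e x \<otimes>\<^bsub>Grp N e\<^esub> g e x)"
    if f: "module_map C M N f" and g: "module_map C M N g"
    unfolding module_map_def
  proof (intro conjI ballI)
    fix e assume e: "e \<in> Obj C"
    interpret comm_group "Grp N e" by (rule gr[OF e])
    show "(\<lambda>x. f e x \<otimes>\<^bsub>Grp N e\<^esub> g e x) \<in> hom (Grp M e) (Grp N e)"
      by (rule homI) (use f g e in \<open>simp_all add: module_mapD(3) module_map_mult m_ac\<close>)
  next
    fix c x assume "c \<in> Mor C" "x \<in> carrier (Grp M (Dom C c))"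
    then show "f (Cod C c) (Act M c x) \<otimes>\<^bsub>Grp N (Cod C c)\<^esub> g (Cod C c) (Act M c x)
      = Act N c (f (Dom C c) x \<otimes>\<^bsub>Grp N (Dom C c)\<^esub> g (Dom C c) x)"
      using module_mapD(2,3)[OF f] module_mapD(2,3)[OF g] by (simp add: hom Dom_in)
  qed
  show "module_map C M N (\<lambda>e x. inv\<^bsub>Grp N e\<^esub> (f e x))" if f: "module_map C M N f"
    unfolding module_map_def
  proof (intro conjI ballI)
    fix e assume e: "e \<in> Obj C"
    interpret comm_group "Grp N e" by (rule gr[OF e])
    show "(\<lambda>x. inv\<^bsub>Grp N e\<^esub> (f e x)) \<in> hom (Grp M e) (Grp N e)"
      by (rule homI) (use f e in \<open>simp_all add: module_mapD(3) module_map_mult inv_mult\<close>)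
  next
    fix c x assume "c \<in> Mor C" "x \<in> carrier (Grp M (Dom C c))"
    then show "inv\<^bsub>Grp N (Cod C c)\<^esub> (f (Cod C c) (Act M c x))
      = Act N c (inv\<^bsub>Grp N (Dom C c)\<^esub> (f (Dom C c) x))"
      using module_mapD(2,3)[OF f] by (simp add: hom Dom_in)
  qed
qed

lemma restrict_in_Hom_group:
  assumes M: "is_module C M" and f: "module_map C M N f"
  shows "(\<lambda>e\<in>Obj C. \<lambda>x\<in>carrier (Grp M e). f e x) \<in> carrier (Hom_group C M N)"
proof -
  have "x \<otimes>\<^bsub>Grp M e\<^esub> y \<in> carrier (Grp M e)"
    if "e \<in> Obj C" "x \<in> carrier (Grp M e)" "y \<in> carrier (Grp M e)" for e x y
    using is_moduleD(2)[OF M that(1)] that by (simp add: group.is_monoid monoid.m_closed)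
  then have "module_map C M N (\<lambda>e\<in>Obj C. \<lambda>x\<in>carrier (Grp M e). f e x)"
    using f is_moduleD(6)[OF M]
    by (auto simp: module_map_def hom_def Pi_iff Dom_in Cod_in)
  then show ?thesis by (auto simp: Hom_group_def)
qed

lemma comm_group_Hom_group:
  assumes M: "is_module C M" and N: "is_module C N"
  shows "comm_group (Hom_group C M N)"
proof -
  let ?H = "Hom_group C M N"
  have N': "comm_group (Grp N e)" if "e \<in> Obj C" for e using is_moduleD(1)[OF N that] .
  have mult: "\<eta> \<otimes>\<^bsub>?H\<^esub> \<theta> \<in> carrier ?H" if "\<eta> \<in> carrier ?H" "\<theta> \<in> carrier ?H" for \<eta> \<theta>
    using restrict_in_Hom_group[OF M module_map_pointwise_mult[OF N carrier_Hom_groupD(1)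
      carrier_Hom_groupD(1), OF that]]
    by (simp add: Hom_group_def)
  have one: "\<one>\<^bsub>?H\<^esub> \<in> carrier ?H"
    using restrict_in_Hom_group[OF M module_map_const_one[OF N]] by (simp add: Hom_group_def)
  have val: "\<eta> e x \<in> carrier (Grp N e)"
    if "\<eta> \<in> carrier ?H" "e \<in> Obj C" "x \<in> carrier (Grp M e)" for \<eta> e x
    by (rule module_mapD(3)[OF carrier_Hom_groupD(1)[OF that(1)] that(2,3)])
  show ?thesis
  proof (rule comm_groupI)
    fix \<eta> \<theta> assume \<eta>: "\<eta> \<in> carrier ?H" and \<theta>: "\<theta> \<in> carrier ?H"
    show "\<eta> \<otimes>\<^bsub>?H\<^esub> \<theta> = \<theta> \<otimes>\<^bsub>?H\<^esub> \<eta>"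
      by (rule Hom_group_eqI[OF mult mult])
        (use \<eta> \<theta> val N' in \<open>simp_all add: Hom_group_mult comm_group.axioms(1) comm_monoid.m_comm\<close>)
    fix \<zeta> assume \<zeta>: "\<zeta> \<in> carrier ?H"
    show "\<eta> \<otimes>\<^bsub>?H\<^esub> \<theta> \<otimes>\<^bsub>?H\<^esub> \<zeta> = \<eta> \<otimes>\<^bsub>?H\<^esub> (\<theta> \<otimes>\<^bsub>?H\<^esub> \<zeta>)"
      by (rule Hom_group_eqI[OF mult[OF mult] mult[OF _ mult]])
        (use \<eta> \<theta> \<zeta> val N' in \<open>simp_all add: Hom_group_mult comm_group.axioms(2) group.is_monoid
          monoid.m_assoc\<close>)
  next
    fix \<eta> assume \<eta>: "\<eta> \<in> carrier ?H"
    show "\<one>\<^bsub>?H\<^esub> \<otimes>\<^bsub>?H\<^esub> \<eta> = \<eta>"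
      by (rule Hom_group_eqI[OF mult[OF one \<eta>] \<eta>])
        (use \<eta> val N' in \<open>simp_all add: Hom_group_mult Hom_group_one comm_group.axioms(2)
          group.is_monoid monoid.l_one\<close>)
    let ?i = "\<lambda>e\<in>Obj C. \<lambda>x\<in>carrier (Grp M e). inv\<^bsub>Grp N e\<^esub> \<eta> e x"
    have i: "?i \<in> carrier ?H"
      by (rule restrict_in_Hom_group[OF M module_map_pointwise_inv[OF N carrier_Hom_groupD(1)[OF \<eta>]]])
    have "?i \<otimes>\<^bsub>?H\<^esub> \<eta> = \<one>\<^bsub>?H\<^esub>"
      by (rule Hom_group_eqI[OF mult[OF i \<eta>] one])
        (use \<eta> val N' in \<open>simp_all add: Hom_group_mult Hom_group_one comm_group.axioms(2) group.l_inv\<close>)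
    with i show "\<exists>\<theta>\<in>carrier ?H. \<theta> \<otimes>\<^bsub>?H\<^esub> \<eta> = \<one>\<^bsub>?H\<^esub>" by blast
  qed (use mult one in auto)
qed

lemma
  assumes M: "is_module C M" and f: "module_map C M M' f"
  shows precompose_in: "\<eta> \<in> carrier (Hom_group C M' N) \<Longrightarrow> precompose C M f \<eta> \<in> carrier (Hom_group C M N)"
    and precompose_mult: "precompose C M f (\<eta> \<otimes>\<^bsub>Hom_group C M' N\<^esub> \<theta>)
      = precompose C M f \<eta> \<otimes>\<^bsub>Hom_group C M N\<^esub> precompose C M f \<theta>"
    and precompose_hom: "precompose C M f \<in> hom (Hom_group C M' N) (Hom_group C M N)"
proof -
  show 1: "precompose C M f \<eta> \<in> carrier (Hom_group C M N)"
    if "\<eta> \<in> carrier (Hom_group C M' N)" for \<eta>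
    using restrict_in_Hom_group[OF M module_map_comp[OF C f carrier_Hom_groupD(1)[OF that]]]
    by (simp add: precompose_def)
  show 2: "precompose C M f (\<eta> \<otimes>\<^bsub>Hom_group C M' N\<^esub> \<theta>)
      = precompose C M f \<eta> \<otimes>\<^bsub>Hom_group C M N\<^esub> precompose C M f \<theta>" for \<eta> \<theta>
    using module_mapD(3)[OF f]
    by (auto simp: precompose_def Hom_group_def fun_eq_iff restrict_def)
  show "precompose C M f \<in> hom (Hom_group C M' N) (Hom_group C M N)"
    by (rule homI) (simp_all add: 1 2)
qed

end

section \<open>Direct summands of free modules\<close>

text \<open>Comparing resolutions whose terms have different element types requires lifting a projective
  module against surjections between modules of several types, which the predicate
  \<open>projective\<close> does not state, as its test modules have the element type of the module itself.
  Being a retract of the free module on itself mentions a single module, and it implies the lifting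
  property at every element type (lemma \<open>free_summand_lift\<close>).\<close>

definition free_summand :: "('o, 'm) cat \<Rightarrow> ('o, 'm, 'u) cmodule \<Rightarrow> bool" where
  "free_summand C P \<longleftrightarrow> is_module C P \<and>
     (\<exists>s q. module_map C P (free_module C P) s \<and> module_map C (free_module C P) P q \<and>
        (\<forall>e\<in>Obj C. \<forall>x\<in>carrier (Grp P e). q e (s e x) = x))"

lemma free_summand_is_module: "free_summand C P \<Longrightarrow> is_module C P"
  by (simp add: free_summand_def)

context
  fixes C :: "('o, 'm) cat"
  assumes C: "category C"
begin

interpretation category C by (rule C)

lemma free_module_generator:
  "\<lbrakk>e \<in> Obj C; m \<in> carrier (Grp M e)\<rbrakk>
    \<Longrightarrow> frag_of (m, Idt C e) \<in> carrier (Grp (free_module C M) e)"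
  by (simp add: gens_def Idt_in Dom_Idt Cod_Idt)

lemma ex_surjection_from_free:
  assumes M: "is_module C M"
  shows "\<exists>p. surjective_map C (free_module C M) M p"
proof -
  obtain p where p: "module_map C (free_module C M) M p"
    and pm: "\<forall>e\<in>Obj C. \<forall>m\<in>carrier (Grp M e). p e (frag_of (m, Idt C e)) = m"
    using free_module_extend[OF C M, of M "\<lambda>e m. m"] by blast
  have "p e ` carrier (Grp (free_module C M) e) = carrier (Grp M e)" if e: "e \<in> Obj C" for e
  proof (intro equalityI subsetI)
    fix m assume m: "m \<in> carrier (Grp M e)"
    then have "m = p e (frag_of (m, Idt C e))" using pm e by simp
    then show "m \<in> p e ` carrier (Grp (free_module C M) e)"
      using free_module_generator[where M = M, OF e m] by (rule image_eqI)
  qed (use module_mapD(3)[OF p e] in blast)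
  with p show ?thesis unfolding surjective_map_def by blast
qed

text \<open>The free module on \<open>P\<close> maps onto \<open>P\<close>, so lifting the identity of \<open>P\<close> against such a
  surjection yields the required section.\<close>

lemma free_summandI:
  assumes P: "is_module C P"
    and lift: "\<And>p. surjective_map C (free_module C P) P p \<Longrightarrow>
      \<exists>s. module_map C P (free_module C P) s \<and> (\<forall>e\<in>Obj C. \<forall>x\<in>carrier (Grp P e). p e (s e x) = x)"
  shows "free_summand C P"
proof -
  obtain p where p: "surjective_map C (free_module C P) P p"
    using ex_surjection_from_free[OF P] by blast
  with lift[OF p] P show ?thesis
    unfolding free_summand_def surjective_map_def by blast
qed

lemma projective_imp_free_summand:
  fixes P :: "('o, 'm, ('m, 'v) univ) cmodule"
  assumes P: "projective C P"
  shows "free_summand C P"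
proof -
  have P': "is_module C P" using P by (simp add: projective_def)
  have "module_map C P P (\<lambda>e x. x)" by (auto simp: module_map_def hom_def)
  then show ?thesis
    using projective_lift[OF C P is_module_free[OF C] P'] by (intro free_summandI[OF P']) blast
qed

text \<open>A map from \<open>P\<close> lifts along \<open>a\<close> whenever its values lie in the image of \<open>a\<close>: choose
  preimages of the values on the generators of the free module on \<open>P\<close>, extend, and restrict along
  the section. Surjectivity of \<open>a\<close> is replaced by a condition on the image because in an exact
  sequence the maps to be lifted land in a kernel, that is, in the image of the next differential.\<close>

lemma free_summand_lift:
  assumes P: "free_summand C P" and M: "is_module C M" and N: "is_module C N"
    and a: "module_map C M N a" and f: "module_map C P N f"
    and im: "\<And>e x. \<lbrakk>e \<in> Obj C; x \<in> carrier (Grp P e)\<rbrakk> \<Longrightarrow> f e x \<in> a e ` carrier (Grp M e)"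
  shows "\<exists>g. module_map C P M g \<and> (\<forall>e\<in>Obj C. \<forall>x\<in>carrier (Grp P e). a e (g e x) = f e x)"
proof -
  obtain s q where s: "module_map C P (free_module C P) s"
    and q: "module_map C (free_module C P) P q"
    and qs: "\<forall>e\<in>Obj C. \<forall>x\<in>carrier (Grp P e). q e (s e x) = x"
    using P unfolding free_summand_def by blast
  define \<phi> where "\<phi> = (\<lambda>e m. SOME y. y \<in> carrier (Grp M e) \<and> a e y = f e (q e (frag_of (m, Idt C e))))"
  have \<phi>: "\<phi> e m \<in> carrier (Grp M e) \<and> a e (\<phi> e m) = f e (q e (frag_of (m, Idt C e)))"
    if "e \<in> Obj C" "m \<in> carrier (Grp P e)" for e m
    unfolding \<phi>_def
    by (rule someI_ex)
      (use im[OF that(1) module_mapD(3)[OF q that(1) free_module_generator[OF that]]] in \<open>auto simp: image_iff\<close>)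
  obtain g where g: "module_map C (free_module C P) M g"
    and g\<phi>: "\<forall>e\<in>Obj C. \<forall>m\<in>carrier (Grp P e). g e (frag_of (m, Idt C e)) = \<phi> e m"
    using free_module_extend[OF C M, of P \<phi>] \<phi> by blast
  have agree: "(a e \<circ> g e) y = (f e \<circ> q e) y"
    if "e \<in> Obj C" "y \<in> carrier (Grp (free_module C P) e)" for e y
    by (rule free_module_map_eq[OF C N module_map_comp[OF C g a] module_map_comp[OF C q f]])
      (use g\<phi> \<phi> that in simp_all)
  have "a e ((g e \<circ> s e) x) = f e x" if "e \<in> Obj C" "x \<in> carrier (Grp P e)" for e x
    using agree[OF that(1) module_mapD(3)[OF s that]] qs that by simp
  then show ?thesis using module_map_comp[OF C s g] by blast
qed

lemma free_summand_imp_projective: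
  assumes P: "free_summand C P" shows "projective C P"
  unfolding projective_def
proof (intro conjI allI impI)
  fix M N :: "('o, 'm, 'a) cmodule" and p f
  assume M: "is_module C M" and N: "is_module C N" and p: "surjective_map C M N p"
    and f: "module_map C P N f"
  show "\<exists>g. module_map C P M g \<and> (\<forall>e\<in>Obj C. \<forall>x\<in>carrier (Grp P e). p e (g e x) = f e x)"
    by (rule free_summand_lift[OF P M N _ f])
      (use p module_mapD(3)[OF f] in \<open>simp_all add: surjective_map_def\<close>)
qed (rule free_summand_is_module[OF P])

lemma free_summand_transport:
  assumes i: "inj i" and P: "free_summand C P"
  shows "free_summand C (transport i P)"
proof (rule free_summandI)
  have P': "is_module C P" by (rule free_summand_is_module[OF P])
  show T: "is_module C (transport i P)" by (rule is_module_transport[OF C i P'])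
  fix p assume p: "surjective_map C (free_module C (transport i P)) (transport i P) p"
  have "\<exists>g. module_map C P (free_module C (transport i P)) g \<and>
      (\<forall>e\<in>Obj C. \<forall>x\<in>carrier (Grp P e). p e (g e x) = i x)"
    by (rule free_summand_lift[OF P is_module_free[OF C] T _ transport_to[OF C i P']])
      (use p module_mapD(3)[OF transport_to[OF C i P']] in \<open>simp_all add: surjective_map_def\<close>)
  then obtain g where g: "module_map C P (free_module C (transport i P)) g"
    and pg: "\<forall>e\<in>Obj C. \<forall>x\<in>carrier (Grp P e). p e (g e x) = i x"
    by blast
  have "p e ((g e \<circ> inv_into UNIV i) x) = x" if "e \<in> Obj C" "x \<in> carrier (Grp (transport i P) e)" for e x
    using pg that i by (auto simp: transport_def)
  then show "\<exists>s. module_map C (transport i P) (free_module C (transport i P)) s \<and>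
      (\<forall>e\<in>Obj C. \<forall>x\<in>carrier (Grp (transport i P) e). p e (s e x) = x)"
    using module_map_comp[OF C transport_from[OF C i P'] g] by blast
qed

end

section \<open>Comparison of resolutions\<close>

text \<open>A projective resolution whose terms have the lifting property at every element type.\<close>

definition summand_resolution ::
  "('o, 'm) cat \<Rightarrow> ('o, 'm, 'v) cmodule \<Rightarrow> ('o, 'm, 'u, 'v) resolution \<Rightarrow> bool" where
  "summand_resolution C M R \<longleftrightarrow> projective_resolution C M R \<and> (\<forall>n. free_summand C (Term R n))"

lemma projective_resolutionD:
  assumes "projective_resolution C M R"
  shows "is_module C (Term R n)"
    and "module_map C (Term R (Suc n)) (Term R n) (Bdry R n)"
    and "module_map C (Term R 0) M (Aug R)"
    and "e \<in> Obj C \<Longrightarrow> Aug R e ` carrier (Grp (Term R 0) e) = carrier (Grp M e)"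
    and "e \<in> Obj C \<Longrightarrow> Bdry R 0 e ` carrier (Grp (Term R (Suc 0)) e) =
      kernel (Grp (Term R 0) e) (Grp M e) (Aug R e)"
    and "e \<in> Obj C \<Longrightarrow> Bdry R (Suc n) e ` carrier (Grp (Term R (Suc (Suc n))) e) =
      kernel (Grp (Term R (Suc n)) e) (Grp (Term R n) e) (Bdry R n e)"
  using assms by (simp_all add: projective_resolution_def projective_def surjective_map_def)

lemma Aug_Bdry:
  assumes "projective_resolution C M R" "e \<in> Obj C" "x \<in> carrier (Grp (Term R (Suc 0)) e)"
  shows "Aug R e (Bdry R 0 e x) = \<one>\<^bsub>Grp M e\<^esub>"
  using projective_resolutionD(5)[OF assms(1,2)] assms(3) by (auto simp: kernel_def)

lemma Bdry_Bdry:
  assumes "projective_resolution C M R" "e \<in> Obj C" "x \<in> carrier (Grp (Term R (Suc (Suc n))) e)"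
  shows "Bdry R n e (Bdry R (Suc n) e x) = \<one>\<^bsub>Grp (Term R n) e\<^esub>"
  using projective_resolutionD(6)[OF assms(1,2)] assms(3) by (auto simp: kernel_def)

definition chain_map ::
  "('o, 'm) cat \<Rightarrow> ('o, 'm, 'u, 'w) resolution \<Rightarrow> ('o, 'm, 'v, 'w) resolution \<Rightarrow>
     (nat \<Rightarrow> 'o \<Rightarrow> 'u \<Rightarrow> 'v) \<Rightarrow> bool" where
  "chain_map C R S f \<longleftrightarrow>
     (\<forall>n. module_map C (Term R n) (Term S n) (f n)) \<and>
     (\<forall>n. \<forall>e\<in>Obj C. \<forall>x\<in>carrier (Grp (Term R (Suc n)) e).
        Bdry S n e (f (Suc n) e x) = f n e (Bdry R n e x))"

definition over_identity ::
  "('o, 'm) cat \<Rightarrow> ('o, 'm, 'u, 'w) resolution \<Rightarrow> ('o, 'm, 'v, 'w) resolution \<Rightarrow>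
     (nat \<Rightarrow> 'o \<Rightarrow> 'u \<Rightarrow> 'v) \<Rightarrow> bool" where
  "over_identity C R S f \<longleftrightarrow>
     (\<forall>e\<in>Obj C. \<forall>x\<in>carrier (Grp (Term R 0) e). Aug S e (f 0 e x) = Aug R e x)"

lemma chain_mapD:
  assumes "chain_map C R S f"
  shows "module_map C (Term R n) (Term S n) (f n)"
    and "\<lbrakk>e \<in> Obj C; x \<in> carrier (Grp (Term R (Suc n)) e)\<rbrakk>
      \<Longrightarrow> Bdry S n e (f (Suc n) e x) = f n e (Bdry R n e x)"
    and "\<lbrakk>e \<in> Obj C; x \<in> carrier (Grp (Term R n) e)\<rbrakk> \<Longrightarrow> f n e x \<in> carrier (Grp (Term S n) e)"
proof -
  show f: "module_map C (Term R n) (Term S n) (f n)" using assms by (simp add: chain_map_def)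
  show "\<lbrakk>e \<in> Obj C; x \<in> carrier (Grp (Term R (Suc n)) e)\<rbrakk>
      \<Longrightarrow> Bdry S n e (f (Suc n) e x) = f n e (Bdry R n e x)"
    using assms by (simp add: chain_map_def)
  show "\<lbrakk>e \<in> Obj C; x \<in> carrier (Grp (Term R n) e)\<rbrakk> \<Longrightarrow> f n e x \<in> carrier (Grp (Term S n) e)"
    by (rule module_mapD(3)[OF f])
qed

context
  fixes C :: "('o, 'm) cat"
  assumes C: "category C"
begin

interpretation category C by (rule C)

text \<open>The usual recursion: once \<open>f\<^sub>n\<close> is compatible with the previous differential, the composite of
  the differential with \<open>f\<^sub>n\<close> takes values in cycles of \<open>S\<close>, which are boundaries by exactness, and
  so it lifts to \<open>f\<^sub>n\<^sub>+\<^sub>1\<close>. The predicate \<open>good\<close> in the proof records this property of the image, which is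
  what the next step needs.\<close>

lemma ex_chain_map:
  fixes M :: "('o, 'm, 'w) cmodule"
  assumes M: "is_module C M" and R: "summand_resolution C M R" and S: "projective_resolution C M S"
  shows "\<exists>f. chain_map C R S f \<and> over_identity C R S f"
proof -
  have Rp: "projective_resolution C M R" and Rs: "\<And>n. free_summand C (Term R n)"
    using R by (auto simp: summand_resolution_def)
  note Rd = projective_resolutionD[OF Rp] and Sd = projective_resolutionD[OF S]
  define step where "step = (\<lambda>n f f'. \<forall>e\<in>Obj C. \<forall>x\<in>carrier (Grp (Term R (Suc n)) e).
    Bdry S n e (f' e x) = f e (Bdry R n e x))"
  define good where "good = (\<lambda>n f. module_map C (Term R n) (Term S n) f \<and>
    (\<forall>e\<in>Obj C. \<forall>x\<in>carrier (Grp (Term R (Suc n)) e).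
      f e (Bdry R n e x) \<in> Bdry S n e ` carrier (Grp (Term S (Suc n)) e)) \<and>
    (n = 0 \<longrightarrow> (\<forall>e\<in>Obj C. \<forall>x\<in>carrier (Grp (Term R 0) e). Aug S e (f e x) = Aug R e x)))"
  have "\<exists>f. \<forall>n. good n (f n) \<and> step n (f n) (f (Suc n))"
  proof (rule dependent_nat_choice)
    obtain f where f: "module_map C (Term R 0) (Term S 0) f"
      and fa: "\<forall>e\<in>Obj C. \<forall>x\<in>carrier (Grp (Term R 0) e). Aug S e (f e x) = Aug R e x"
      using free_summand_lift[OF C Rs Sd(1) M Sd(3) Rd(3)] Sd(4) module_mapD(3)[OF Rd(3)] by blast
    have "f e (Bdry R 0 e x) \<in> Bdry S 0 e ` carrier (Grp (Term S (Suc 0)) e)"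
      if e: "e \<in> Obj C" and x: "x \<in> carrier (Grp (Term R (Suc 0)) e)" for e x
      using module_mapD(3)[OF Rd(2) e x] e fa Aug_Bdry[OF Rp e x] module_mapD(3)[OF f e]
      by (simp add: Sd(5) kernel_def)
    with f fa show "\<exists>f. good 0 f" unfolding good_def by blast
  next
    fix f n assume good: "good n f"
    then have f: "module_map C (Term R n) (Term S n) f" by (simp add: good_def)
    obtain f' where f': "module_map C (Term R (Suc n)) (Term S (Suc n)) f'"
      and st: "\<forall>e\<in>Obj C. \<forall>x\<in>carrier (Grp (Term R (Suc n)) e).
        Bdry S n e (f' e x) = (f e \<circ> Bdry R n e) x"
      using free_summand_lift[OF C Rs Sd(1) Sd(1) Sd(2) module_map_comp[OF C Rd(2) f]] good
      unfolding good_def by auto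
    have "f' e (Bdry R (Suc n) e x) \<in> Bdry S (Suc n) e ` carrier (Grp (Term S (Suc (Suc n))) e)"
      if e: "e \<in> Obj C" and x: "x \<in> carrier (Grp (Term R (Suc (Suc n))) e)" for e x
    proof -
      have y: "Bdry R (Suc n) e x \<in> carrier (Grp (Term R (Suc n)) e)"
        by (rule module_mapD(3)[OF Rd(2) e x])
      then have "Bdry S n e (f' e (Bdry R (Suc n) e x)) = f e (Bdry R n e (Bdry R (Suc n) e x))"
        using st e by simp
      also have "\<dots> = \<one>\<^bsub>Grp (Term S n) e\<^esub>"
        using Bdry_Bdry[OF Rp e x] module_map_one[OF Rd(1) Sd(1) f e] by simp
      finally show ?thesis
        using module_mapD(3)[OF f' e y] e by (simp add: Sd(6) kernel_def)
    qed
    with f' st show "\<exists>f'. good (Suc n) f' \<and> step n f f'"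
      unfolding good_def step_def by auto
  qed
  then obtain f where "\<And>n. good n (f n)" "\<And>n. step n (f n) (f (Suc n))" by blast
  then show ?thesis
    by (intro exI[of _ f]) (simp add: chain_map_def over_identity_def good_def step_def)
qed

text \<open>A chain map that induces zero on the resolved module is null-homotopic: the difference
  \<open>\<delta>\<^sub>n\<^sub>+\<^sub>1 - h\<^sub>n d\<close> consists of cycles of the exact complex \<open>S\<close>, so it lifts along the differential to
  \<open>h\<^sub>n\<^sub>+\<^sub>1\<close>.\<close>

lemma ex_null_homotopy:
  fixes M :: "('o, 'm, 'w) cmodule"
  assumes R: "summand_resolution C M R" and S: "projective_resolution C M S"
    and \<delta>: "chain_map C R S \<delta>"
    and \<delta>0: "\<And>e x. \<lbrakk>e \<in> Obj C; x \<in> carrier (Grp (Term R 0) e)\<rbrakk> \<Longrightarrow> Aug S e (\<delta> 0 e x) = \<one>\<^bsub>Grp M e\<^esub>"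
  shows "\<exists>h. (\<forall>n. module_map C (Term R n) (Term S (Suc n)) (h n)) \<and>
    (\<forall>e\<in>Obj C. \<forall>x\<in>carrier (Grp (Term R 0) e). \<delta> 0 e x = Bdry S 0 e (h 0 e x)) \<and>
    (\<forall>n. \<forall>e\<in>Obj C. \<forall>x\<in>carrier (Grp (Term R (Suc n)) e).
      \<delta> (Suc n) e x = Bdry S (Suc n) e (h (Suc n) e x) \<otimes>\<^bsub>Grp (Term S (Suc n)) e\<^esub> h n e (Bdry R n e x))"
proof -
  have Rp: "projective_resolution C M R" and Rs: "\<And>n. free_summand C (Term R n)"
    using R by (auto simp: summand_resolution_def)
  note Rd = projective_resolutionD[OF Rp] and Sd = projective_resolutionD[OF S]
  note \<delta>d = chain_mapD[OF \<delta>]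
  have Sg: "group (Grp (Term S n) e)" if "e \<in> Obj C" for n e by (rule is_moduleD(2)[OF Sd(1) that])
  define step where "step = (\<lambda>n h h'. \<forall>e\<in>Obj C. \<forall>x\<in>carrier (Grp (Term R (Suc n)) e).
    \<delta> (Suc n) e x = Bdry S (Suc n) e (h' e x) \<otimes>\<^bsub>Grp (Term S (Suc n)) e\<^esub> h e (Bdry R n e x))"
  define good where "good = (\<lambda>n h. module_map C (Term R n) (Term S (Suc n)) h \<and>
    (\<forall>e\<in>Obj C. \<forall>x\<in>carrier (Grp (Term R (Suc n)) e).
      Bdry S n e (h e (Bdry R n e x)) = \<delta> n e (Bdry R n e x)) \<and>
    (n = 0 \<longrightarrow> (\<forall>e\<in>Obj C. \<forall>x\<in>carrier (Grp (Term R 0) e). \<delta> 0 e x = Bdry S 0 e (h e x))))"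
  have "\<exists>h. \<forall>n. good n (h n) \<and> step n (h n) (h (Suc n))"
  proof (rule dependent_nat_choice)
    have "\<delta> 0 e x \<in> Bdry S 0 e ` carrier (Grp (Term S (Suc 0)) e)"
      if "e \<in> Obj C" "x \<in> carrier (Grp (Term R 0) e)" for e x
      using that \<delta>0 \<delta>d(3) by (simp add: Sd(5) kernel_def)
    then obtain h where h: "module_map C (Term R 0) (Term S (Suc 0)) h"
      and h0: "\<forall>e\<in>Obj C. \<forall>x\<in>carrier (Grp (Term R 0) e). Bdry S 0 e (h e x) = \<delta> 0 e x"
      using free_summand_lift[OF C Rs Sd(1) Sd(1) Sd(2) \<delta>d(1)] by blast
    then show "\<exists>h. good 0 h"
      using module_mapD(3)[OF Rd(2)] unfolding good_def by auto
  next
    fix h n assume good: "good n h"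
    then have h: "module_map C (Term R n) (Term S (Suc n)) h" by (simp add: good_def)
    \<comment> \<open>the cycle \<open>\<delta>\<^sub>n\<^sub>+\<^sub>1 - h\<^sub>n d\<close>, in multiplicative notation\<close>
    let ?k = "\<lambda>e x. \<delta> (Suc n) e x \<otimes>\<^bsub>Grp (Term S (Suc n)) e\<^esub>
      inv\<^bsub>Grp (Term S (Suc n)) e\<^esub> (h e \<circ> Bdry R n e) x"
    have k: "module_map C (Term R (Suc n)) (Term S (Suc n)) ?k"
      by (intro module_map_pointwise_mult[OF C Sd(1)] module_map_pointwise_inv[OF C Sd(1)]
          module_map_comp[OF C Rd(2) h] \<delta>d(1))
    have "?k e x \<in> Bdry S (Suc n) e ` carrier (Grp (Term S (Suc (Suc n))) e)"
      if e: "e \<in> Obj C" and x: "x \<in> carrier (Grp (Term R (Suc n)) e)" for e x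
    proof -
      have y: "h e (Bdry R n e x) \<in> carrier (Grp (Term S (Suc n)) e)"
        by (rule module_mapD(3)[OF h e module_mapD(3)[OF Rd(2) e x]])
      have "Bdry S n e (?k e x) = Bdry S n e (\<delta> (Suc n) e x) \<otimes>\<^bsub>Grp (Term S n) e\<^esub>
          inv\<^bsub>Grp (Term S n) e\<^esub> Bdry S n e (h e (Bdry R n e x))"
        using module_map_mult[OF Sd(2) e \<delta>d(3)[OF e x], of "inv\<^bsub>Grp (Term S (Suc n)) e\<^esub> h e (Bdry R n e x)"]
          module_map_inv[OF Sd(1) Sd(1) Sd(2) e y] y Sg[OF e]
        by simp
      also have "Bdry S n e (h e (Bdry R n e x)) = Bdry S n e (\<delta> (Suc n) e x)"
        using good e x \<delta>d(2)[OF e x] by (simp add: good_def)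
      finally have "Bdry S n e (?k e x) = \<one>\<^bsub>Grp (Term S n) e\<^esub>"
        using module_mapD(3)[OF Sd(2) e \<delta>d(3)[OF e x]] Sg[OF e] by (simp add: group.r_inv)
      then show ?thesis
        using module_mapD(3)[OF k e x] e by (simp add: Sd(6) kernel_def)
    qed
    then obtain h' where h': "module_map C (Term R (Suc n)) (Term S (Suc (Suc n))) h'"
      and hk: "\<forall>e\<in>Obj C. \<forall>x\<in>carrier (Grp (Term R (Suc n)) e). Bdry S (Suc n) e (h' e x) = ?k e x"
      using free_summand_lift[OF C Rs Sd(1) Sd(1) Sd(2) k] by blast
    have "\<delta> (Suc n) e x = ?k e x \<otimes>\<^bsub>Grp (Term S (Suc n)) e\<^esub> h e (Bdry R n e x)"
      if e: "e \<in> Obj C" and x: "x \<in> carrier (Grp (Term R (Suc n)) e)" for e x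
    proof -
      interpret comm_group "Grp (Term S (Suc n)) e" by (rule is_moduleD(1)[OF Sd(1) e])
      show ?thesis
        using \<delta>d(3)[OF e x] module_mapD(3)[OF h e module_mapD(3)[OF Rd(2) e x]]
        by (simp add: m_assoc)
    qed
    then have st: "step n h h'" using hk by (simp add: step_def)
    have "Bdry S (Suc n) e (h' e (Bdry R (Suc n) e x)) = \<delta> (Suc n) e (Bdry R (Suc n) e x)"
      if e: "e \<in> Obj C" and x: "x \<in> carrier (Grp (Term R (Suc (Suc n))) e)" for e x
    proof -
      have y: "Bdry R (Suc n) e x \<in> carrier (Grp (Term R (Suc n)) e)"
        by (rule module_mapD(3)[OF Rd(2) e x])
      interpret comm_group "Grp (Term S (Suc n)) e" by (rule is_moduleD(1)[OF Sd(1) e])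
      show ?thesis
        using hk e y Bdry_Bdry[OF Rp e x] module_map_one[OF Rd(1) Sd(1) h e] \<delta>d(3)[OF e y]
        by simp
    qed
    with h' st show "\<exists>h'. good (Suc n) h' \<and> step n h h'"
      unfolding good_def by auto
  qed
  then obtain h where "\<And>n. good n (h n)" "\<And>n. step n (h n) (h (Suc n))" by blast
  then show ?thesis
    by (intro exI[of _ h]) (simp add: good_def step_def)
qed

end

section \<open>Independence of the resolution\<close>

context
  fixes C :: "('o, 'm) cat"
  assumes C: "category C"
begin

interpretation category C by (rule C)

lemma coboundary_group_hom:
  assumes R: "projective_resolution C M R" and N: "is_module C N"
  shows "group_hom (Hom_group C (Term R n) N) (Hom_group C (Term R (Suc n)) N) (coboundary C R n)"
  using comm_group_Hom_group[OF C projective_resolutionD(1)[OF R] N]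
    precompose_hom[OF C projective_resolutionD(1,2)[OF R]]
  by (simp add: group_hom_def group_hom_axioms_def comm_group.axioms(2) coboundary_eq)

lemma cocycles_iff:
  assumes R: "projective_resolution C M R" and N: "is_module C N"
  shows "\<eta> \<in> cocycles C R N n \<longleftrightarrow> \<eta> \<in> carrier (Hom_group C (Term R n) N) \<and>
    (\<forall>e\<in>Obj C. \<forall>x\<in>carrier (Grp (Term R (Suc n)) e). \<eta> e (Bdry R n e x) = \<one>\<^bsub>Grp N e\<^esub>)"
proof -
  interpret \<delta>: group_hom "Hom_group C (Term R n) N" "Hom_group C (Term R (Suc n)) N" "coboundary C R n"
    by (rule coboundary_group_hom[OF R N])
  have "coboundary C R n \<eta> = \<one>\<^bsub>Hom_group C (Term R (Suc n)) N\<^esub> \<longleftrightarrow>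
    (\<forall>e\<in>Obj C. \<forall>x\<in>carrier (Grp (Term R (Suc n)) e). \<eta> e (Bdry R n e x) = \<one>\<^bsub>Grp N e\<^esub>)"
    (is "?l \<longleftrightarrow> ?r") if \<eta>: "\<eta> \<in> carrier (Hom_group C (Term R n) N)"
  proof
    assume ?l
    show ?r
    proof (intro ballI)
      fix e x assume "e \<in> Obj C" "x \<in> carrier (Grp (Term R (Suc n)) e)"
      then show "\<eta> e (Bdry R n e x) = \<one>\<^bsub>Grp N e\<^esub>"
        using fun_cong[OF fun_cong[OF \<open>?l\<close>], of e x] by (simp add: coboundary_eq Hom_group_one)
    qed
  next
    assume ?r
    then show ?l
      by (intro Hom_group_eqI[OF \<delta>.hom_closed[OF \<eta>] \<delta>.H.one_closed])
        (simp add: coboundary_eq Hom_group_one)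
  qed
  then show ?thesis by (auto simp: cocycles_def kernel_def)
qed

lemma cocycles_subgroup:
  assumes R: "projective_resolution C M R" and N: "is_module C N"
  shows "subgroup (cocycles C R N n) (Hom_group C (Term R n) N)"
  unfolding cocycles_def by (rule group_hom.subgroup_kernel[OF coboundary_group_hom[OF R N]])

lemma coboundaries_subset_cocycles:
  assumes R: "projective_resolution C M R" and N: "is_module C N"
  shows "coboundaries C R N n \<subseteq> cocycles C R N n"
proof (cases n)
  case 0
  then show ?thesis using subgroup.one_closed[OF cocycles_subgroup[OF R N]] by simp
next
  case (Suc m)
  note Rd = projective_resolutionD[OF R]
  have "coboundary C R m \<eta> \<in> cocycles C R N (Suc m)"
    if \<eta>: "\<eta> \<in> carrier (Hom_group C (Term R m) N)" for \<eta>
    using group_hom.hom_closed[OF coboundary_group_hom[OF R N] \<eta>] module_mapD(3)[OF Rd(2)]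
      Bdry_Bdry[OF R] module_map_one[OF Rd(1) N carrier_Hom_groupD(1)[OF \<eta>]]
    by (simp add: cocycles_iff[OF R N] coboundary_eq)
  then show ?thesis by (auto simp: Suc)
qed

lemma cohomology_subgroups:
  assumes R: "projective_resolution C M R" and N: "is_module C N"
  shows "comm_group ((Hom_group C (Term R n) N)\<lparr>carrier := cocycles C R N n\<rparr>)"
    and "subgroup (coboundaries C R N n) ((Hom_group C (Term R n) N)\<lparr>carrier := cocycles C R N n\<rparr>)"
proof -
  interpret H: comm_group "Hom_group C (Term R n) N"
    by (rule comm_group_Hom_group[OF C projective_resolutionD(1)[OF R] N])
  note Z = cocycles_subgroup[OF R N, of n]
  show "comm_group ((Hom_group C (Term R n) N)\<lparr>carrier := cocycles C R N n\<rparr>)"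
    by (rule group.group_comm_groupI[OF H.subgroup_imp_group[OF Z]])
      (use subgroup.subset[OF Z] in \<open>auto intro: H.m_comm\<close>)
  have "subgroup (coboundaries C R N n) (Hom_group C (Term R n) N)"
  proof (cases n)
    case 0
    then show ?thesis using H.triv_subgroup by simp
  next
    case (Suc m)
    then show ?thesis using group_hom.img_is_subgroup[OF coboundary_group_hom[OF R N, of m]] by simp
  qed
  then show "subgroup (coboundaries C R N n) ((Hom_group C (Term R n) N)\<lparr>carrier := cocycles C R N n\<rparr>)"
    by (rule H.subgroup_incl[OF _ Z coboundaries_subset_cocycles[OF R N]])
qed

lemma
  assumes R: "projective_resolution C M R" and S: "projective_resolution C M S"
    and N: "is_module C N" and f: "chain_map C R S f"
  shows precompose_cocycle: "\<eta> \<in> cocycles C S N n \<Longrightarrow> precompose C (Term R n) (f n) \<eta> \<in> cocycles C R N n"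
    and precompose_coboundary:
      "\<eta> \<in> coboundaries C S N n \<Longrightarrow> precompose C (Term R n) (f n) \<eta> \<in> coboundaries C R N n"
proof -
  note Rd = projective_resolutionD[OF R] and Sd = projective_resolutionD[OF S] and fd = chain_mapD[OF f]
  interpret f: group_hom "Hom_group C (Term S n) N" "Hom_group C (Term R n) N"
    "precompose C (Term R n) (f n)" for n
    using comm_group_Hom_group[OF C Rd(1) N] comm_group_Hom_group[OF C Sd(1) N]
      precompose_hom[OF C Rd(1) fd(1)]
    by (simp add: group_hom_def group_hom_axioms_def comm_group.axioms(2))
  show "precompose C (Term R n) (f n) \<eta> \<in> cocycles C R N n" if \<eta>: "\<eta> \<in> cocycles C S N n"
    using \<eta> module_mapD(3)[OF Rd(2)] fd(3) fd(2)[symmetric]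
    by (simp add: cocycles_iff[OF R N] cocycles_iff[OF S N])
  show "precompose C (Term R n) (f n) \<eta> \<in> coboundaries C R N n" if \<eta>: "\<eta> \<in> coboundaries C S N n"
  proof (cases n)
    case 0
    then show ?thesis using \<eta> by simp
  next
    case (Suc m)
    then obtain \<theta> where \<theta>: "\<theta> \<in> carrier (Hom_group C (Term S m) N)" "\<eta> = coboundary C S m \<theta>"
      using \<eta> by auto
    have "precompose C (Term R (Suc m)) (f (Suc m)) \<eta> = coboundary C R m (precompose C (Term R m) (f m) \<theta>)"
      using \<theta> fd(2,3) module_mapD(3)[OF Rd(2)]
      by (auto simp: coboundary_eq precompose_def fun_eq_iff restrict_def)
    then show ?thesis using \<theta> by (auto simp: Suc)
  qed
qed

text \<open>The composite \<open>g f\<close> and the identity lift the same map of the resolved module, so their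
  difference \<open>\<delta>\<close> has a null homotopy \<open>h\<close>. A cocycle \<open>\<eta>\<close> kills boundaries, and hence
  \<open>\<eta> \<delta> = \<eta> h d\<close> is the coboundary of \<open>\<eta> h\<close>; in degree zero it vanishes.\<close>

lemma precompose_homotopic:
  fixes M :: "('o, 'm, 'w) cmodule"
  assumes M: "is_module C M" and R: "summand_resolution C M R" and S: "projective_resolution C M S"
    and N: "is_module C N"
    and f: "chain_map C R S f" "over_identity C R S f"
    and g: "chain_map C S R g" "over_identity C S R g"
    and \<eta>: "\<eta> \<in> cocycles C R N n"
  shows "\<exists>b\<in>coboundaries C R N n.
    precompose C (Term R n) (f n) (precompose C (Term S n) (g n) \<eta>) = \<eta> \<otimes>\<^bsub>Hom_group C (Term R n) N\<^esub> b"
proof -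
  have Rp: "projective_resolution C M R" using R by (simp add: summand_resolution_def)
  note Rd = projective_resolutionD[OF Rp] and Sd = projective_resolutionD[OF S]
    and fd = chain_mapD[OF f(1)] and gd = chain_mapD[OF g(1)]
  have id: "module_map C (Term R n) (Term R n) (\<lambda>e x. x)" for n
    by (auto simp: module_map_def hom_def)
  have Rg: "comm_group (Grp (Term R n) e)" "group (Grp (Term R n) e)" if "e \<in> Obj C" for n e
    using is_moduleD(1,2)[OF Rd(1) that] by auto
  \<comment> \<open>the difference \<open>g f - id\<close>, in multiplicative notation\<close>
  define \<delta> where "\<delta> = (\<lambda>n e x. (g n e \<circ> f n e) x \<otimes>\<^bsub>Grp (Term R n) e\<^esub> inv\<^bsub>Grp (Term R n) e\<^esub> x)"
  have \<delta>m: "module_map C (Term R n) (Term R n) (\<delta> n)" for n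
    unfolding \<delta>_def
    by (rule module_map_pointwise_mult[OF C Rd(1) module_map_comp[OF C fd(1) gd(1)]
          module_map_pointwise_inv[OF C Rd(1) id]])
  have "chain_map C R R \<delta>"
    unfolding chain_map_def
  proof (intro conjI allI ballI)
    fix n e x assume e: "e \<in> Obj C" and x: "x \<in> carrier (Grp (Term R (Suc n)) e)"
    show "Bdry R n e (\<delta> (Suc n) e x) = \<delta> n e (Bdry R n e x)"
      using module_map_mult[OF Rd(2) e gd(3)[OF e fd(3)[OF e x]], of "inv\<^bsub>Grp (Term R (Suc n)) e\<^esub> x"]
        module_map_inv[OF Rd(1) Rd(1) Rd(2) e x] gd(2)[OF e fd(3)[OF e x]] fd(2)[OF e x] Rg[OF e] x
      by (simp add: \<delta>_def)
  qed (rule \<delta>m)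
  moreover have "Aug R e (\<delta> 0 e x) = \<one>\<^bsub>Grp M e\<^esub>"
    if e: "e \<in> Obj C" and x: "x \<in> carrier (Grp (Term R 0) e)" for e x
  proof -
    have "Aug R e (g 0 e (f 0 e x)) = Aug R e x"
      using f(2) g(2) e x fd(3)[OF e x] by (simp add: over_identity_def)
    then show ?thesis
      using module_map_mult[OF Rd(3) e gd(3)[OF e fd(3)[OF e x]], of "inv\<^bsub>Grp (Term R 0) e\<^esub> x"]
        module_map_inv[OF Rd(1) M Rd(3) e x] module_mapD(3)[OF Rd(3) e x] Rg[OF e] x
        is_moduleD(2)[OF M e]
      by (simp add: \<delta>_def group.r_inv)
  qed
  ultimately obtain h where h: "\<And>n. module_map C (Term R n) (Term R (Suc n)) (h n)"
    and h0: "\<And>e x. \<lbrakk>e \<in> Obj C; x \<in> carrier (Grp (Term R 0) e)\<rbrakk> \<Longrightarrow> \<delta> 0 e x = Bdry R 0 e (h 0 e x)"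
    and hS: "\<And>n e x. \<lbrakk>e \<in> Obj C; x \<in> carrier (Grp (Term R (Suc n)) e)\<rbrakk> \<Longrightarrow>
      \<delta> (Suc n) e x = Bdry R (Suc n) e (h (Suc n) e x) \<otimes>\<^bsub>Grp (Term R (Suc n)) e\<^esub> h n e (Bdry R n e x)"
    using ex_null_homotopy[OF C R Rp, of \<delta>] by blast
  have \<eta>H: "\<eta> \<in> carrier (Hom_group C (Term R n) N)"
    and \<eta>d: "\<And>e x. \<lbrakk>e \<in> Obj C; x \<in> carrier (Grp (Term R (Suc n)) e)\<rbrakk> \<Longrightarrow> \<eta> e (Bdry R n e x) = \<one>\<^bsub>Grp N e\<^esub>"
    using \<eta> by (simp_all add: cocycles_iff[OF Rp N])
  note \<eta>m = carrier_Hom_groupD(1)[OF \<eta>H]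
  have split: "\<eta> e (g n e (f n e x)) = \<eta> e x \<otimes>\<^bsub>Grp N e\<^esub> \<eta> e (\<delta> n e x)"
    if e: "e \<in> Obj C" and x: "x \<in> carrier (Grp (Term R n) e)" for e x
  proof -
    interpret R: comm_group "Grp (Term R n) e" by (rule Rg[OF e])
    have "g n e (f n e x) = x \<otimes>\<^bsub>Grp (Term R n) e\<^esub> \<delta> n e x"
      using x gd(3)[OF e fd(3)[OF e x]] by (simp add: \<delta>_def R.m_comm[of x] R.m_assoc)
    then show ?thesis
      using module_map_mult[OF \<eta>m e x module_mapD(3)[OF \<delta>m e x]] by simp
  qed
  have c: "precompose C (Term R n) (f n) (precompose C (Term S n) (g n) \<eta>) \<in> carrier (Hom_group C (Term R n) N)"
    by (rule precompose_in[OF C Rd(1) fd(1) precompose_in[OF C Sd(1) gd(1) \<eta>H]])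
  interpret H: comm_group "Hom_group C (Term R n) N"
    by (rule comm_group_Hom_group[OF C Rd(1) N])
  have concl: ?thesis
    if b: "b \<in> coboundaries C R N n"
      and bv: "\<And>e x. \<lbrakk>e \<in> Obj C; x \<in> carrier (Grp (Term R n) e)\<rbrakk> \<Longrightarrow> \<eta> e (\<delta> n e x) = b e x" for b
  proof (rule bexI[OF _ b], rule Hom_group_eqI[OF c H.m_closed[OF \<eta>H]])
    show "b \<in> carrier (Hom_group C (Term R n) N)"
      using subsetD[OF coboundaries_subset_cocycles[OF Rp N] b] by (simp add: cocycles_iff[OF Rp N])
  qed (simp add: fd(3) split bv Hom_group_mult)
  show ?thesis
  proof (cases n)
    case 0
    show ?thesis
    proof (rule concl)
      show "\<one>\<^bsub>Hom_group C (Term R n) N\<^esub> \<in> coboundaries C R N n" by (simp add: 0)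
    next
      fix e x assume "e \<in> Obj C" "x \<in> carrier (Grp (Term R n) e)"
      then show "\<eta> e (\<delta> n e x) = \<one>\<^bsub>Hom_group C (Term R n) N\<^esub> e x"
        using \<eta>d module_mapD(3)[OF h] h0 by (simp add: 0 Hom_group_one)
    qed
  next
    case (Suc m)
    have \<eta>h: "precompose C (Term R m) (h m) \<eta> \<in> carrier (Hom_group C (Term R m) N)"
      using precompose_in[OF C Rd(1) h] \<eta>H by (simp add: Suc)
    show ?thesis
    proof (rule concl)
      show "coboundary C R m (precompose C (Term R m) (h m) \<eta>) \<in> coboundaries C R N n"
        using \<eta>h by (simp add: Suc)
    next
      fix e x assume e: "e \<in> Obj C" and x: "x \<in> carrier (Grp (Term R n) e)"
      have x': "x \<in> carrier (Grp (Term R (Suc m)) e)" using x by (simp add: Suc)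
      have y: "h n e x \<in> carrier (Grp (Term R (Suc n)) e)" by (rule module_mapD(3)[OF h e x])
      have z: "h m e (Bdry R m e x) \<in> carrier (Grp (Term R n) e)"
        using module_mapD(3)[OF h e module_mapD(3)[OF Rd(2) e x']] by (simp add: Suc)
      have "\<delta> n e x = Bdry R n e (h n e x) \<otimes>\<^bsub>Grp (Term R n) e\<^esub> h m e (Bdry R m e x)"
        using hS[OF e x'] by (simp add: Suc)
      then have "\<eta> e (\<delta> n e x) = \<eta> e (Bdry R n e (h n e x)) \<otimes>\<^bsub>Grp N e\<^esub> \<eta> e (h m e (Bdry R m e x))"
        using module_map_mult[OF \<eta>m e module_mapD(3)[OF Rd(2) e y] z] by simp
      also have "\<dots> = \<eta> e (h m e (Bdry R m e x))"
        using \<eta>d[OF e y] module_mapD(3)[OF \<eta>m e z] is_moduleD(2)[OF N e]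
        by (simp add: group.is_monoid monoid.l_one)
      also have "\<dots> = coboundary C R m (precompose C (Term R m) (h m) \<eta>) e x"
        using e x' module_mapD(3)[OF Rd(2) e x'] by (simp add: coboundary_eq)
      finally show "\<eta> e (\<delta> n e x) = coboundary C R m (precompose C (Term R m) (h m) \<eta>) e x" .
    qed
  qed
qed

text \<open>\<open>Ext\<close> may be computed from any resolution by direct summands of free modules: chain maps in
  both directions over the identity of \<open>M\<close> exist, and by lemma \<open>precompose_homotopic\<close> their
  composites change cocycles only by coboundaries. The two resolutions may have different element types.\<close>

theorem cohomology_group_unique:
  fixes M :: "('o, 'm, 'w) cmodule"
  assumes M: "is_module C M" and N: "is_module C N"
    and R: "summand_resolution C M R" and S: "summand_resolution C M S"
  shows "cohomology_group C R N n \<cong> cohomology_group C S N n"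
proof -
  have Rp: "projective_resolution C M R" and Sp: "projective_resolution C M S"
    using R S by (simp_all add: summand_resolution_def)
  obtain f where f: "chain_map C R S f" "over_identity C R S f" using ex_chain_map[OF C M R Sp] by blast
  obtain g where g: "chain_map C S R g" "over_identity C S R g" using ex_chain_map[OF C M S Rp] by blast
  show ?thesis
    unfolding cohomology_group_def
  proof (rule quotient_iso[where \<phi> = "precompose C (Term S n) (g n)" and \<psi> = "precompose C (Term R n) (f n)"])
    show "precompose C (Term S n) (g n) \<in> hom (Hom_group C (Term R n) N\<lparr>carrier := cocycles C R N n\<rparr>)
        (Hom_group C (Term S n) N\<lparr>carrier := cocycles C S N n\<rparr>)"
      using precompose_cocycle[OF Sp Rp N g(1)]
      by (auto intro!: homI precompose_mult[OF C projective_resolutionD(1)[OF Sp] chain_mapD(1)[OF g(1)]])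
    show "precompose C (Term R n) (f n) \<in> hom (Hom_group C (Term S n) N\<lparr>carrier := cocycles C S N n\<rparr>)
        (Hom_group C (Term R n) N\<lparr>carrier := cocycles C R N n\<rparr>)"
      using precompose_cocycle[OF Rp Sp N f(1)]
      by (auto intro!: homI precompose_mult[OF C projective_resolutionD(1)[OF Rp] chain_mapD(1)[OF f(1)]])
  qed (use cohomology_subgroups[OF Rp N] cohomology_subgroups[OF Sp N]
      precompose_coboundary[OF Sp Rp N g(1)] precompose_coboundary[OF Rp Sp N f(1)]
      precompose_homotopic[OF M R Sp N f g] precompose_homotopic[OF M S Rp N g f] in simp_all)
qed

end

section \<open>The module of an ordered groupoid with a greatest identity\<close>

context ordered_groupoid
begin

text \<open>When \<open>t\<close> is the greatest identity, every arrow \<open>g\<close> gives a morphism \<open>(t, g)\<close>, so the basis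
  of \<open>\<int>G\<close> at \<open>e\<close> is the set of morphisms from \<open>t\<close> to \<open>e\<close>. Thus \<open>\<int>G\<close> is the free module on one
  generator placed at \<open>t\<close>: by the Yoneda lemma a map from it is an arbitrary choice of an element
  at \<open>t\<close>. Without a greatest identity, \<open>\<int>G\<close> need not be projective.\<close>

context
  fixes t
  assumes t: "t \<in> Obj G" and top: "\<And>e. e \<in> Obj G \<Longrightarrow> Le G e t"
begin

lemma top_Mor_LCat: "g \<in> Mor G \<Longrightarrow> (t, g) \<in> Mor (LCat G)"
  using t top by (simp add: LCat_simps Dom_in)

lemma Act_ZG_top: "g \<in> Mor G \<Longrightarrow> Act (ZG G) (t, g) (frag_of t) = frag_of g"
  using t top by (simp add: Act_ZG_of corestr_Obj Dom_in Obj_Cmp)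

lemma top_generator: "frag_of t \<in> carrier (Grp (ZG G) t)"
  using t by (simp add: ZG_def Obj_Mor Cod_Obj)

lemma ZG_top_map_eq:
  assumes N: "is_module (LCat G) N"
    and \<eta>: "module_map (LCat G) (ZG G) N \<eta>" and \<theta>: "module_map (LCat G) (ZG G) N \<theta>"
    and eq: "\<eta> t (frag_of t) = \<theta> t (frag_of t)"
    and e: "e \<in> Obj G" and x: "x \<in> carrier (Grp (ZG G) e)"
  shows "\<eta> e x = \<theta> e x"
proof (rule hom_free_eq[where S = "{k \<in> Mor G. Cod G k = e}"])
  have e': "e \<in> Obj (LCat G)" using e by (simp add: LCat_simps)
  show "group (Grp N e)" by (rule is_moduleD(2)[OF N e'])
  show "\<eta> e \<in> hom (free_Abelian_group {k \<in> Mor G. Cod G k = e}) (Grp N e)"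
    "\<theta> e \<in> hom (free_Abelian_group {k \<in> Mor G. Cod G k = e}) (Grp N e)"
    using module_mapD(1)[OF \<eta> e'] module_mapD(1)[OF \<theta> e'] by (simp_all add: ZG_def)
  fix k assume "k \<in> {k \<in> Mor G. Cod G k = e}"
  then have k: "k \<in> Mor G" "Cod G k = e" by auto
  show "\<eta> e (frag_of k) = \<theta> e (frag_of k)"
    using module_mapD(2)[OF \<eta> top_Mor_LCat[OF k(1)], of "frag_of t"]
      module_mapD(2)[OF \<theta> top_Mor_LCat[OF k(1)], of "frag_of t"]
      top_generator eq k
    by (simp add: LCat_simps Act_ZG_top)
qed (use x in \<open>simp add: ZG_def\<close>)

lemma ZG_top_ex_map:
  assumes N: "is_module (LCat G) N" and v: "v \<in> carrier (Grp N t)"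
  shows "\<exists>\<eta>. module_map (LCat G) (ZG G) N \<eta> \<and> \<eta> t (frag_of t) = v"
proof -
  interpret L: category "LCat G" by (rule category_LCat)
  define s where "s = (\<lambda>k. Act N (t, k) v)"
  define B where "B = (\<lambda>e. {k \<in> Mor G. Cod G k = e})"
  have s: "s k \<in> carrier (Grp N (Cod G k))" if "k \<in> Mor G" for k
    using is_moduleD(6)[OF N top_Mor_LCat[OF that]] v by (simp add: s_def LCat_simps)
  have "\<exists>h. h \<in> hom (free_Abelian_group (B e)) (Grp N e) \<and> (\<forall>k\<in>B e. h (frag_of k) = s k)"
    if "e \<in> Obj G" for e
  proof -
    have "s ` B e \<subseteq> carrier (Grp N e)" using s by (auto simp: B_def)
    moreover have "e \<in> Obj (LCat G)" using that by (simp add: LCat_simps)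
    ultimately show ?thesis
      using comm_group.free_Abelian_group_universal[OF is_moduleD(1)[OF N]] by metis
  qed
  then obtain \<eta> where \<eta>: "\<And>e. e \<in> Obj G \<Longrightarrow> \<eta> e \<in> hom (free_Abelian_group (B e)) (Grp N e)"
    and \<eta>s: "\<And>e k. \<lbrakk>e \<in> Obj G; k \<in> B e\<rbrakk> \<Longrightarrow> \<eta> e (frag_of k) = s k"
    by metis
  have "module_map (LCat G) (ZG G) N \<eta>"
    unfolding module_map_def
  proof (intro conjI ballI)
    fix e assume "e \<in> Obj (LCat G)"
    then show "\<eta> e \<in> hom (Grp (ZG G) e) (Grp N e)"
      using \<eta> by (simp add: LCat_simps ZG_def B_def)
  next
    fix c x assume c: "c \<in> Mor (LCat G)" and x: "x \<in> carrier (Grp (ZG G) (Dom (LCat G) c))"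
    obtain e g where eg: "c = (e, g)" by (cases c)
    have g: "e \<in> Obj G" "g \<in> Mor G" "Le G (Dom G g) e" using c by (simp_all add: eg LCat_simps)
    have A: "Act (ZG G) c \<in> hom (free_Abelian_group (B e)) (free_Abelian_group (B (Cod G g)))"
      using Act_ZG_hom[OF c] by (simp add: eg LCat_simps ZG_def B_def)
    have "(\<eta> (Cod G g) \<circ> Act (ZG G) c) x = (Act N c \<circ> \<eta> e) x"
    proof (rule hom_free_eq[where S = "B e"])
      show "group (Grp N (Cod G g))"
        using is_moduleD(2)[OF N] g by (simp add: LCat_simps Cod_in)
      show "\<eta> (Cod G g) \<circ> Act (ZG G) c \<in> hom (free_Abelian_group (B e)) (Grp N (Cod G g))"
        by (rule hom_compose[OF A \<eta>[OF Cod_in[OF g(2)]]])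
      show "Act N c \<circ> \<eta> e \<in> hom (free_Abelian_group (B e)) (Grp N (Cod G g))"
        using hom_compose[OF \<eta>[OF g(1)]] is_moduleD(3)[OF N c] by (simp add: eg LCat_simps)
    next
      fix k assume kB: "k \<in> B e"
      then have k: "k \<in> Mor G" "Cod G k = e" by (auto simp: B_def)
      have kg: "Cmp G (corestr G k (Dom G g)) g \<in> B (Cod G g)"
        using prod_in[OF k(1) g(2)] Cod_prod[OF k(1) g(2)] g(3) k(2) by (simp add: B_def)
      have "\<eta> (Cod G g) (Act (ZG G) c (frag_of k)) = Act N (t, Cmp G (corestr G k (Dom G g)) g) v"
        using \<eta>s[OF Cod_in[OF g(2)] kg] by (simp add: eg Act_ZG_of s_def)
      also have "(t, Cmp G (corestr G k (Dom G g)) g) = Cmp (LCat G) (t, k) c"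
        by (simp add: eg LCat_simps)
      also have "Act N \<dots> v = Act N c (Act N (t, k) v)"
        using is_moduleD(5)[OF N top_Mor_LCat[OF k(1)] c] k v by (simp add: eg LCat_simps)
      also have "\<dots> = Act N c (\<eta> e (frag_of k))"
        using \<eta>s[OF g(1) kB] by (simp add: s_def)
      finally show "(\<eta> (Cod G g) \<circ> Act (ZG G) c) (frag_of k) = (Act N c \<circ> \<eta> e) (frag_of k)" by simp
    qed (use x in \<open>simp add: eg LCat_simps ZG_def B_def\<close>)
    then show "\<eta> (Cod (LCat G) c) (Act (ZG G) c x) = Act N c (\<eta> (Dom (LCat G) c) x)"
      by (simp add: eg LCat_simps)
  qed
  moreover have "\<eta> t (frag_of t) = v"
    using \<eta>s[OF t, of t] t is_moduleD(4)[OF N, of t] v by (simp add: B_def Obj_Mor Cod_Obj s_def LCat_simps)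
  ultimately show ?thesis by blast
qed

lemma free_summand_ZG_top: "free_summand (LCat G) (ZG G)"
proof (rule free_summandI[OF category_LCat is_module_ZG])
  fix p assume p: "surjective_map (LCat G) (free_module (LCat G) (ZG G)) (ZG G) p"
  then have pm: "module_map (LCat G) (free_module (LCat G) (ZG G)) (ZG G) p"
    by (simp add: surjective_map_def)
  have F: "is_module (LCat G) (free_module (LCat G) (ZG G))" by (rule is_module_free[OF category_LCat])
  have "frag_of t \<in> p t ` carrier (Grp (free_module (LCat G) (ZG G)) t)"
    using p t top_generator by (simp add: surjective_map_def LCat_simps)
  then obtain v where v: "v \<in> carrier (Grp (free_module (LCat G) (ZG G)) t)" "p t v = frag_of t"
    by (metis imageE)
  obtain s where s: "module_map (LCat G) (ZG G) (free_module (LCat G) (ZG G)) s" "s t (frag_of t) = v"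
    using ZG_top_ex_map[OF F v(1)] by blast
  have "module_map (LCat G) (ZG G) (ZG G) (\<lambda>e x. x)" by (auto simp: module_map_def hom_def)
  then have "(p e \<circ> s e) x = x" if "e \<in> Obj G" "x \<in> carrier (Grp (ZG G) e)" for e x
    using ZG_top_map_eq[OF is_module_ZG module_map_comp[OF category_LCat s(1) pm]] that s(2) v(2) by simp
  with s(1) show "\<exists>s. module_map (LCat G) (ZG G) (free_module (LCat G) (ZG G)) s \<and>
      (\<forall>e\<in>Obj (LCat G). \<forall>x\<in>carrier (Grp (ZG G) e). p e (s e x) = x)"
    by (auto simp: LCat_simps)
qed

end

end

section \<open>Extension and restriction between modules over the two groupoids\<close>

text \<open>There are no morphisms from an object of \<open>G\<close> to the new identity. Therefore extension by zero,
  \<open>M \<mapsto> M\<^sup>0\<close>, is left adjoint to restriction to \<open>G\<close>. Restriction preserves surjections, so extension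
  by zero preserves projectives.\<close>

definition restrict_module ::
  "('a option, 'a option \<times> 'a option, 'u) cmodule \<Rightarrow> ('a, 'a \<times> 'a, 'u) cmodule" where
  "restrict_module M = \<lparr>Grp = (\<lambda>e. Grp M (Some e)), Act = (\<lambda>(e, g). Act M (Some e, Some g))\<rparr>"

text \<open>The transpose of \<open>\<eta>\<close> under the adjunction; \<open>v\<close> is the value at the new identity, where
  the only possible choice is the neutral element of the target (\<open>undefined\<close> if the target is some
  \<open>M\<^sup>0\<close>).\<close>

definition extend_map :: "'v \<Rightarrow> ('a \<Rightarrow> 'u \<Rightarrow> 'v) \<Rightarrow> 'a option \<Rightarrow> 'u \<Rightarrow> 'v" where
  "extend_map v \<eta> e x = (case e of None \<Rightarrow> v | Some e' \<Rightarrow> \<eta> e' x)"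

lemma extend_map_simps [simp]:
  "extend_map v \<eta> None x = v" "extend_map v \<eta> (Some e) x = \<eta> e x"
  by (simp_all add: extend_map_def)

lemma restrict_module_simps:
  "Grp (restrict_module M) e = Grp M (Some e)"
  "Act (restrict_module M) (e, g) = Act M (Some e, Some g)"
  by (simp_all add: restrict_module_def)

lemma ext0_simps:
  "Grp (ext0 G M) None = singleton_group undefined"
  "Grp (ext0 G M) (Some e) = Grp M e"
  "Act (ext0 G M) (None, g) = (\<lambda>_. \<one>\<^bsub>Grp (ext0 G M) (map_option (Cod G) g)\<^esub>)"
  "Act (ext0 G M) (Some e, Some h) = Act M (e, h)"
  by (simp_all add: ext0_def Let_def)

lemma singleton_group_simps: "carrier (singleton_group a) = {a}" "\<one>\<^bsub>singleton_group a\<^esub> = a"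
  by (simp_all add: singleton_group_def)

lemma restrict_ext0: "restrict_module (ext0 G M) = M"
  by (cases M) (simp add: restrict_module_def ext0_def Let_def)

context ordered_groupoid
begin

interpretation I: ordered_groupoid "adjI G" by (rule ordered_groupoid_adjI)

lemma LCat_adjI_simps:
  "Obj (LCat (adjI G)) = insert None (Some ` Obj G)"
  "Dom (LCat (adjI G)) (e', g') = e'"
  "Cod (LCat (adjI G)) (e', g') = map_option (Cod G) g'"
  by (simp_all add: I.LCat_simps adjI_simps)

lemma Mor_LCat_adjI_Some: "(Some e, Some g) \<in> Mor (LCat (adjI G)) \<longleftrightarrow> (e, g) \<in> Mor (LCat G)"
  by (auto simp: I.LCat_simps LCat_simps adjI_simps)

lemma Mor_LCat_adjI_cases:
  assumes "c \<in> Mor (LCat (adjI G))"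
  obtains g where "c = (None, g)" "g \<in> Mor (adjI G)"
  | e g where "c = (Some e, Some g)" "(e, g) \<in> Mor (LCat G)"
proof (cases c)
  case (Pair e g)
  with assms that show thesis
    by (cases e; cases g) (auto simp: Mor_LCat_adjI_Some, auto simp: I.LCat_simps adjI_simps)
qed

lemma Cmp_LCat_adjI_Some:
  assumes "(e, g) \<in> Mor (LCat G)" "(f, h) \<in> Mor (LCat G)" "Cod G g = f"
  shows "Cmp (LCat (adjI G)) (Some e, Some g) (Some f, Some h)
    = (Some e, Some (Cmp G (corestr G g (Dom G h)) h))"
proof -
  have *: "g \<in> Mor G" "Dom G h \<in> Obj G" "Le G (Dom G h) (Cod G g)"
    using assms by (auto simp: LCat_simps Dom_in)
  then have "corestr (adjI G) (Some g) (Some (Dom G h)) = Some (corestr G g (Dom G h))"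
    using I.corestr_eq[of "Some g" "Some (corestr G g (Dom G h))"]
    by (simp add: adjI_simps corestr_in corestr_Le Cod_corestr)
  then show ?thesis by (simp add: I.LCat_simps adjI_simps)
qed

lemma is_module_restrict:
  assumes M: "is_module (LCat (adjI G)) M"
  shows "is_module (LCat G) (restrict_module M)"
  unfolding is_module_def
proof (intro conjI ballI impI)
  fix e assume e: "e \<in> Obj (LCat G)"
  then have e': "Some e \<in> Obj (LCat (adjI G))" by (simp add: LCat_adjI_simps LCat_simps)
  show "comm_group (Grp (restrict_module M) e)"
    using is_moduleD(1)[OF M e'] by (simp add: restrict_module_simps)
  fix x assume "x \<in> carrier (Grp (restrict_module M) e)"
  then show "Act (restrict_module M) (Idt (LCat G) e) x = x"
    using is_moduleD(4)[OF M e'] e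
    by (simp add: restrict_module_simps LCat_simps I.LCat_simps adjI_simps)
next
  fix c assume c: "c \<in> Mor (LCat G)"
  obtain e g where eg: "c = (e, g)" by (cases c)
  have c': "(Some e, Some g) \<in> Mor (LCat (adjI G))" using c by (simp add: eg Mor_LCat_adjI_Some)
  show "Act (restrict_module M) c
    \<in> hom (Grp (restrict_module M) (Dom (LCat G) c)) (Grp (restrict_module M) (Cod (LCat G) c))"
    using is_moduleD(3)[OF M c'] by (simp add: eg restrict_module_simps LCat_simps LCat_adjI_simps)
  fix d x assume d: "d \<in> Mor (LCat G)" and cd: "Cod (LCat G) c = Dom (LCat G) d"
    and x: "x \<in> carrier (Grp (restrict_module M) (Dom (LCat G) c))"
  obtain f h where fh: "d = (f, h)" by (cases d)
  have d': "(Some f, Some h) \<in> Mor (LCat (adjI G))" using d by (simp add: fh Mor_LCat_adjI_Some)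
  show "Act (restrict_module M) (Cmp (LCat G) c d) x = Act (restrict_module M) d (Act (restrict_module M) c x)"
    using is_moduleD(5)[OF M c' d'] x cd Cmp_LCat_adjI_Some c d
    by (simp add: eg fh restrict_module_simps LCat_simps(3-6) LCat_adjI_simps)
qed

lemma module_map_restrict:
  assumes \<eta>: "module_map (LCat (adjI G)) M N \<eta>"
  shows "module_map (LCat G) (restrict_module M) (restrict_module N) (\<lambda>e. \<eta> (Some e))"
  unfolding module_map_def
proof (intro conjI ballI)
  fix e assume "e \<in> Obj (LCat G)"
  then show "\<eta> (Some e) \<in> hom (Grp (restrict_module M) e) (Grp (restrict_module N) e)"
    using module_mapD(1)[OF \<eta>, of "Some e"]
    by (simp add: restrict_module_simps LCat_simps LCat_adjI_simps)
next
  fix c x assume c: "c \<in> Mor (LCat G)" and x: "x \<in> carrier (Grp (restrict_module M) (Dom (LCat G) c))"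
  obtain e g where eg: "c = (e, g)" by (cases c)
  have c': "(Some e, Some g) \<in> Mor (LCat (adjI G))" using c by (simp add: eg Mor_LCat_adjI_Some)
  show "\<eta> (Some (Cod (LCat G) c)) (Act (restrict_module M) c x)
      = Act (restrict_module N) c (\<eta> (Some (Dom (LCat G) c)) x)"
    using module_mapD(2)[OF \<eta> c', of x] x
    by (simp add: eg restrict_module_simps LCat_simps LCat_adjI_simps)
qed

lemma module_map_extend:
  assumes M: "is_module (LCat G) M" and N: "is_module (LCat (adjI G)) N"
    and \<eta>: "module_map (LCat G) M (restrict_module N) \<eta>"
  shows "module_map (LCat (adjI G)) (ext0 G M) N (extend_map \<one>\<^bsub>Grp N None\<^esub> \<eta>)"
proof -
  interpret L: category "LCat (adjI G)" by (rule I.category_LCat)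
  have E: "is_module (LCat (adjI G)) (ext0 G M)" by (rule is_module_ext0[OF M])
  have N0: "group (Grp N None)" using is_moduleD(2)[OF N] by (simp add: LCat_adjI_simps)
  have hom: "extend_map \<one>\<^bsub>Grp N None\<^esub> \<eta> e \<in> hom (Grp (ext0 G M) e) (Grp N e)"
    if "e \<in> Obj (LCat (adjI G))" for e
  proof (cases e)
    case None
    with N0 show ?thesis by (simp add: hom_def group.is_monoid monoid.one_closed)
  next
    case (Some e')
    have "extend_map \<one>\<^bsub>Grp N None\<^esub> \<eta> (Some e') = \<eta> e'" by (simp add: fun_eq_iff)
    with Some that show ?thesis
      using module_mapD(1)[OF \<eta>, of e'] by (auto simp: ext0_simps restrict_module_simps LCat_simps LCat_adjI_simps)
  qed
  have one: "extend_map \<one>\<^bsub>Grp N None\<^esub> \<eta> e \<one>\<^bsub>Grp (ext0 G M) e\<^esub> = \<one>\<^bsub>Grp N e\<^esub>"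
    if "e \<in> Obj (LCat (adjI G))" for e
    by (rule hom_one[OF hom[OF that] is_moduleD(2)[OF E that] is_moduleD(2)[OF N that]])
  show ?thesis
    unfolding module_map_def
  proof (intro conjI ballI hom)
    fix c x assume c: "c \<in> Mor (LCat (adjI G))"
      and x: "x \<in> carrier (Grp (ext0 G M) (Dom (LCat (adjI G)) c))"
    from c show "extend_map \<one>\<^bsub>Grp N None\<^esub> \<eta> (Cod (LCat (adjI G)) c) (Act (ext0 G M) c x)
      = Act N c (extend_map \<one>\<^bsub>Grp N None\<^esub> \<eta> (Dom (LCat (adjI G)) c) x)"
    proof (cases rule: Mor_LCat_adjI_cases)
      case (1 g)
      have "Act N c \<one>\<^bsub>Grp N None\<^esub> = \<one>\<^bsub>Grp N (Cod (LCat (adjI G)) c)\<^esub>"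
        using group_hom.hom_one[OF Act_hom[OF I.category_LCat N c]] by (simp add: 1 LCat_adjI_simps)
      then show ?thesis
        using one[OF L.Cod_in[OF c]] by (simp add: 1 LCat_adjI_simps ext0_simps)
    next
      case (2 e g)
      then show ?thesis
        using module_mapD(2)[OF \<eta> 2(2)] x
        by (simp add: ext0_simps restrict_module_simps LCat_adjI_simps LCat_simps)
    qed
  qed
qed

text \<open>A section over \<open>G\<close> of the restricted surjection extends to a section of the surjection itself,
  by the adjunction.\<close>

lemma free_summand_ext0:
  assumes P: "free_summand (LCat G) P"
  shows "free_summand (LCat (adjI G)) (ext0 G P)"
proof (rule free_summandI[OF I.category_LCat])
  let ?F = "free_module (LCat (adjI G)) (ext0 G P)"
  have P': "is_module (LCat G) P" by (rule free_summand_is_module[OF P])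
  show "is_module (LCat (adjI G)) (ext0 G P)" by (rule is_module_ext0[OF P'])
  fix p assume p: "surjective_map (LCat (adjI G)) ?F (ext0 G P) p"
  then have pm: "module_map (LCat (adjI G)) ?F (ext0 G P) p" by (simp add: surjective_map_def)
  have F: "is_module (LCat (adjI G)) ?F" by (rule is_module_free[OF I.category_LCat])
  have id: "module_map (LCat G) P P (\<lambda>e x. x)" by (auto simp: module_map_def hom_def)
  have "\<exists>s. module_map (LCat G) P (restrict_module ?F) s \<and>
      (\<forall>e\<in>Obj (LCat G). \<forall>x\<in>carrier (Grp P e). p (Some e) (s e x) = x)"
    by (rule free_summand_lift[OF category_LCat P is_module_restrict[OF F] P'
          module_map_restrict[OF pm, unfolded restrict_ext0] id])
      (use p in \<open>simp add: surjective_map_def restrict_module_simps LCat_simps LCat_adjI_simps ext0_simps\<close>)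
  then obtain s where s: "module_map (LCat G) P (restrict_module ?F) s"
    and ps: "\<And>e x. \<lbrakk>e \<in> Obj (LCat G); x \<in> carrier (Grp P e)\<rbrakk> \<Longrightarrow> p (Some e) (s e x) = x"
    by blast
  define s' where "s' = extend_map \<one>\<^bsub>Grp ?F None\<^esub> s"
  have s': "module_map (LCat (adjI G)) (ext0 G P) ?F s'"
    unfolding s'_def by (rule module_map_extend[OF P' F s])
  have "p e (s' e x) = x" if e: "e \<in> Obj (LCat (adjI G))" and x: "x \<in> carrier (Grp (ext0 G P) e)" for e x
  proof (cases e)
    case None
    then show ?thesis
      using module_mapD(3)[OF pm e module_mapD(3)[OF s' e x]] x
      by (simp add: ext0_simps singleton_group_simps)
  next
    case (Some e')
    then show ?thesis
      using ps[of e' x] e x by (auto simp: s'_def ext0_simps LCat_adjI_simps LCat_simps)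
  qed
  with s' show "\<exists>s. module_map (LCat (adjI G)) (ext0 G P) ?F s \<and>
      (\<forall>e\<in>Obj (LCat (adjI G)). \<forall>x\<in>carrier (Grp (ext0 G P) e). p e (s e x) = x)" by blast
qed

end

section \<open>The resolution over the larger groupoid\<close>

text \<open>The map \<open>frag_extend (frag_of \<circ> Some)\<close> renames basis elements along the inclusion of \<open>G\<close> in
  \<open>G\<^sup>I\<close>, and \<open>frag_extend (frag_of \<circ> the)\<close> undoes it.\<close>

lemma keys_frag_map_Some:
  "Poly_Mapping.keys (frag_extend (frag_of \<circ> Some) y) \<subseteq> Some ` Poly_Mapping.keys y"
  using keys_frag_extend[of "frag_of \<circ> Some" y] by auto

lemma frag_map_the_Some: "frag_extend (frag_of \<circ> the) (frag_extend (frag_of \<circ> Some) y) = y"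
proof -
  have "frag_extend ((frag_of \<circ> the) \<circ> Some) y = frag_extend frag_of y"
    by (rule frag_extend_eq) simp
  then show ?thesis by (simp only: frag_extend_compose frag_expansion[symmetric])
qed

lemma frag_map_Some_the:
  assumes "Poly_Mapping.keys x \<subseteq> range Some"
  shows "frag_extend (frag_of \<circ> Some) (frag_extend (frag_of \<circ> the) x) = x"
proof -
  have "frag_extend ((frag_of \<circ> Some) \<circ> the) x = frag_extend frag_of x"
    by (rule frag_extend_eq) (use assms in auto)
  then show ?thesis by (simp only: frag_extend_compose frag_expansion[symmetric])
qed

lemma frag_map_Some_inject:
  "frag_extend (frag_of \<circ> Some) x = frag_extend (frag_of \<circ> Some) y \<longleftrightarrow> x = y"
  by (metis frag_map_the_Some)

lemma augmentation_frag_map_Some: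
  "augmentation e' (frag_extend (frag_of \<circ> Some) y) = augmentation e y"
proof -
  have "frag_extend (frag_of \<circ> Some) \<in> hom (free_Abelian_group UNIV) (free_Abelian_group UNIV)"
    by (rule frag_extend_hom) simp
  from hom_compose[OF this augmentation_hom]
  have "(augmentation e' \<circ> frag_extend (frag_of \<circ> Some)) y = augmentation e y"
    by (rule hom_free_eq[OF group_integer_group _ augmentation_hom]) (simp_all add: augmentation_of)
  then show ?thesis by simp
qed

text \<open>The terms of a resolution share one element type, so the elements of \<open>\<int>G\<^sup>I\<close> have to be
  represented in the type of the resolution of \<open>KG\<close>. A formal sum over \<open>G\<^sup>I\<close> is recovered from its
  coefficient at the new identity together with its part supported on \<open>G\<close>; the remaining slot is
  filled arbitrarily.\<close>

definition pack :: "('a option \<Rightarrow>\<^sub>0 int) \<Rightarrow> ('m, 'a \<Rightarrow>\<^sub>0 int) univ" where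
  "pack x = Comb [(Poly_Mapping.lookup x None, Elt (Poly_Mapping.map_key Some x), undefined)]"

lemma inj_pack: "inj pack"
proof (rule injI)
  fix x y :: "'a option \<Rightarrow>\<^sub>0 int"
  assume eq: "(pack x :: ('m, 'a \<Rightarrow>\<^sub>0 int) univ) = pack y"
  show "x = y"
  proof (rule poly_mapping_eqI)
    fix k
    have "Poly_Mapping.lookup x (Some a) = Poly_Mapping.lookup y (Some a)" for a
    proof -
      have "Poly_Mapping.map_key Some x = Poly_Mapping.map_key Some y" using eq by (simp add: pack_def)
      from arg_cong[OF this, of "\<lambda>p. Poly_Mapping.lookup p a"] show ?thesis
        by (simp add: map_key.rep_eq)
    qed
    then show "Poly_Mapping.lookup x k = Poly_Mapping.lookup y k"
      using eq by (cases k) (simp_all add: pack_def)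
  qed
qed

text \<open>Splicing a resolution \<open>R\<close> of \<open>KG\<close>, extended by zero, with the exact sequence
  \<open>0 \<rightarrow> (KG)\<^sup>0 \<rightarrow> \<int>G\<^sup>I \<rightarrow> \<Delta>\<int> \<rightarrow> 0\<close> gives a resolution of \<open>\<Delta>\<int>\<close> over \<open>G\<^sup>I\<close>, shifted by one degree.
  The injection \<open>i\<close> transports \<open>\<int>G\<^sup>I\<close> to the element type of \<open>R\<close>.\<close>

definition shifted_resolution ::
  "'a ordgpd \<Rightarrow> (('a option \<Rightarrow>\<^sub>0 int) \<Rightarrow> 'u) \<Rightarrow> ('a, 'a \<times> 'a, 'u, 'a \<Rightarrow>\<^sub>0 int) resolution \<Rightarrow>
     ('a option, 'a option \<times> 'a option, 'u, int) resolution" where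
  "shifted_resolution G i R = \<lparr>
     Term = case_nat (transport i (ZG (adjI G))) (\<lambda>n. ext0 G (Term R n)),
     Bdry = case_nat (extend_map (i 0) (\<lambda>e x. i (frag_extend (frag_of \<circ> Some) (Aug R e x))))
       (\<lambda>n. extend_map undefined (Bdry R n)),
     Aug = (\<lambda>e. augmentation e \<circ> inv_into UNIV i)\<rparr>"

lemma shifted_resolution_simps:
  "Term (shifted_resolution G i R) 0 = transport i (ZG (adjI G))"
  "Term (shifted_resolution G i R) (Suc n) = ext0 G (Term R n)"
  "Bdry (shifted_resolution G i R) 0
    = extend_map (i 0) (\<lambda>e x. i (frag_extend (frag_of \<circ> Some) (Aug R e x)))"
  "Bdry (shifted_resolution G i R) (Suc n) = extend_map undefined (Bdry R n)"
  "Aug (shifted_resolution G i R) = (\<lambda>e. augmentation e \<circ> inv_into UNIV i)"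
  by (simp_all add: shifted_resolution_def)

context ordered_groupoid
begin

interpretation I: ordered_groupoid "adjI G" by (rule ordered_groupoid_adjI)

lemma None_top: "None \<in> Obj (adjI G)" "e \<in> Obj (adjI G) \<Longrightarrow> Le (adjI G) e None"
  by (auto simp: adjI_simps)

lemma module_map_Some: "module_map (LCat G) (ZG G) (restrict_module (ZG (adjI G)))
   (\<lambda>e. frag_extend (frag_of \<circ> Some))"
  unfolding module_map_def
proof (intro conjI ballI)
  fix e assume "e \<in> Obj (LCat G)"
  show "frag_extend (frag_of \<circ> Some) \<in> hom (Grp (ZG G) e) (Grp (restrict_module (ZG (adjI G))) e)"
    unfolding restrict_module_simps
    by (simp add: ZG_def) (rule frag_extend_hom, auto simp: adjI_simps)
next
  fix c x assume c: "c \<in> Mor (LCat G)" and x: "x \<in> carrier (Grp (ZG G) (Dom (LCat G) c))"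
  obtain e g where eg: "c = (e, g)" by (cases c)
  have g: "e \<in> Obj G" "g \<in> Mor G" "Le G (Dom G g) e" using c by (simp_all add: eg LCat_simps)
  have c': "(Some e, Some g) \<in> Mor (LCat (adjI G))" using c by (simp add: eg Mor_LCat_adjI_Some)
  let ?B = "\<lambda>e. {k \<in> Mor G. Cod G k = e}" and ?B' = "\<lambda>e. {k \<in> Mor (adjI G). Cod (adjI G) k = e}"
  have s: "frag_extend (frag_of \<circ> Some) \<in> hom (free_Abelian_group (?B e)) (free_Abelian_group (?B' (Some e)))"
    for e by (rule frag_extend_hom) (auto simp: adjI_simps)
  have "(frag_extend (frag_of \<circ> Some) \<circ> Act (ZG G) c) x
    = (Act (ZG (adjI G)) (Some e, Some g) \<circ> frag_extend (frag_of \<circ> Some)) x"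
  proof (rule hom_free_eq[where S = "?B e"])
    show "frag_extend (frag_of \<circ> Some) \<circ> Act (ZG G) c
      \<in> hom (free_Abelian_group (?B e)) (free_Abelian_group (?B' (Some (Cod G g))))"
      using hom_compose[OF Act_ZG_hom[OF c]] s[of "Cod G g"] by (simp add: eg LCat_simps ZG_def)
    show "Act (ZG (adjI G)) (Some e, Some g) \<circ> frag_extend (frag_of \<circ> Some)
      \<in> hom (free_Abelian_group (?B e)) (free_Abelian_group (?B' (Some (Cod G g))))"
      using hom_compose[OF s] I.Act_ZG_hom[OF c'] by (simp add: ZG_def LCat_adjI_simps)
  next
    fix k assume "k \<in> ?B e"
    then have k: "k \<in> Mor G" "Cod G k = e" by auto
    have "(Dom G k, k) \<in> Mor (LCat G)" using k by (simp add: LCat_simps Dom_in Le_refl Obj_Mor)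
    from Cmp_LCat_adjI_Some[OF this c[unfolded eg] k(2)]
    have "Cmp (adjI G) (corestr (adjI G) (Some k) (Dom (adjI G) (Some g))) (Some g)
      = Some (Cmp G (corestr G k (Dom G g)) g)"
      by (simp add: I.LCat_simps)
    then show "(frag_extend (frag_of \<circ> Some) \<circ> Act (ZG G) c) (frag_of k)
      = (Act (ZG (adjI G)) (Some e, Some g) \<circ> frag_extend (frag_of \<circ> Some)) (frag_of k)"
      by (simp add: eg Act_ZG_of I.Act_ZG_of)
  qed (use x in \<open>simp_all add: eg ZG_def LCat_simps\<close>)
  then show "frag_extend (frag_of \<circ> Some) (Act (ZG G) c x)
    = Act (restrict_module (ZG (adjI G))) c (frag_extend (frag_of \<circ> Some) x)"
    by (simp add: eg restrict_module_simps)
qed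

text \<open>The only arrow of \<open>G\<^sup>I\<close> ending at the new identity is the new identity itself, so there
  \<open>\<int>G\<^sup>I\<close> is \<open>\<int>\<close> and the augmentation is injective. The arrows ending at an object of \<open>G\<close> are those
  of \<open>G\<close>. Together with lemma \<open>kernel_augmentation_Some\<close> this identifies the kernel of the augmentation
  over \<open>G\<^sup>I\<close> with \<open>(KG)\<^sup>0\<close>.\<close>

lemma kernel_augmentation_None:
  "kernel (Grp (ZG (adjI G)) None) integer_group (augmentation e) = {0}"
proof -
  have "x = 0" if k: "Poly_Mapping.keys x \<subseteq> {None}" and a: "augmentation e x = 0"
    for x :: "'a option \<Rightarrow>\<^sub>0 int"
  proof -
    have "Poly_Mapping.keys x = {} \<or> Poly_Mapping.keys x = {None}" using k by blast
    then show ?thesis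
    proof
      assume n: "Poly_Mapping.keys x = {None}"
      then have "Poly_Mapping.lookup x None \<noteq> 0" by (simp add: in_keys_iff[symmetric])
      with a show ?thesis by (simp add: augmentation_def n)
    qed simp
  qed
  moreover have "{k \<in> Mor (adjI G). Cod (adjI G) k = None} = {None}" by (auto simp: adjI_simps)
  moreover have "augmentation e (0 :: 'a option \<Rightarrow>\<^sub>0 int) = 0" by (simp add: augmentation_def)
  ultimately show ?thesis
    by (fastforce simp: kernel_def ZG_def)
qed

lemma kernel_augmentation_Some:
  "kernel (Grp (ZG (adjI G)) (Some e)) integer_group (augmentation e')
    = frag_extend (frag_of \<circ> Some) ` carrier (Grp (KG G) e)"
proof (intro equalityI subsetI)
  fix x assume "x \<in> kernel (Grp (ZG (adjI G)) (Some e)) integer_group (augmentation e')"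
  then have x: "Poly_Mapping.keys x \<subseteq> Some ` {k \<in> Mor G. Cod G k = e}" and a: "augmentation e' x = 0"
    by (auto simp: kernel_def ZG_def adjI_simps)
  define y where "y = frag_extend (frag_of \<circ> the) x"
  have xy: "x = frag_extend (frag_of \<circ> Some) y"
    unfolding y_def using x by (intro frag_map_Some_the[symmetric]) blast
  have "Poly_Mapping.keys y \<subseteq> the ` Poly_Mapping.keys x"
    using keys_frag_extend[of "frag_of \<circ> the" x] by (auto simp: y_def)
  then have "Poly_Mapping.keys y \<subseteq> {k \<in> Mor G. Cod G k = e}" using x by fastforce
  moreover have "augmentation e y = 0"
    using a augmentation_frag_map_Some[of e' y e] by (simp add: xy)
  ultimately have "y \<in> carrier (Grp (KG G) e)"
    by (simp add: KG_def kernel_module_def kernel_def ZG_def constZ_def)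
  then show "x \<in> frag_extend (frag_of \<circ> Some) ` carrier (Grp (KG G) e)" unfolding xy by (rule imageI)
next
  fix x assume "x \<in> frag_extend (frag_of \<circ> Some) ` carrier (Grp (KG G) e)"
  then obtain y where xy: "x = frag_extend (frag_of \<circ> Some) y" and "y \<in> carrier (Grp (KG G) e)"
    by (rule imageE)
  then have y: "Poly_Mapping.keys y \<subseteq> {k \<in> Mor G. Cod G k = e}" and a: "augmentation e y = 0"
    by (simp_all add: KG_def kernel_module_def kernel_def ZG_def constZ_def)
  have "Poly_Mapping.keys x \<subseteq> {k \<in> Mor (adjI G). Cod (adjI G) k = Some e}"
    using keys_frag_map_Some[of y] y by (auto simp: xy adjI_simps)
  then show "x \<in> kernel (Grp (ZG (adjI G)) (Some e)) integer_group (augmentation e')"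
    using a augmentation_frag_map_Some[of e' y e] by (simp add: xy kernel_def ZG_def)
qed

lemma is_module_transport_ZG:
  "inj i \<Longrightarrow> is_module (LCat (adjI G)) (transport i (ZG (adjI G)))"
  by (rule is_module_transport[OF I.category_LCat _ I.is_module_ZG])

lemma free_summand_shifted:
  assumes i: "inj i" and R: "summand_resolution (LCat G) M R"
  shows "free_summand (LCat (adjI G)) (Term (shifted_resolution G i R) n)"
proof (cases n)
  case 0
  then show ?thesis
    using free_summand_transport[OF I.category_LCat i I.free_summand_ZG_top[OF None_top]]
    by (simp add: shifted_resolution_simps)
next
  case (Suc m)
  have "free_summand (LCat G) (Term R m)" using R by (simp add: summand_resolution_def)
  from free_summand_ext0[OF this] Suc show ?thesis by (simp add: shifted_resolution_simps)
qed

lemma module_map_shifted_Bdry: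
  assumes i: "inj i" and R: "projective_resolution (LCat G) (KG G) R"
  defines "S \<equiv> shifted_resolution G i R"
  shows "module_map (LCat (adjI G)) (Term S (Suc n)) (Term S n) (Bdry S n)"
proof -
  note Rd = projective_resolutionD[OF R]
  note T = is_module_transport_ZG[OF i]
  show ?thesis
  proof (cases n)
    case 0
    have "module_map (LCat G) (Term R 0) (ZG G) (Aug R)"
      using module_map_comp[OF category_LCat Rd(3)] kernel_inclusion[OF category_LCat, of "ZG G" constZ augmentation]
      by (simp add: KG_def comp_def)
    from module_map_comp[OF category_LCat module_map_comp[OF category_LCat this module_map_Some]
        module_map_restrict[OF transport_to[OF I.category_LCat i I.is_module_ZG]]]
    have "module_map (LCat G) (Term R 0) (restrict_module (transport i (ZG (adjI G))))
        (\<lambda>e x. i (frag_extend (frag_of \<circ> Some) (Aug R e x)))"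
      by (simp add: comp_def)
    from module_map_extend[OF Rd(1) T this]
    show ?thesis
      by (simp add: S_def 0 shifted_resolution_simps transport_def transport_group_def ZG_def)
  next
    case (Suc m)
    show ?thesis
      using module_map_extend[OF Rd(1) is_module_ext0[OF Rd(1)], of "Suc m" m "Bdry R m"] Rd(2)
      by (simp add: S_def Suc shifted_resolution_simps restrict_ext0 ext0_simps singleton_group_simps)
  qed
qed

lemma surjective_shifted_Aug:
  assumes i: "inj i"
  shows "surjective_map (LCat (adjI G)) (transport i (ZG (adjI G))) constZ
    (\<lambda>e. augmentation e \<circ> inv_into UNIV i)"
proof -
  have "n \<in> (augmentation e \<circ> inv_into UNIV i) ` carrier (Grp (transport i (ZG (adjI G))) e)"
    if e: "e \<in> Obj (LCat (adjI G))" for e n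
  proof (rule image_eqI)
    have "Poly_Mapping.keys (frag_cmul n (frag_of e)) = (if n = 0 then {} else {e})" by auto
    then have "augmentation e (frag_cmul n (frag_of e)) = n"
      by (simp add: augmentation_def)
    then show "n = (augmentation e \<circ> inv_into UNIV i) (i (frag_cmul n (frag_of e)))"
      using i by simp
    have "e \<in> Obj (adjI G)" using e by (simp add: I.LCat_simps)
    then have "frag_cmul n (frag_of e) \<in> carrier (Grp (ZG (adjI G)) e)"
      by (auto simp: ZG_def I.Obj_Mor I.Cod_Obj)
    then show "i (frag_cmul n (frag_of e)) \<in> carrier (Grp (transport i (ZG (adjI G))) e)"
      by (simp add: transport_def)
  qed
  moreover have "module_map (LCat (adjI G)) (transport i (ZG (adjI G))) constZ
      (\<lambda>e. augmentation e \<circ> inv_into UNIV i)"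
    by (rule module_map_comp[OF I.category_LCat transport_from[OF I.category_LCat i I.is_module_ZG]
          I.augmentation_map])
  ultimately show ?thesis
    by (auto simp: surjective_map_def constZ_def)
qed

lemma exact_shifted_0:
  assumes i: "inj i" and R: "projective_resolution (LCat G) (KG G) R"
    and e: "e \<in> Obj (LCat (adjI G))"
  defines "S \<equiv> shifted_resolution G i R"
  shows "Bdry S 0 e ` carrier (Grp (Term S 1) e) = kernel (Grp (Term S 0) e) (Grp constZ e) (Aug S e)"
proof -
  have K: "kernel (Grp (Term S 0) e) (Grp constZ e) (Aug S e)
    = i ` kernel (Grp (ZG (adjI G)) e) integer_group (augmentation e)"
    using i by (auto simp: S_def shifted_resolution_simps transport_def kernel_def constZ_def)
  show ?thesis
  proof (cases e)
    case None
    then show ?thesis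
      unfolding K by (simp add: S_def kernel_augmentation_None shifted_resolution_simps ext0_simps
          singleton_group_simps)
  next
    case (Some e')
    then have "e' \<in> Obj (LCat G)" using e by (auto simp: LCat_adjI_simps LCat_simps)
    then have "carrier (Grp (KG G) e') = Aug R e' ` carrier (Grp (Term R 0) e')"
      using projective_resolutionD(4)[OF R] by simp
    then show ?thesis
      unfolding K by (simp add: S_def Some kernel_augmentation_Some shifted_resolution_simps ext0_simps
          image_image)
  qed
qed

lemma exact_shifted_Suc:
  assumes i: "inj i" and R: "projective_resolution (LCat G) (KG G) R"
    and e: "e \<in> Obj (LCat (adjI G))"
  defines "S \<equiv> shifted_resolution G i R"
  shows "Bdry S (Suc n) e ` carrier (Grp (Term S (Suc (Suc n))) e)
    = kernel (Grp (Term S (Suc n)) e) (Grp (Term S n) e) (Bdry S n e)"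
proof (cases e)
  case None
  have "Bdry S n None undefined = \<one>\<^bsub>Grp (Term S n) None\<^esub>"
    by (cases n) (simp_all add: S_def shifted_resolution_simps ext0_simps singleton_group_simps
        transport_def transport_group_def ZG_def)
  then show ?thesis
    by (auto simp: None S_def shifted_resolution_simps(2,4) ext0_simps singleton_group_simps kernel_def)
next
  case (Some e')
  then have e': "e' \<in> Obj (LCat G)" using e by (auto simp: LCat_adjI_simps LCat_simps)
  have e'S: "Bdry S (Suc n) e ` carrier (Grp (Term S (Suc (Suc n))) e)
    = Bdry R n e' ` carrier (Grp (Term R (Suc n)) e')"
    by (simp add: S_def Some shifted_resolution_simps ext0_simps)
  show ?thesis
  proof (cases n)
    case 0
    have "i (frag_extend (frag_of \<circ> Some) y) = i 0 \<longleftrightarrow> y = 0" for y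
      using frag_map_Some_inject[of y 0] i by (simp add: inj_eq)
    then have "kernel (Grp (Term S 1) e) (Grp (Term S 0) e) (Bdry S 0 e)
      = kernel (Grp (Term R 0) e') (Grp (KG G) e') (Aug R e')"
      by (simp add: kernel_def S_def Some shifted_resolution_simps ext0_simps transport_def
          transport_group_def ZG_def KG_def kernel_module_def)
    then show ?thesis
      unfolding e'S using projective_resolutionD(5)[OF R e'] by (simp add: 0)
  next
    case (Suc m)
    have "kernel (Grp (Term S (Suc n)) e) (Grp (Term S n) e) (Bdry S n e)
      = kernel (Grp (Term R (Suc m)) e') (Grp (Term R m) e') (Bdry R m e')"
      by (simp add: kernel_def S_def Some Suc shifted_resolution_simps ext0_simps)
    then show ?thesis
      unfolding e'S using projective_resolutionD(6)[OF R e'] by (simp add: Suc)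
  qed
qed

lemma summand_resolution_shifted:
  assumes i: "inj i" and R: "summand_resolution (LCat G) (KG G) R"
  shows "summand_resolution (LCat (adjI G)) constZ (shifted_resolution G i R)"
proof -
  have Rp: "projective_resolution (LCat G) (KG G) R" using R by (simp add: summand_resolution_def)
  note fs = free_summand_shifted[OF i R]
  have "projective_resolution (LCat (adjI G)) constZ (shifted_resolution G i R)"
    unfolding projective_resolution_def
  proof (intro conjI allI ballI)
    show "surjective_map (LCat (adjI G)) (Term (shifted_resolution G i R) 0) constZ
        (Aug (shifted_resolution G i R))"
      using surjective_shifted_Aug[OF i] by (simp add: shifted_resolution_simps)
  qed (use free_summand_imp_projective[OF I.category_LCat fs] module_map_shifted_Bdry[OF i Rp]
      exact_shifted_0[OF i Rp] exact_shifted_Suc[OF i Rp] in blast)+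
  with fs show ?thesis by (simp add: summand_resolution_def)
qed

end

section \<open>Cochains of the two resolutions\<close>

definition restrict_hom ::
  "'a ordgpd \<Rightarrow> ('a, 'a \<times> 'a, 'u) cmodule \<Rightarrow> ('a option \<Rightarrow> 'u \<Rightarrow> 'w) \<Rightarrow> 'a \<Rightarrow> 'u \<Rightarrow> 'w" where
  "restrict_hom G P \<eta> = (\<lambda>e\<in>Obj (LCat G). \<lambda>x\<in>carrier (Grp P e). \<eta> (Some e) x)"

definition extend_hom ::
  "'a ordgpd \<Rightarrow> ('a, 'a \<times> 'a, 'u) cmodule \<Rightarrow> ('a \<Rightarrow> 'u \<Rightarrow> 'w) \<Rightarrow> 'a option \<Rightarrow> 'u \<Rightarrow> 'w" where
  "extend_hom G P \<eta> =
     (\<lambda>e\<in>Obj (LCat (adjI G)). \<lambda>x\<in>carrier (Grp (ext0 G P) e). extend_map undefined \<eta> e x)"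

context ordered_groupoid
begin

interpretation I: ordered_groupoid "adjI G" by (rule ordered_groupoid_adjI)

lemma Obj_LCat_adjI_Some: "Some e \<in> Obj (LCat (adjI G)) \<longleftrightarrow> e \<in> Obj (LCat G)"
  and Obj_LCat_adjI_None: "None \<in> Obj (LCat (adjI G))"
  by (auto simp: LCat_adjI_simps LCat_simps)

lemma restrict_hom_apply:
  "\<lbrakk>e \<in> Obj (LCat G); x \<in> carrier (Grp P e)\<rbrakk> \<Longrightarrow> restrict_hom G P \<eta> e x = \<eta> (Some e) x"
  by (simp add: restrict_hom_def)

lemma extend_hom_apply:
  "\<lbrakk>e \<in> Obj (LCat G); x \<in> carrier (Grp P e)\<rbrakk> \<Longrightarrow> extend_hom G P \<eta> (Some e) x = \<eta> e x"
  by (simp add: extend_hom_def Obj_LCat_adjI_Some ext0_simps)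

text \<open>A natural transformation into \<open>A\<^sup>0\<close> is determined by its components at the objects of \<open>G\<close>, as
  \<open>A\<^sup>0\<close> is trivial at the new identity.\<close>

lemma Hom_ext0_eqI:
  assumes \<eta>: "\<eta> \<in> carrier (Hom_group (LCat (adjI G)) M (ext0 G A))"
    and \<theta>: "\<theta> \<in> carrier (Hom_group (LCat (adjI G)) M (ext0 G A))"
    and eq: "\<And>e x. \<lbrakk>e \<in> Obj (LCat G); x \<in> carrier (Grp M (Some e))\<rbrakk> \<Longrightarrow> \<eta> (Some e) x = \<theta> (Some e) x"
  shows "\<eta> = \<theta>"
proof (rule Hom_group_eqI[OF \<eta> \<theta>])
  fix e x assume e: "e \<in> Obj (LCat (adjI G))" and x: "x \<in> carrier (Grp M e)"
  show "\<eta> e x = \<theta> e x"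
  proof (cases e)
    case None
    then show ?thesis
      using module_mapD(3)[OF carrier_Hom_groupD(1)[OF \<eta>] e x]
        module_mapD(3)[OF carrier_Hom_groupD(1)[OF \<theta>] e x]
      by (simp add: ext0_simps singleton_group_simps)
  next
    case (Some e')
    with e x eq[of e' x] show ?thesis by (simp add: Obj_LCat_adjI_Some)
  qed
qed

context
  fixes P :: "('a, 'a \<times> 'a, 'u) cmodule" and A :: "('a, 'a \<times> 'a, 'w) cmodule"
  assumes P: "is_module (LCat G) P" and A: "is_module (LCat G) A"
begin

lemma restrict_hom_in:
  assumes "\<eta> \<in> carrier (Hom_group (LCat (adjI G)) (ext0 G P) (ext0 G A))"
  shows "restrict_hom G P \<eta> \<in> carrier (Hom_group (LCat G) P A)"
  using restrict_in_Hom_group[OF category_LCat P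
      module_map_restrict[OF carrier_Hom_groupD(1)[OF assms], unfolded restrict_ext0]]
  by (simp add: restrict_hom_def)

lemma extend_hom_in:
  assumes "\<eta> \<in> carrier (Hom_group (LCat G) P A)"
  shows "extend_hom G P \<eta> \<in> carrier (Hom_group (LCat (adjI G)) (ext0 G P) (ext0 G A))"
proof -
  have "module_map (LCat G) P (restrict_module (ext0 G A)) \<eta>"
    using carrier_Hom_groupD(1)[OF assms] by (simp add: restrict_ext0)
  from restrict_in_Hom_group[OF I.category_LCat is_module_ext0[OF P]
      module_map_extend[OF P is_module_ext0[OF A] this]]
  show ?thesis by (simp add: extend_hom_def ext0_simps singleton_group_simps)
qed

lemma extend_restrict_hom:
  assumes \<eta>: "\<eta> \<in> carrier (Hom_group (LCat (adjI G)) (ext0 G P) (ext0 G A))"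
  shows "extend_hom G P (restrict_hom G P \<eta>) = \<eta>"
  by (rule Hom_ext0_eqI[OF extend_hom_in[OF restrict_hom_in[OF \<eta>]] \<eta>])
    (simp add: extend_hom_apply restrict_hom_apply ext0_simps)

lemma restrict_extend_hom:
  assumes \<eta>: "\<eta> \<in> carrier (Hom_group (LCat G) P A)"
  shows "restrict_hom G P (extend_hom G P \<eta>) = \<eta>"
  by (rule Hom_group_eqI[OF restrict_hom_in[OF extend_hom_in[OF \<eta>]] \<eta>])
    (simp add: extend_hom_apply restrict_hom_apply)

lemma restrict_hom_hom:
  "restrict_hom G P \<in> hom (Hom_group (LCat (adjI G)) (ext0 G P) (ext0 G A)) (Hom_group (LCat G) P A)"
proof (rule homI[OF restrict_hom_in])
  let ?H' = "Hom_group (LCat (adjI G)) (ext0 G P) (ext0 G A)" and ?H = "Hom_group (LCat G) P A"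
  interpret H': comm_group ?H'
    by (rule comm_group_Hom_group[OF I.category_LCat is_module_ext0[OF P] is_module_ext0[OF A]])
  interpret H: comm_group ?H by (rule comm_group_Hom_group[OF category_LCat P A])
  fix \<eta> \<theta> assume "\<eta> \<in> carrier ?H'" "\<theta> \<in> carrier ?H'"
  then show "restrict_hom G P (\<eta> \<otimes>\<^bsub>?H'\<^esub> \<theta>) = restrict_hom G P \<eta> \<otimes>\<^bsub>?H\<^esub> restrict_hom G P \<theta>"
    by (intro Hom_group_eqI[OF restrict_hom_in H.m_closed])
      (simp_all add: restrict_hom_in restrict_hom_apply Hom_group_mult Obj_LCat_adjI_Some ext0_simps)
qed

lemma extend_hom_hom:
  "extend_hom G P \<in> hom (Hom_group (LCat G) P A) (Hom_group (LCat (adjI G)) (ext0 G P) (ext0 G A))"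
proof (rule homI[OF extend_hom_in])
  let ?H' = "Hom_group (LCat (adjI G)) (ext0 G P) (ext0 G A)" and ?H = "Hom_group (LCat G) P A"
  interpret H': comm_group ?H'
    by (rule comm_group_Hom_group[OF I.category_LCat is_module_ext0[OF P] is_module_ext0[OF A]])
  interpret H: comm_group ?H by (rule comm_group_Hom_group[OF category_LCat P A])
  fix \<eta> \<theta> assume "\<eta> \<in> carrier ?H" "\<theta> \<in> carrier ?H"
  then show "extend_hom G P (\<eta> \<otimes>\<^bsub>?H\<^esub> \<theta>) = extend_hom G P \<eta> \<otimes>\<^bsub>?H'\<^esub> extend_hom G P \<theta>"
    by (intro Hom_ext0_eqI[OF extend_hom_in H'.m_closed])
      (simp_all add: extend_hom_in extend_hom_apply Hom_group_mult Obj_LCat_adjI_Some ext0_simps)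
qed

end

text \<open>A map from \<open>\<int>G\<^sup>I\<close> to \<open>A\<^sup>0\<close> is determined by the image of the generator at the new identity, which
  lies in the trivial group there.\<close>

lemma ZG_top_to_ext0_trivial:
  assumes i: "inj i" and A: "is_module (LCat G) A"
    and \<eta>: "\<eta> \<in> carrier (Hom_group (LCat (adjI G)) (transport i (ZG (adjI G))) (ext0 G A))"
  shows "\<eta> = \<one>\<^bsub>Hom_group (LCat (adjI G)) (transport i (ZG (adjI G))) (ext0 G A)\<^esub>"
proof -
  let ?P = "transport i (ZG (adjI G))"
  have A0: "is_module (LCat (adjI G)) (ext0 G A)" by (rule is_module_ext0[OF A])
  interpret H: comm_group "Hom_group (LCat (adjI G)) ?P (ext0 G A)"
    by (rule comm_group_Hom_group[OF I.category_LCat is_module_transport_ZG[OF i] A0])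
  let ?\<eta>i = "\<lambda>e. \<eta> e \<circ> i" and ?one = "\<lambda>e x. \<one>\<^bsub>Grp (ext0 G A) e\<^esub>"
  have m: "module_map (LCat (adjI G)) (ZG (adjI G)) (ext0 G A) ?\<eta>i"
    by (rule module_map_comp[OF I.category_LCat transport_to[OF I.category_LCat i I.is_module_ZG]
          carrier_Hom_groupD(1)[OF \<eta>]])
  have one: "module_map (LCat (adjI G)) (ZG (adjI G)) (ext0 G A) ?one"
    by (rule module_map_const_one[OF I.category_LCat A0])
  have eq: "?\<eta>i None (frag_of None) = ?one None (frag_of None)"
    using module_mapD(3)[OF m Obj_LCat_adjI_None I.top_generator[OF None_top]]
    by (simp add: ext0_simps singleton_group_simps)
  have "?\<eta>i e x = ?one e x" if "e \<in> Obj (adjI G)" "x \<in> carrier (Grp (ZG (adjI G)) e)" for e x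
    using I.ZG_top_map_eq[OF None_top A0 m one eq that] by simp
  then show ?thesis
    by (intro Hom_group_eqI[OF \<eta> H.one_closed])
      (auto simp: Hom_group_one transport_def I.LCat_simps(1))
qed

context
  fixes i :: "('a option \<Rightarrow>\<^sub>0 int) \<Rightarrow> 'u" and R :: "('a, 'a \<times> 'a, 'u, 'a \<Rightarrow>\<^sub>0 int) resolution"
    and S and A :: "('a, 'a \<times> 'a, 'w) cmodule"
  assumes i: "inj i" and R: "summand_resolution (LCat G) (KG G) R" and A: "is_module (LCat G) A"
  defines "S \<equiv> shifted_resolution G i R"
begin

lemma R_resolution: "projective_resolution (LCat G) (KG G) R"
  using R by (simp add: summand_resolution_def)

lemma S_resolution: "projective_resolution (LCat (adjI G)) constZ S"
  using summand_resolution_shifted[OF i R] by (simp add: summand_resolution_def S_def)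

lemma Term_S: "Term S (Suc n) = ext0 G (Term R n)" and Bdry_S: "Bdry S (Suc n) = extend_map undefined (Bdry R n)"
  and Term_S_0: "Term S 0 = transport i (ZG (adjI G))"
  by (simp_all add: S_def shifted_resolution_simps)

lemma restrict_hom_cocycle:
  assumes \<eta>: "\<eta> \<in> cocycles (LCat (adjI G)) S (ext0 G A) (Suc n)"
  shows "restrict_hom G (Term R n) \<eta> \<in> cocycles (LCat G) R A n"
proof -
  have \<eta>H: "\<eta> \<in> carrier (Hom_group (LCat (adjI G)) (ext0 G (Term R n)) (ext0 G A))"
    and \<eta>d: "\<And>e x. \<lbrakk>e \<in> Obj (LCat (adjI G)); x \<in> carrier (Grp (Term S (Suc (Suc n))) e)\<rbrakk>
      \<Longrightarrow> \<eta> e (Bdry S (Suc n) e x) = \<one>\<^bsub>Grp (ext0 G A) e\<^esub>"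
    using \<eta> by (simp_all add: cocycles_iff[OF I.category_LCat S_resolution is_module_ext0[OF A]] Term_S)
  have "restrict_hom G (Term R n) \<eta> e (Bdry R n e x) = \<one>\<^bsub>Grp A e\<^esub>"
    if e: "e \<in> Obj (LCat G)" and x: "x \<in> carrier (Grp (Term R (Suc n)) e)" for e x
    using \<eta>d[of "Some e" x] e x module_mapD(3)[OF projective_resolutionD(2)[OF R_resolution] e x]
    by (simp add: Obj_LCat_adjI_Some Term_S Bdry_S ext0_simps restrict_hom_apply)
  then show ?thesis
    using restrict_hom_in[OF projective_resolutionD(1)[OF R_resolution] A \<eta>H]
    by (simp add: cocycles_iff[OF category_LCat R_resolution A])
qed

lemma extend_hom_cocycle:
  assumes \<eta>: "\<eta> \<in> cocycles (LCat G) R A n"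
  shows "extend_hom G (Term R n) \<eta> \<in> cocycles (LCat (adjI G)) S (ext0 G A) (Suc n)"
proof -
  have H: "extend_hom G (Term R n) \<eta> \<in> carrier (Hom_group (LCat (adjI G)) (ext0 G (Term R n)) (ext0 G A))"
    using extend_hom_in[OF projective_resolutionD(1)[OF R_resolution] A] \<eta>
    by (simp add: cocycles_iff[OF category_LCat R_resolution A])
  have "extend_hom G (Term R n) \<eta> e (Bdry S (Suc n) e x) = \<one>\<^bsub>Grp (ext0 G A) e\<^esub>"
    if e: "e \<in> Obj (LCat (adjI G))" and x: "x \<in> carrier (Grp (Term S (Suc (Suc n))) e)" for e x
  proof (cases e)
    case None
    then show ?thesis
      using module_mapD(3)[OF carrier_Hom_groupD(1)[OF H] Obj_LCat_adjI_None]
      by (simp add: Bdry_S ext0_simps singleton_group_simps)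
  next
    case (Some e')
    then have e': "e' \<in> Obj (LCat G)" and x': "x \<in> carrier (Grp (Term R (Suc n)) e')"
      using e x by (simp_all add: Obj_LCat_adjI_Some Term_S ext0_simps)
    then show ?thesis
      using \<eta> module_mapD(3)[OF projective_resolutionD(2)[OF R_resolution] e' x']
      by (simp add: Some Bdry_S ext0_simps extend_hom_apply cocycles_iff[OF category_LCat R_resolution A])
  qed
  with H show ?thesis
    by (simp add: cocycles_iff[OF I.category_LCat S_resolution is_module_ext0[OF A]] Term_S)
qed

lemma restrict_hom_coboundary:
  assumes \<theta>: "\<theta> \<in> carrier (Hom_group (LCat (adjI G)) (Term S (Suc n)) (ext0 G A))"
  shows "restrict_hom G (Term R (Suc n)) (coboundary (LCat (adjI G)) S (Suc n) \<theta>)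
    = coboundary (LCat G) R n (restrict_hom G (Term R n) \<theta>)"
proof (rule Hom_group_eqI)
  note Rd = projective_resolutionD[OF R_resolution] and A0 = is_module_ext0[OF A]
  show "restrict_hom G (Term R (Suc n)) (coboundary (LCat (adjI G)) S (Suc n) \<theta>)
      \<in> carrier (Hom_group (LCat G) (Term R (Suc n)) A)"
    by (rule restrict_hom_in[OF Rd(1) A])
      (use group_hom.hom_closed[OF coboundary_group_hom[OF I.category_LCat S_resolution A0] \<theta>]
        in \<open>simp add: Term_S\<close>)
  show "coboundary (LCat G) R n (restrict_hom G (Term R n) \<theta>)
      \<in> carrier (Hom_group (LCat G) (Term R (Suc n)) A)"
    by (rule group_hom.hom_closed[OF coboundary_group_hom[OF category_LCat R_resolution A]
          restrict_hom_in[OF Rd(1) A \<theta>[unfolded Term_S]]])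
  fix e x assume e: "e \<in> Obj (LCat G)" and x: "x \<in> carrier (Grp (Term R (Suc n)) e)"
  then show "restrict_hom G (Term R (Suc n)) (coboundary (LCat (adjI G)) S (Suc n) \<theta>) e x
      = coboundary (LCat G) R n (restrict_hom G (Term R n) \<theta>) e x"
    using module_mapD(3)[OF Rd(2) e x]
    by (simp add: restrict_hom_apply coboundary_eq Obj_LCat_adjI_Some Term_S Bdry_S ext0_simps)
qed

text \<open>The cochain group of \<open>S\<close> in degree zero is trivial, so the coboundaries of \<open>S\<close> in degree one
  match those of \<open>R\<close> in degree zero, and the shift by one degree holds for \<open>n = 1\<close> as well.\<close>

lemma coboundaries_S_0: "coboundaries (LCat (adjI G)) S (ext0 G A) (Suc 0)
    = {\<one>\<^bsub>Hom_group (LCat (adjI G)) (Term S (Suc 0)) (ext0 G A)\<^esub>}"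
proof -
  let ?H = "\<lambda>n. Hom_group (LCat (adjI G)) (Term S n) (ext0 G A)"
  interpret group_hom "?H 0" "?H (Suc 0)" "coboundary (LCat (adjI G)) S 0"
    by (rule coboundary_group_hom[OF I.category_LCat S_resolution is_module_ext0[OF A]])
  have "\<eta> = \<one>\<^bsub>?H 0\<^esub>" if "\<eta> \<in> carrier (?H 0)" for \<eta>
    unfolding Term_S_0 by (rule ZG_top_to_ext0_trivial[OF i A that[unfolded Term_S_0]])
  then have "carrier (?H 0) = {\<one>\<^bsub>?H 0\<^esub>}" using G.one_closed by blast
  then show ?thesis by simp
qed

lemma restrict_hom_coboundaries:
  "restrict_hom G (Term R n) ` coboundaries (LCat (adjI G)) S (ext0 G A) (Suc n)
    = coboundaries (LCat G) R A n"
proof (cases n)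
  case 0
  note Rm = projective_resolutionD(1)[OF R_resolution]
  have "group_hom (Hom_group (LCat (adjI G)) (ext0 G (Term R 0)) (ext0 G A)) (Hom_group (LCat G) (Term R 0) A)
      (restrict_hom G (Term R 0))"
    using restrict_hom_hom[OF Rm A] comm_group_Hom_group[OF category_LCat Rm A]
      comm_group_Hom_group[OF I.category_LCat is_module_ext0[OF Rm] is_module_ext0[OF A]]
    by (simp add: group_hom_def group_hom_axioms_def comm_group.axioms(2))
  from group_hom.hom_one[OF this] show ?thesis by (simp only: 0 coboundaries_S_0 Term_S) simp
next
  case (Suc m)
  note Rm = projective_resolutionD(1)[OF R_resolution]
  let ?X = "carrier (Hom_group (LCat (adjI G)) (Term S (Suc m)) (ext0 G A))"
  have X: "carrier (Hom_group (LCat G) (Term R m) A)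
    = restrict_hom G (Term R m) ` carrier (Hom_group (LCat (adjI G)) (Term S (Suc m)) (ext0 G A))"
  proof (intro equalityI subsetI)
    fix \<theta> assume \<theta>: "\<theta> \<in> carrier (Hom_group (LCat G) (Term R m) A)"
    show "\<theta> \<in> restrict_hom G (Term R m) ` carrier (Hom_group (LCat (adjI G)) (Term S (Suc m)) (ext0 G A))"
      by (rule image_eqI[where x = "extend_hom G (Term R m) \<theta>"])
        (simp_all add: Term_S restrict_extend_hom[OF Rm A \<theta>] extend_hom_in[OF Rm A \<theta>])
  qed (use restrict_hom_in[OF Rm A] in \<open>auto simp: Term_S\<close>)
  have "restrict_hom G (Term R n) ` coboundaries (LCat (adjI G)) S (ext0 G A) (Suc n)
    = (\<lambda>\<theta>. restrict_hom G (Term R (Suc m)) (coboundary (LCat (adjI G)) S (Suc m) \<theta>)) ` ?X"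
    by (simp only: Suc coboundaries.simps image_image)
  also have "\<dots> = (\<lambda>\<theta>. coboundary (LCat G) R m (restrict_hom G (Term R m) \<theta>)) ` ?X"
    by (rule image_cong[OF refl restrict_hom_coboundary])
  also have "\<dots> = coboundaries (LCat G) R A n"
    by (simp only: Suc coboundaries.simps X image_image)
  finally show ?thesis .
qed

text \<open>From degree one on, restriction to \<open>G\<close> identifies the cochains of \<open>S\<close> with those of \<open>R\<close> one
  degree lower, compatibly with the differentials.\<close>

lemma cohomology_group_shifted:
  "cohomology_group (LCat (adjI G)) S (ext0 G A) (Suc n) \<cong> cohomology_group (LCat G) R A n"
  unfolding cohomology_group_def
proof (rule quotient_iso[where \<phi> = "restrict_hom G (Term R n)" and \<psi> = "extend_hom G (Term R n)"])
  note Rm = projective_resolutionD(1)[OF R_resolution, of n]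
  note A0 = is_module_ext0[OF A]
  let ?L = "LCat G" and ?L' = "LCat (adjI G)"
  let ?Z = "(Hom_group ?L (Term R n) A)\<lparr>carrier := cocycles ?L R A n\<rparr>"
  let ?Z' = "(Hom_group ?L' (Term S (Suc n)) (ext0 G A))\<lparr>carrier := cocycles ?L' S (ext0 G A) (Suc n)\<rparr>"
  note sub = cohomology_subgroups[OF category_LCat R_resolution A]
  note sub' = cohomology_subgroups[OF I.category_LCat S_resolution A0]
  show "comm_group ?Z'" "comm_group ?Z" "subgroup (coboundaries ?L' S (ext0 G A) (Suc n)) ?Z'"
    "subgroup (coboundaries ?L R A n) ?Z"
    by (fact sub sub')+
  have c: "\<eta> \<in> carrier (Hom_group ?L (Term R n) A)" if "\<eta> \<in> cocycles ?L R A n" for \<eta>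
    using that by (simp add: cocycles_iff[OF category_LCat R_resolution A])
  have c': "\<eta> \<in> carrier (Hom_group ?L' (ext0 G (Term R n)) (ext0 G A))"
    if "\<eta> \<in> cocycles ?L' S (ext0 G A) (Suc n)" for \<eta>
    using that by (simp add: cocycles_iff[OF I.category_LCat S_resolution A0] Term_S)
  show "restrict_hom G (Term R n) \<in> hom ?Z' ?Z"
  proof (rule homI)
    fix \<eta> \<theta> assume "\<eta> \<in> carrier ?Z'" "\<theta> \<in> carrier ?Z'"
    then have "\<eta> \<in> cocycles ?L' S (ext0 G A) (Suc n)" "\<theta> \<in> cocycles ?L' S (ext0 G A) (Suc n)" by simp_all
    then show "restrict_hom G (Term R n) (\<eta> \<otimes>\<^bsub>?Z'\<^esub> \<theta>)
        = restrict_hom G (Term R n) \<eta> \<otimes>\<^bsub>?Z\<^esub> restrict_hom G (Term R n) \<theta>"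
      by (simp add: Term_S hom_mult[OF restrict_hom_hom[OF Rm A] c' c'])
  qed (simp add: restrict_hom_cocycle)
  show "extend_hom G (Term R n) \<in> hom ?Z ?Z'"
  proof (rule homI)
    fix \<eta> \<theta> assume "\<eta> \<in> carrier ?Z" "\<theta> \<in> carrier ?Z"
    then have "\<eta> \<in> cocycles ?L R A n" "\<theta> \<in> cocycles ?L R A n" by simp_all
    then show "extend_hom G (Term R n) (\<eta> \<otimes>\<^bsub>?Z\<^esub> \<theta>)
        = extend_hom G (Term R n) \<eta> \<otimes>\<^bsub>?Z'\<^esub> extend_hom G (Term R n) \<theta>"
      by (simp add: Term_S hom_mult[OF extend_hom_hom[OF Rm A] c c])
  qed (simp add: extend_hom_cocycle)
  show "restrict_hom G (Term R n) b \<in> coboundaries ?L R A n"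
    if "b \<in> coboundaries ?L' S (ext0 G A) (Suc n)" for b
    using imageI[OF that, of "restrict_hom G (Term R n)"] unfolding restrict_hom_coboundaries .
  show "extend_hom G (Term R n) b \<in> coboundaries ?L' S (ext0 G A) (Suc n)"
    if "b \<in> coboundaries ?L R A n" for b
  proof -
    have "b \<in> restrict_hom G (Term R n) ` coboundaries ?L' S (ext0 G A) (Suc n)"
      using that unfolding restrict_hom_coboundaries .
    then obtain b' where b': "b' \<in> coboundaries ?L' S (ext0 G A) (Suc n)" "b = restrict_hom G (Term R n) b'"
      by blast
    have "b' \<in> carrier (Hom_group ?L' (ext0 G (Term R n)) (ext0 G A))"
      by (rule c'[OF subsetD[OF coboundaries_subset_cocycles[OF I.category_LCat S_resolution A0] b'(1)]])
    then show ?thesis using b' extend_restrict_hom[OF Rm A] by simp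
  qed
  show "\<exists>a\<in>coboundaries ?L' S (ext0 G A) (Suc n).
      extend_hom G (Term R n) (restrict_hom G (Term R n) \<eta>) = \<eta> \<otimes>\<^bsub>?Z'\<^esub> a" if "\<eta> \<in> carrier ?Z'" for \<eta>
  proof -
    have "\<eta> \<otimes>\<^bsub>?Z'\<^esub> \<one>\<^bsub>?Z'\<^esub> = \<eta>"
      using monoid.r_one[OF group.is_monoid[OF comm_group.axioms(2)[OF sub'(1)]] that] .
    then show ?thesis
      using extend_restrict_hom[OF Rm A c'] that subgroup.one_closed[OF sub'(2)]
      by (intro bexI[of _ "\<one>\<^bsub>?Z'\<^esub>"]) (simp_all del: coboundaries.simps)
  qed
  show "\<exists>b\<in>coboundaries ?L R A n.
      restrict_hom G (Term R n) (extend_hom G (Term R n) \<eta>) = \<eta> \<otimes>\<^bsub>?Z\<^esub> b" if "\<eta> \<in> carrier ?Z" for \<eta>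
  proof -
    have "\<eta> \<otimes>\<^bsub>?Z\<^esub> \<one>\<^bsub>?Z\<^esub> = \<eta>"
      using monoid.r_one[OF group.is_monoid[OF comm_group.axioms(2)[OF sub(1)]] that] .
    then show ?thesis
      using restrict_extend_hom[OF Rm A c] that subgroup.one_closed[OF sub(2)]
      by (intro bexI[of _ "\<one>\<^bsub>?Z\<^esub>"]) (simp_all del: coboundaries.simps)
  qed
qed

end

end

lemma summand_resolution_Ext:
  assumes C: "category C" and M: "is_module C M"
  shows "summand_resolution C M (Ext_resolution C M)"
proof -
  have R: "projective_resolution C M (Ext_resolution C M)"
    by (rule projective_resolution_Ext[OF C M])
  then have "projective C (Term (Ext_resolution C M) n)" for n
    by (simp add: projective_resolution_def)
  from R projective_imp_free_summand[OF C this] show ?thesis by (simp add: summand_resolution_def)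
qed

theorem theorem3p4:
  fixes G :: "'a ordgpd"
    and A :: "('a, 'a \<times> 'a, 'w) cmodule"
    and n :: nat
  assumes "ordered_groupoid G"
    and "is_module (LCat G) A"
    and "n > 0"
  shows "cohomology (adjI G) n (ext0 G A) \<cong> Ext (LCat G) (n - 1) (KG G) A"
proof -
  interpret ordered_groupoid G by (rule assms(1))
  interpret I: ordered_groupoid "adjI G" by (rule ordered_groupoid_adjI)
  obtain m where n: "n = Suc m" using assms(3) by (cases n) auto
  let ?R = "Ext_resolution (LCat G) (KG G)"
  have R: "summand_resolution (LCat G) (KG G) ?R"
    by (rule summand_resolution_Ext[OF category_LCat is_module_KG])
  have "cohomology (adjI G) n (ext0 G A)
    \<cong> cohomology_group (LCat (adjI G)) (shifted_resolution G pack ?R) (ext0 G A) (Suc m)"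
    unfolding cohomology_def Ext_def n
    by (rule cohomology_group_unique[OF I.category_LCat is_module_constZ is_module_ext0[OF assms(2)]
          summand_resolution_Ext[OF I.category_LCat is_module_constZ]
          summand_resolution_shifted[OF inj_pack R]])
  also have "\<dots> \<cong> cohomology_group (LCat G) ?R A m"
    by (rule cohomology_group_shifted[OF inj_pack R assms(2)])
  finally show ?thesis by (simp add: Ext_def n)
qed

end
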